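(* Let $\mathcal W_{\underline{\mathrm{Cub}}}$ be the Grothendieck localizer (in $\mathbf{RTS}$) generated by the class of maps $f:X\to Y$ of regular transition systems such that $\underline{\mathrm{Cub}}(f):\underline{\mathrm{Cub}}(X)\to\underline{\mathrm{Cub}}(Y)$ is a weak equivalence of the left determined model structure of $\mathbf{RTS}$. Let $\mathcal W(\mathcal S)$ be the Grothendieck localizer generated by the set of maps $\mathcal S=\{p_x\mid x\in\Sigma\}$. Then $\mathcal W_{\underline{\mathrm{Cub}}}=\mathcal W(\mathcal S)$.
   Context: Fix a nonempty set $\Sigma$ of labels. A weak transition system is a triple $X=(S,\mu:L\to\Sigma,T=\bigcup_{n\ge1}T_n)$ where $S$ is a set (states), $L$ a set (actions), $\mu$ a map (labelling map), $T_n\subset S\times L^n\times S$ ($n$-transitions), such that: (Multiset axiom) if $(\alpha,u_1,\dots,u_n,\beta)$ is a transition with $n\ge2$, so is $(\alpha,u_{\sigma(1)},\dots,u_{\sigma(n)},\beta)$ for every permutation $\sigma$; (Composition axiom) for $n\ge3$ and $p,q\ge1$ with $p+q<n$, if $(\alpha,u_1,\dots,u_n,\beta)$, $(\alpha,u_1,\dots,u_p,\nu_1)$, $(\nu_1,u_{p+1},\dots,u_n,\beta)$, $(\alpha,u_1,\dots,u_{p+q},\nu_2)$, $(\nu_2,u_{p+q+1},\dots,u_n,\beta)$ are transitions, then so is $(\nu_1,u_{p+1},\dots,u_{p+q},\nu_2)$. A map consists of a map on states and a map on actions commuting with the labelling maps to $\Sigma$, sending transitions to transitions. The category is $\mathbf{WTS}$.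 $X$ is regular if every action $u$ occurs in some $1$-transition $(\alpha,u,\beta)$ and CSA2 holds: for every transition $(\alpha,u_1,\dots,u_n,\beta)$ with $n\ge2$ and every $1\le p<n$ there is a unique state $\nu$ with $(\alpha,u_1,\dots,u_p,\nu)$ and $(\nu,u_{p+1},\dots,u_n,\beta)$ transitions. $\mathbf{RTS}\subset\mathbf{WTS}$ is the full subcategory of regular transition systems. A set is viewed as a transition system with that set of states and no actions. For $n\ge0$ and $x_1,\dots,x_n\in\Sigma$, the $n$-cube $C_n[x_1,\dots,x_n]$ has states $\{0,1\}^n$, actions $(x_1,1),\dots,(x_n,n)$ with $\mu(x_i,i)=x_i$, and transitions $((\epsilon_i),(x_{i_1},i_1),\dots,(x_{i_d},i_d),(\epsilon'_i))$, $d\geq1$, with $i_1,\dots,i_d$ distinct, $\epsilon_i\le\epsilon'_i$ for all $i$, and $\epsilon_i\ne\epsilon_i'$ iff $i\in\{i_1,\dots,i_d\}$. For $n\ge1$, the boundary $\partial C_n[x_1,\dots,x_n]$ is the regular transition system obtained by removing from the $n$-cube all its $n$-transitions (for $n=1$ it is the two-state set $\{0,1\}$, with no action). The double transition $\uparrow\! x\!\uparrow$ ($x\in\Sigma$) has states $1,2,3,4$, one action $x$ labelled $x$, and transitions $(1,x,2),(3,x,4)$. Let $\mathcal I=\{\varnothing\to\{0\},\ \{0,1\}\to\{0\}\}\cup\{\partial C_n[x_1,\dots,x_n]\to C_n[x_1,\dots,x_n]\mid n\ge1,\ x_i\in\Sigma\}\cup\{C_1[x]\to\ \uparrow\! x\!\uparrow\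 \mid x\in\Sigma\}$. For $x\in\Sigma$, $p_x:C_1[x]\sqcup C_1[x]\to\ \uparrow\! x\!\uparrow$ is the map bijective on states sending the $1$-transitions of the two copies of $C_1[x]$ to $(1,x,2)$ and $(3,x,4)$ respectively (both actions go to $x$). The cubification functor is $\underline{\mathrm{Cub}}(X)=\varinjlim_{C_n[x_1,\dots,x_n]\to X}C_n[x_1,\dots,x_n]$, the colimit being taken in $\mathbf{WTS}$ over the comma category of all maps from cubes ($n\ge0$, $x_i\in\Sigma$) to $X$; it restricts to an endofunctor of $\mathbf{RTS}$. The left determined model structure on $\mathbf{RTS}$ is the (existing, combinatorial) model structure with generating cofibrations $\mathcal I$ whose class of weak equivalences is the smallest Grothendieck localizer. Here, $\mathcal C$ being the class of cofibrations generated by $\mathcal I$ in $\mathbf{RTS}$, a Grothendieck localizer is a class of maps satisfying two-out-of-three, containing all maps with the right lifting property with respect to $\mathcal C$, and whose intersection with $\mathcal C$ is closed under pushouts and transfinite compositions. The Grothendieck localizer generated by a class of maps is the smallest one containing it. *)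

theory Defs
  imports Main "HOL-Library.FuncSet" "HOL-Library.Multiset"
begin

unbundle cardinal_syntax

section \<open>Weak and regular transition systems\<close>

text \<open>
  The set of labels is the universe of the type \<open>'l\<close>. All \<open>n\<close>-transitions, \<open>n \<ge> 1\<close>, are kept in one
  set; \<open>n\<close> is the length of the list of actions. Functions are extensional (\<open>undefined\<close> outside
  their domain), so that equality of records is equality of transition systems, resp. of maps.
\<close>

record ('s, 'a, 'l) ts =
  states :: "'s set"
  actions :: "'a set"
  label :: "'a \<Rightarrow> 'l"
  transitions :: "('s \<times> 'a list \<times> 's) set"

definition weak_ts :: "('s, 'a, 'l) ts \<Rightarrow> bool" where
  "weak_ts X \<longleftrightarrow>
     label X \<in> extensional (actions X) \<and>
     (\<forall>\<alpha> us \<beta>. (\<alpha>, us, \<beta>) \<in> transitions X \<longrightarrow>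
        \<alpha> \<in> states X \<and> us \<noteq> [] \<and> set us \<subseteq> actions X \<and> \<beta> \<in> states X) \<and>
     \<comment> \<open>Multiset axiom\<close>
     (\<forall>\<alpha> us vs \<beta>. (\<alpha>, us, \<beta>) \<in> transitions X \<longrightarrow> mset vs = mset us \<longrightarrow>
        (\<alpha>, vs, \<beta>) \<in> transitions X) \<and>
     \<comment> \<open>Composition axiom\<close>
     (\<forall>\<alpha> \<beta> \<nu>1 \<nu>2 us vs ws. us \<noteq> [] \<longrightarrow> vs \<noteq> [] \<longrightarrow> ws \<noteq> [] \<longrightarrow>
        (\<alpha>, us @ vs @ ws, \<beta>) \<in> transitions X \<longrightarrow>
        (\<alpha>, us, \<nu>1) \<in> transitions X \<longrightarrow> (\<nu>1, vs @ ws, \<beta>) \<in> transitions X \<longrightarrow>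
        (\<alpha>, us @ vs, \<nu>2) \<in> transitions X \<longrightarrow> (\<nu>2, ws, \<beta>) \<in> transitions X \<longrightarrow>
        (\<nu>1, vs, \<nu>2) \<in> transitions X)"

definition regular_ts :: "('s, 'a, 'l) ts \<Rightarrow> bool" where
  "regular_ts X \<longleftrightarrow>
     weak_ts X \<and>
     (\<forall>u \<in> actions X. \<exists>\<alpha> \<beta>. (\<alpha>, [u], \<beta>) \<in> transitions X) \<and>
     \<comment> \<open>CSA2\<close>
     (\<forall>\<alpha> us \<beta> p. (\<alpha>, us, \<beta>) \<in> transitions X \<longrightarrow> 1 \<le> p \<longrightarrow> p < length us \<longrightarrow>
        (\<exists>!\<nu>. (\<alpha>, take p us, \<nu>) \<in> transitions X \<and> (\<nu>, drop p us, \<beta>) \<in> transitions X))"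

record ('s, 'a, 't, 'b, 'l) ts_map =
  src :: "('s, 'a, 'l) ts"
  tgt :: "('t, 'b, 'l) ts"
  on_states :: "'s \<Rightarrow> 't"
  on_actions :: "'a \<Rightarrow> 'b"

definition ts_hom ::
    "('s, 'a, 'l) ts \<Rightarrow> ('t, 'b, 'l) ts \<Rightarrow> ('s, 'a, 't, 'b, 'l) ts_map set" where
  "ts_hom X Y = {f. src f = X \<and> tgt f = Y \<and> weak_ts X \<and> weak_ts Y \<and>
     on_states f \<in> states X \<rightarrow>\<^sub>E states Y \<and>
     on_actions f \<in> actions X \<rightarrow>\<^sub>E actions Y \<and>
     (\<forall>u \<in> actions X. label Y (on_actions f u) = label X u) \<and>
     (\<forall>\<alpha> us \<beta>. (\<alpha>, us, \<beta>) \<in> transitions X \<longrightarrow>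
        (on_states f \<alpha>, map (on_actions f) us, on_states f \<beta>) \<in> transitions Y)}"

definition ts_id :: "('s, 'a, 'l) ts \<Rightarrow> ('s, 'a, 's, 'a, 'l) ts_map" where
  "ts_id X = \<lparr>src = X, tgt = X,
     on_states = restrict id (states X), on_actions = restrict id (actions X)\<rparr>"

definition ts_comp ::
    "('t, 'b, 'u, 'c, 'l) ts_map \<Rightarrow> ('s, 'a, 't, 'b, 'l) ts_map \<Rightarrow> ('s, 'a, 'u, 'c, 'l) ts_map"
    (infixl \<open>\<circ>\<^sub>t\<close> 55) where
  "g \<circ>\<^sub>t f = \<lparr>src = src f, tgt = tgt g,
     on_states = compose (states (src f)) (on_states g) (on_states f),
     on_actions = compose (actions (src f)) (on_actions g) (on_actions f)\<rparr>"

definition ts_iso :: "('s, 'a, 't, 'b, 'l) ts_map \<Rightarrow> bool" where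
  "ts_iso f \<longleftrightarrow> f \<in> ts_hom (src f) (tgt f) \<and>
     (\<exists>g \<in> ts_hom (tgt f) (src f). g \<circ>\<^sub>t f = ts_id (src f) \<and> f \<circ>\<^sub>t g = ts_id (tgt f))"

definition arrow_iso :: "('s, 'a, 't, 'b, 'l) ts_map \<Rightarrow> ('u, 'c, 'v, 'd, 'l) ts_map \<Rightarrow> bool" where
  "arrow_iso f g \<longleftrightarrow> (\<exists>a b. ts_iso a \<and> src a = src f \<and> tgt a = src g \<and>
     ts_iso b \<and> src b = tgt f \<and> tgt b = tgt g \<and> b \<circ>\<^sub>t f = g \<circ>\<^sub>t a)"

text \<open>
  The categories. Sets are rendered as subsets of a type \<open>'u\<close> of cardinality less than \<open>\<kappa>\<close>, where
  \<open>\<kappa>\<close> will be an uncountable regular cardinal with \<open>\<kappa> \<le> |UNIV :: 'u set|\<close>. For inaccessible \<open>\<kappa>\<close>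
  these are, up to bijection, the sets of a Grothendieck universe; in general there are enough
  of them for all colimits of fewer than \<open>\<kappa>\<close> objects.
\<close>

definition wts :: "'k rel \<Rightarrow> ('u, 'u, 'l) ts set" where
  "wts \<kappa> = {X. weak_ts X \<and> |states X| <o \<kappa> \<and> |actions X| <o \<kappa>}"

definition rts :: "'k rel \<Rightarrow> ('u, 'u, 'l) ts set" where
  "rts \<kappa> = {X \<in> wts \<kappa>. regular_ts X}"

definition rts_maps :: "'k rel \<Rightarrow> ('u, 'u, 'u, 'u, 'l) ts_map set" where
  "rts_maps \<kappa> = {f. src f \<in> rts \<kappa> \<and> tgt f \<in> rts \<kappa> \<and> f \<in> ts_hom (src f) (tgt f)}"

section \<open>Cubes and generating cofibrations\<close>

definition discrete :: "'s set \<Rightarrow> ('s, 'a, 'l) ts" where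
  "discrete A = \<lparr>states = A, actions = {}, label = (\<lambda>_. undefined), transitions = {}\<rparr>"

definition cube :: "'l list \<Rightarrow> (nat list, 'l \<times> nat, 'l) ts" where
  "cube xs = (let n = length xs; L = {(xs ! i, i) | i. i < n} in
     \<lparr>states = {e. length e = n \<and> set e \<subseteq> {0, 1}},
      actions = L,
      label = restrict fst L,
      transitions = {(e, map (\<lambda>i. (xs ! i, i)) is, e') | e is e'.
         length e = n \<and> set e \<subseteq> {0, 1} \<and> length e' = n \<and> set e' \<subseteq> {0, 1} \<and>
         is \<noteq> [] \<and> distinct is \<and> set is \<subseteq> {..<n} \<and>
         (\<forall>i<n. e ! i \<le> e' ! i \<and> (e ! i \<noteq> e' ! i \<longleftrightarrow> i \<in> set is))}\<rparr>)"

text \<open>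
  Removing the \<open>1\<close>-transitions of a \<open>1\<close>-cube leaves its action unused; it has to be
  removed as well for the boundary to be regular.
\<close>

definition cube_boundary :: "'l list \<Rightarrow> (nat list, 'l \<times> nat, 'l) ts" where
  "cube_boundary xs = (let L = (if length xs = 1 then {} else actions (cube xs)) in
     \<lparr>states = states (cube xs), actions = L, label = restrict fst L,
      transitions = {(\<alpha>, us, \<beta>) \<in> transitions (cube xs). length us \<noteq> length xs}\<rparr>)"

text \<open>
  The states \<open>1, 2, 3, 4\<close> are written \<open>[1], [2], [3], [4]\<close> and the action \<open>x\<close> is written \<open>(x, 0)\<close>,
  which puts all generating cofibrations in one type.
\<close>

definition double_transition :: "'l \<Rightarrow> (nat list, 'l \<times> nat, 'l) ts" where
  "double_transition x =
     \<lparr>states = {[1], [2], [3], [4]}, actions = {(x, 0)}, label = restrict fst {(x, 0)},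
      transitions = {([1], [(x, 0)], [2]), ([3], [(x, 0)], [4])}\<rparr>"

definition boundary_inclusion ::
    "'l list \<Rightarrow> (nat list, 'l \<times> nat, nat list, 'l \<times> nat, 'l) ts_map" where
  "boundary_inclusion xs = \<lparr>src = cube_boundary xs, tgt = cube xs,
     on_states = restrict id (states (cube_boundary xs)),
     on_actions = restrict id (actions (cube_boundary xs))\<rparr>"

definition empty_to_point :: "(nat list, 'l \<times> nat, nat list, 'l \<times> nat, 'l) ts_map" where
  "empty_to_point = \<lparr>src = discrete {}, tgt = discrete {[0]},
     on_states = (\<lambda>_. undefined), on_actions = (\<lambda>_. undefined)\<rparr>"

definition two_points_to_point :: "(nat list, 'l \<times> nat, nat list, 'l \<times> nat, 'l) ts_map" where
  "two_points_to_point = \<lparr>src = discrete {[0], [1]}, tgt = discrete {[0]},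
     on_states = (\<lambda>s \<in> {[0], [1]}. [0]), on_actions = (\<lambda>_. undefined)\<rparr>"

definition cube_to_double ::
    "'l \<Rightarrow> (nat list, 'l \<times> nat, nat list, 'l \<times> nat, 'l) ts_map" where
  "cube_to_double x = \<lparr>src = cube [x], tgt = double_transition x,
     on_states = (\<lambda>s \<in> states (cube [x]). if s = [0] then [1] else [2]),
     on_actions = restrict id (actions (cube [x]))\<rparr>"

definition generating_cofibrations ::
    "(nat list, 'l \<times> nat, nat list, 'l \<times> nat, 'l) ts_map set" where
  "generating_cofibrations =
     {empty_to_point, two_points_to_point} \<union>
     {boundary_inclusion xs | xs. xs \<noteq> []} \<union>
     range cube_to_double"

section \<open>The maps $p_x$\<close>

definition ts_coprod :: "('s, 'a, 'l) ts \<Rightarrow> ('t, 'b, 'l) ts \<Rightarrow> ('s + 't, 'a + 'b, 'l) ts" where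
  "ts_coprod X Y = \<lparr>states = states X <+> states Y,
     actions = actions X <+> actions Y,
     label = restrict (case_sum (label X) (label Y)) (actions X <+> actions Y),
     transitions =
       {(Inl \<alpha>, map Inl us, Inl \<beta>) | \<alpha> us \<beta>. (\<alpha>, us, \<beta>) \<in> transitions X} \<union>
       {(Inr \<alpha>, map Inr us, Inr \<beta>) | \<alpha> us \<beta>. (\<alpha>, us, \<beta>) \<in> transitions Y}\<rparr>"

definition p_map ::
    "'l \<Rightarrow> (nat list + nat list, 'l \<times> nat + 'l \<times> nat, nat list, 'l \<times> nat, 'l) ts_map" where
  "p_map x = (let D = ts_coprod (cube [x]) (cube [x]) in
     \<lparr>src = D, tgt = double_transition x,
      on_states = restrict
        (case_sum (\<lambda>s. if s = [0] then [1] else [2]) (\<lambda>s. if s = [0] then [3] else [4])) (states D),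
      on_actions = restrict (case_sum id id) (actions D)\<rparr>)"

text \<open>
  The maps $p_x$ as a class of maps of \<open>rts \<kappa>\<close>: all copies whose states and actions are in \<open>'u\<close>.
  Localizers contain the isomorphisms and hence, by two-out-of-three, are closed under
  isomorphism of arrows, so the choice of copies does not matter.
\<close>

definition p_maps :: "'k rel \<Rightarrow> ('u, 'u, 'u, 'u, 'l) ts_map set" where
  "p_maps \<kappa> = {f \<in> rts_maps \<kappa>. \<exists>x. arrow_iso f (p_map x)}"

section \<open>Colimits\<close>

text \<open>
  A diagram has a set \<open>I\<close> of indices, the objects \<open>D i\<close>, \<open>i \<in> I\<close>, and a set \<open>A\<close> of triples \<open>(i, h, j)\<close>
  with \<open>h\<close> an arrow of the diagram from \<open>D i\<close> to \<open>D j\<close>. Colimits are taken in the full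
  subcategory with set of objects \<open>Ob\<close>.
\<close>

definition ts_cocone ::
    "'i set \<Rightarrow> ('i \<Rightarrow> ('s, 'a, 'l) ts) \<Rightarrow> ('i \<times> ('s, 'a, 's, 'a, 'l) ts_map \<times> 'i) set \<Rightarrow>
     ('t, 'b, 'l) ts \<Rightarrow> ('i \<Rightarrow> ('s, 'a, 't, 'b, 'l) ts_map) \<Rightarrow> bool" where
  "ts_cocone I D A Z c \<longleftrightarrow>
     (\<forall>i \<in> I. c i \<in> ts_hom (D i) Z) \<and> (\<forall>i h j. (i, h, j) \<in> A \<longrightarrow> c j \<circ>\<^sub>t h = c i)"

definition ts_colimit ::
    "('t, 'b, 'l) ts set \<Rightarrow>
     'i set \<Rightarrow> ('i \<Rightarrow> ('s, 'a, 'l) ts) \<Rightarrow> ('i \<times> ('s, 'a, 's, 'a, 'l) ts_map \<times> 'i) set \<Rightarrow>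
     ('t, 'b, 'l) ts \<Rightarrow> ('i \<Rightarrow> ('s, 'a, 't, 'b, 'l) ts_map) \<Rightarrow> bool" where
  "ts_colimit Ob I D A Z c \<longleftrightarrow>
     Z \<in> Ob \<and> ts_cocone I D A Z c \<and>
     (\<forall>Z' \<in> Ob. \<forall>c'. ts_cocone I D A Z' c' \<longrightarrow>
        (\<exists>!g. g \<in> ts_hom Z Z' \<and> (\<forall>i \<in> I. g \<circ>\<^sub>t c i = c' i)))"

text \<open>The square \<open>f' \<circ> u = u' \<circ> f\<close> is a pushout square; \<open>f'\<close> is the pushout of \<open>f\<close> along \<open>u\<close>.\<close>

definition ts_pushout ::
    "('s, 'a, 'l) ts set \<Rightarrow> ('s, 'a, 's, 'a, 'l) ts_map \<Rightarrow> ('s, 'a, 's, 'a, 'l) ts_map \<Rightarrow>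
     ('s, 'a, 's, 'a, 'l) ts_map \<Rightarrow> ('s, 'a, 's, 'a, 'l) ts_map \<Rightarrow> bool" where
  "ts_pushout Ob f u f' u' \<longleftrightarrow>
     (\<exists>A \<in> Ob. \<exists>B \<in> Ob. \<exists>X \<in> Ob. \<exists>Y \<in> Ob.
        f \<in> ts_hom A B \<and> u \<in> ts_hom A X \<and> f' \<in> ts_hom X Y \<and> u' \<in> ts_hom B Y \<and>
        f' \<circ>\<^sub>t u = u' \<circ>\<^sub>t f \<and>
        (\<forall>Z \<in> Ob. \<forall>v \<in> ts_hom X Z. \<forall>w \<in> ts_hom B Z. v \<circ>\<^sub>t u = w \<circ>\<^sub>t f \<longrightarrow>
           (\<exists>!g. g \<in> ts_hom Y Z \<and> g \<circ>\<^sub>t f' = v \<and> g \<circ>\<^sub>t u' = w)))"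

text \<open>
  Transfinite compositions in \<open>rts \<kappa>\<close> of maps in \<open>M\<close>. The ordinal (nonzero and less than \<open>\<kappa>\<close>) is
  given by a well-order \<open>r\<close>; \<open>j\<close> is the successor of \<open>i\<close> iff \<open>underS r j = under r i\<close>.
\<close>

definition transfinite_compositions ::
    "'k rel \<Rightarrow> ('u, 'u, 'u, 'u, 'l) ts_map set \<Rightarrow> ('u, 'u, 'u, 'u, 'l) ts_map set" where
  "transfinite_compositions \<kappa> M =
     {f. \<exists>(r :: 'u rel) X \<phi> Z c i0.
        Well_order r \<and> |Field r| <o \<kappa> \<and>
        (\<forall>i \<in> Field r. X i \<in> rts \<kappa> \<and> \<phi> i i = ts_id (X i)) \<and>
        (\<forall>i j. (i, j) \<in> r \<longrightarrow> \<phi> i j \<in> ts_hom (X i) (X j)) \<and>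
        (\<forall>i j k. (i, j) \<in> r \<longrightarrow> (j, k) \<in> r \<longrightarrow> \<phi> j k \<circ>\<^sub>t \<phi> i j = \<phi> i k) \<and>
        (\<forall>i \<in> Field r. \<forall>j \<in> Field r. underS r j = under r i \<longrightarrow> \<phi> i j \<in> M) \<and>
        (\<forall>j \<in> Field r. underS r j \<noteq> {} \<longrightarrow> (\<nexists>i. i \<in> Field r \<and> underS r j = under r i) \<longrightarrow>
           ts_colimit (rts \<kappa>) (underS r j) X
             {(i, \<phi> i i', i') | i i'. (i, i') \<in> r \<and> i' \<in> underS r j} (X j) (\<lambda>i. \<phi> i j)) \<and>
        ts_colimit (rts \<kappa>) (Field r) X {(i, \<phi> i i', i') | i i'. (i, i') \<in> r} Z c \<and>
        i0 \<in> Field r \<and> underS r i0 = {} \<and> f = c i0}"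

section \<open>Cubification\<close>

definition cubes_over ::
    "('u, 'u, 'l) ts \<Rightarrow> (nat list, 'l \<times> nat, 'u, 'u, 'l) ts_map set" where
  "cubes_over X = (\<Union>xs. ts_hom (cube xs) X)"

definition is_Cub ::
    "'k rel \<Rightarrow> ('u, 'u, 'l) ts \<Rightarrow> ('u, 'u, 'l) ts \<Rightarrow>
     ((nat list, 'l \<times> nat, 'u, 'u, 'l) ts_map \<Rightarrow> (nat list, 'l \<times> nat, 'u, 'u, 'l) ts_map) \<Rightarrow>
     bool" where
  "is_Cub \<kappa> X Z c \<longleftrightarrow>
     ts_colimit (wts \<kappa>) (cubes_over X) src
       {(k, h, k') | k h k'. k \<in> cubes_over X \<and> k' \<in> cubes_over X \<and>
          h \<in> ts_hom (src k) (src k') \<and> k' \<circ>\<^sub>t h = k} Z c"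

text \<open>
  \<open>g\<close> is the value of the functor Cub at \<open>f\<close>, for some choice of the colimits at the source and
  the target of \<open>f\<close> (two choices give isomorphic arrows).
\<close>

definition is_Cub_map ::
    "'k rel \<Rightarrow> ('u, 'u, 'u, 'u, 'l) ts_map \<Rightarrow> ('u, 'u, 'u, 'u, 'l) ts_map \<Rightarrow> bool" where
  "is_Cub_map \<kappa> f g \<longleftrightarrow>
     g \<in> ts_hom (src g) (tgt g) \<and>
     (\<exists>c d. is_Cub \<kappa> (src f) (src g) c \<and> is_Cub \<kappa> (tgt f) (tgt g) d \<and>
        (\<forall>k \<in> cubes_over (src f). g \<circ>\<^sub>t c k = d (f \<circ>\<^sub>t k)))"

section \<open>Cofibrations and Grothendieck localizers\<close>

definition has_lifting :: "('s, 'a, 't, 'b, 'l) ts_map \<Rightarrow> ('u, 'c, 'v, 'd, 'l) ts_map \<Rightarrow> bool" where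
  "has_lifting i p \<longleftrightarrow>
     (\<forall>u \<in> ts_hom (src i) (src p). \<forall>v \<in> ts_hom (tgt i) (tgt p). p \<circ>\<^sub>t u = v \<circ>\<^sub>t i \<longrightarrow>
        (\<exists>h \<in> ts_hom (tgt i) (src p). h \<circ>\<^sub>t i = u \<and> p \<circ>\<^sub>t h = v))"

definition rlp ::
    "'k rel \<Rightarrow> ('s, 'a, 't, 'b, 'l) ts_map set \<Rightarrow> ('u, 'u, 'u, 'u, 'l) ts_map set" where
  "rlp \<kappa> K = {p \<in> rts_maps \<kappa>. \<forall>i \<in> K. has_lifting i p}"

definition cofibrations :: "'k rel \<Rightarrow> ('u, 'u, 'u, 'u, 'l) ts_map set" where
  "cofibrations \<kappa> = {i \<in> rts_maps \<kappa>.
     \<forall>p \<in> (rlp \<kappa> generating_cofibrations :: ('u, 'u, 'u, 'u, 'l) ts_map set). has_lifting i p}"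

definition grothendieck_localizer :: "'k rel \<Rightarrow> ('u, 'u, 'u, 'u, 'l) ts_map set \<Rightarrow> bool" where
  "grothendieck_localizer \<kappa> W \<longleftrightarrow>
     W \<subseteq> rts_maps \<kappa> \<and>
     (\<forall>f \<in> rts_maps \<kappa>. \<forall>g \<in> rts_maps \<kappa>. tgt f = src g \<longrightarrow>
        (f \<in> W \<and> g \<in> W \<longrightarrow> g \<circ>\<^sub>t f \<in> W) \<and>
        (f \<in> W \<and> g \<circ>\<^sub>t f \<in> W \<longrightarrow> g \<in> W) \<and>
        (g \<in> W \<and> g \<circ>\<^sub>t f \<in> W \<longrightarrow> f \<in> W)) \<and>
     rlp \<kappa> (cofibrations \<kappa> :: ('u, 'u, 'u, 'u, 'l) ts_map set) \<subseteq> W \<and>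
     (\<forall>f \<in> W \<inter> cofibrations \<kappa>. \<forall>u f' u'.
        ts_pushout (rts \<kappa>) f u f' u' \<longrightarrow> f' \<in> W \<inter> cofibrations \<kappa>) \<and>
     transfinite_compositions \<kappa> (W \<inter> cofibrations \<kappa>) \<subseteq> W \<inter> cofibrations \<kappa>"

definition generated_localizer ::
    "'k rel \<Rightarrow> ('u, 'u, 'u, 'u, 'l) ts_map set \<Rightarrow> ('u, 'u, 'u, 'u, 'l) ts_map set" where
  "generated_localizer \<kappa> K = \<Inter>{W. grothendieck_localizer \<kappa> W \<and> K \<subseteq> W}"

text \<open>
  The weak equivalences of the left determined model structure with cofibrations
  \<open>cofibrations \<kappa>\<close> are by definition the smallest Grothendieck localizer.
\<close>

definition left_determined_weqs :: "'k rel \<Rightarrow> ('u, 'u, 'u, 'u, 'l) ts_map set" where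
  "left_determined_weqs \<kappa> = generated_localizer \<kappa> {}"

definition W_Cub :: "'k rel \<Rightarrow> ('u, 'u, 'u, 'u, 'l) ts_map set" where
  "W_Cub \<kappa> = generated_localizer \<kappa>
     {f \<in> rts_maps \<kappa>. \<exists>g. is_Cub_map \<kappa> f g \<and> g \<in> left_determined_weqs \<kappa>}"

end

theory Submission
  imports Defs
begin

text \<open>
  A map of regular transition systems has the right lifting property with respect to \<open>\<I>\<close> iff it is
  bijective on states, surjective on actions and reflects transitions; every map that is injective
  on actions is therefore a cofibration.

  Let \<open>W\<close> be a localizer. If it contains all \<open>p\<^sub>x\<close>, then it contains every map \<open>f : A \<rightarrow> X\<close> that is
  bijective on states and surjective on transitions. Indeed \<open>f\<close> factors through the transition
  system \<open>S\<close> with the actions of \<open>A\<close> and all transitions sent by \<open>f\<close> to transitions of \<open>X\<close>. The map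
  \<open>S \<rightarrow> X\<close> is a trivial fibration, and the inclusion \<open>A \<subseteq> S\<close> is a transfinite composition of
  inclusions in which an action \<open>v\<close> acquires the transitions of an action \<open>u\<close> with \<open>f u = f v\<close>. Such
  a step is in \<open>W\<close>: adding a fresh copy \<open>w\<close> of \<open>u\<close> is a section of a trivial fibration, and so is
  adding just one edge of \<open>w\<close>, up to pushout; by two-out-of-three the extension of \<open>w\<close> from one
  edge to a full copy of \<open>u\<close> is in \<open>W\<close>, too. Push this out along \<open>w \<mapsto> v\<close>, once \<open>v\<close> has been given
  such an edge by means of \<open>p\<^sub>x\<close>.

  The counit \<open>Cub X \<rightarrow> X\<close> is such a map, since in a regular transition system every transition is the
  long diagonal of a cube. By two-out-of-three, \<open>W\<close> then contains \<open>f\<close> whenever it contains \<open>Cub f\<close>.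
  Conversely, \<open>Cub p\<^sub>x\<close> is an isomorphism.
\<close>

section \<open>Weak transition systems and their maps\<close>

text \<open>Two requirements shape the proof. A localizer is only known to be closed under pushouts
  of cofibrations, whereas \<open>p_map x\<close> merges two actions, so injectivity on actions
  fails for it; what is glued instead is an inclusion that two-out-of-three relates to it. Moreover
  every system that occurs must be regular, although new transitions can destroy the uniqueness of
  intermediate states. The gluings therefore leave the states alone and stay over a regular system
  into which the states inject. Uniqueness is inherited from there, and only the existence of
  intermediate states, isolated in \<open>good_trans\<close>, has to be followed through each
  construction. With fixed states the pushouts and transfinite compositions in question are plain
  unions of transitions. Cubification is given by its universal property alone. That its values are
  regular and have the states of \<open>X\<close> is extracted from uniqueness of mediating maps, by
  comparing the colimit with the part of it that the legs cover.\<close>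

lemma weak_ts_transD:
  assumes "weak_ts X" "(\<alpha>, us, \<beta>) \<in> transitions X"
  shows "\<alpha> \<in> states X" "us \<noteq> []" "set us \<subseteq> actions X" "\<beta> \<in> states X"
  using assms unfolding weak_ts_def by blast+

lemma weak_ts_msetD:
  assumes "weak_ts X" "(\<alpha>, us, \<beta>) \<in> transitions X" "mset vs = mset us"
  shows "(\<alpha>, vs, \<beta>) \<in> transitions X"
  using assms unfolding weak_ts_def by blast

lemma weak_ts_compD:
  assumes "weak_ts X" "us \<noteq> []" "vs \<noteq> []" "ws \<noteq> []"
    "(\<alpha>, us @ vs @ ws, \<beta>) \<in> transitions X"
    "(\<alpha>, us, \<nu>1) \<in> transitions X" "(\<nu>1, vs @ ws, \<beta>) \<in> transitions X"
    "(\<alpha>, us @ vs, \<nu>2) \<in> transitions X" "(\<nu>2, ws, \<beta>) \<in> transitions X"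
  shows "(\<nu>1, vs, \<nu>2) \<in> transitions X"
  using assms unfolding weak_ts_def by blast

lemma regular_ts_weak: "regular_ts X \<Longrightarrow> weak_ts X"
  by (simp add: regular_ts_def)

lemma regular_ts_usedD:
  assumes "regular_ts X" "u \<in> actions X"
  obtains \<alpha> \<beta> where "(\<alpha>, [u], \<beta>) \<in> transitions X"
  using assms unfolding regular_ts_def by blast

lemma regular_ts_split:
  assumes "regular_ts X" "(\<alpha>, us @ vs, \<beta>) \<in> transitions X" "us \<noteq> []" "vs \<noteq> []"
  shows "\<exists>!\<nu>. (\<alpha>, us, \<nu>) \<in> transitions X \<and> (\<nu>, vs, \<beta>) \<in> transitions X"
proof -
  have *: "\<And>\<alpha> ws \<beta> p. (\<alpha>, ws, \<beta>) \<in> transitions X \<Longrightarrow> 1 \<le> p \<Longrightarrow> p < length ws \<Longrightarrow>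
        (\<exists>!\<nu>. (\<alpha>, take p ws, \<nu>) \<in> transitions X \<and> (\<nu>, drop p ws, \<beta>) \<in> transitions X)"
    using assms(1) unfolding regular_ts_def by blast
  show ?thesis
    using *[OF assms(2), of "length us"] assms(3,4) by (simp add: Suc_le_eq)
qed

definition mk_map ::
    "('s, 'a, 'l) ts \<Rightarrow> ('t, 'b, 'l) ts \<Rightarrow> ('s \<Rightarrow> 't) \<Rightarrow> ('a \<Rightarrow> 'b) \<Rightarrow> ('s, 'a, 't, 'b, 'l) ts_map" where
  "mk_map X Y f g = \<lparr>src = X, tgt = Y,
     on_states = restrict f (states X), on_actions = restrict g (actions X)\<rparr>"

lemma mk_map_simps [simp]:
  "src (mk_map X Y f g) = X" "tgt (mk_map X Y f g) = Y"
  "s \<in> states X \<Longrightarrow> on_states (mk_map X Y f g) s = f s"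
  "a \<in> actions X \<Longrightarrow> on_actions (mk_map X Y f g) a = g a"
  by (auto simp: mk_map_def)

lemma ts_homI:
  assumes "src f = X" "tgt f = Y" "weak_ts X" "weak_ts Y"
    "on_states f \<in> states X \<rightarrow>\<^sub>E states Y" "on_actions f \<in> actions X \<rightarrow>\<^sub>E actions Y"
    "\<And>u. u \<in> actions X \<Longrightarrow> label Y (on_actions f u) = label X u"
    "\<And>\<alpha> us \<beta>. (\<alpha>, us, \<beta>) \<in> transitions X \<Longrightarrow>
        (on_states f \<alpha>, map (on_actions f) us, on_states f \<beta>) \<in> transitions Y"
  shows "f \<in> ts_hom X Y"
  using assms unfolding ts_hom_def by blast

lemma mk_map_hom:
  assumes "weak_ts X" "weak_ts Y"
    "\<And>s. s \<in> states X \<Longrightarrow> f s \<in> states Y" "\<And>a. a \<in> actions X \<Longrightarrow> g a \<in> actions Y"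
    "\<And>a. a \<in> actions X \<Longrightarrow> label Y (g a) = label X a"
    "\<And>\<alpha> us \<beta>. (\<alpha>, us, \<beta>) \<in> transitions X \<Longrightarrow> (f \<alpha>, map g us, f \<beta>) \<in> transitions Y"
  shows "mk_map X Y f g \<in> ts_hom X Y"
proof (rule ts_homI)
  fix \<alpha> us \<beta> assume t: "(\<alpha>, us, \<beta>) \<in> transitions X"
  have "map (on_actions (mk_map X Y f g)) us = map g us"
    using weak_ts_transD(3)[OF assms(1) t] by (auto simp: mk_map_def)
  then show "(on_states (mk_map X Y f g) \<alpha>, map (on_actions (mk_map X Y f g)) us,
      on_states (mk_map X Y f g) \<beta>) \<in> transitions Y"
    using weak_ts_transD[OF assms(1) t] assms(6)[OF t] by (simp del: map_eq_conv)
qed (use assms in \<open>auto simp: mk_map_def\<close>)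

lemma ts_homD:
  assumes "f \<in> ts_hom X Y"
  shows "src f = X" "tgt f = Y" "weak_ts X" "weak_ts Y"
    "s \<in> states X \<Longrightarrow> on_states f s \<in> states Y"
    "a \<in> actions X \<Longrightarrow> on_actions f a \<in> actions Y"
    "a \<in> actions X \<Longrightarrow> label Y (on_actions f a) = label X a"
    "(\<alpha>, us, \<beta>) \<in> transitions X \<Longrightarrow>
        (on_states f \<alpha>, map (on_actions f) us, on_states f \<beta>) \<in> transitions Y"
    "on_states f \<in> extensional (states X)" "on_actions f \<in> extensional (actions X)"
  using assms unfolding ts_hom_def by (auto simp: PiE_def)

lemma ts_hom_eqI:
  assumes "f \<in> ts_hom X Y" "g \<in> ts_hom X Y"
    "\<And>s. s \<in> states X \<Longrightarrow> on_states f s = on_states g s"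
    "\<And>a. a \<in> actions X \<Longrightarrow> on_actions f a = on_actions g a"
  shows "f = g"
proof (rule ts_map.equality)
  show "on_states f = on_states g" "on_actions f = on_actions g"
    using ts_homD[OF assms(1)] ts_homD[OF assms(2)] assms(3,4)
    by (auto intro: extensionalityI)
qed (use ts_homD[OF assms(1)] ts_homD[OF assms(2)] in auto)

lemma ts_comp_simps [simp]:
  "src (g \<circ>\<^sub>t f) = src f" "tgt (g \<circ>\<^sub>t f) = tgt g"
  "s \<in> states (src f) \<Longrightarrow> on_states (g \<circ>\<^sub>t f) s = on_states g (on_states f s)"
  "a \<in> actions (src f) \<Longrightarrow> on_actions (g \<circ>\<^sub>t f) a = on_actions g (on_actions f a)"
  by (auto simp: ts_comp_def compose_def)

lemma ts_comp_hom:
  assumes f: "f \<in> ts_hom X Y" and g: "g \<in> ts_hom Y Z"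
  shows "g \<circ>\<^sub>t f \<in> ts_hom X Z"
proof (rule ts_homI)
  fix \<alpha> us \<beta> assume t: "(\<alpha>, us, \<beta>) \<in> transitions X"
  have "map (on_actions (g \<circ>\<^sub>t f)) us = map (on_actions g) (map (on_actions f) us)"
    using weak_ts_transD(3)[OF ts_homD(3)[OF f] t] ts_homD(1)[OF f] by auto
  then show "(on_states (g \<circ>\<^sub>t f) \<alpha>, map (on_actions (g \<circ>\<^sub>t f)) us,
      on_states (g \<circ>\<^sub>t f) \<beta>) \<in> transitions Z"
    using weak_ts_transD[OF ts_homD(3)[OF f] t] ts_homD(1)[OF f]
      ts_homD(8)[OF g ts_homD(8)[OF f t]] by (simp del: map_eq_conv)
qed (use ts_homD[OF f] ts_homD[OF g] in \<open>auto simp: ts_comp_def compose_def\<close>)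

lemma ts_id_mk: "ts_id X = mk_map X X id id"
  by (simp add: ts_id_def mk_map_def)

lemma ts_id_hom: "weak_ts X \<Longrightarrow> ts_id X \<in> ts_hom X X"
  unfolding ts_id_mk by (rule mk_map_hom) auto

lemma ts_comp_id:
  assumes "f \<in> ts_hom X Y"
  shows "f \<circ>\<^sub>t ts_id X = f" "ts_id Y \<circ>\<^sub>t f = f"
proof -
  note f = ts_homD[OF assms]
  show "f \<circ>\<^sub>t ts_id X = f"
    by (rule ts_hom_eqI[OF ts_comp_hom[OF ts_id_hom[OF f(3)] assms] assms])
       (auto simp: ts_id_mk)
  show "ts_id Y \<circ>\<^sub>t f = f"
    by (rule ts_hom_eqI[OF ts_comp_hom[OF assms ts_id_hom[OF f(4)]] assms])
       (use f in \<open>auto simp: ts_id_mk\<close>)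
qed

lemma ts_comp_assoc:
  assumes "f \<in> ts_hom X Y" "g \<in> ts_hom Y Z" "h \<in> ts_hom Z V"
  shows "h \<circ>\<^sub>t g \<circ>\<^sub>t f = h \<circ>\<^sub>t (g \<circ>\<^sub>t f)"
  by (rule ts_hom_eqI[OF ts_comp_hom[OF assms(1) ts_comp_hom[OF assms(2,3)]]
          ts_comp_hom[OF ts_comp_hom[OF assms(1,2)] assms(3)]])
     (use ts_homD[OF assms(1)] ts_homD[OF assms(2)] in auto)

definition sub_ts :: "('s, 'a, 'l) ts \<Rightarrow> ('s, 'a, 'l) ts \<Rightarrow> bool" where
  "sub_ts X Y \<longleftrightarrow> states X \<subseteq> states Y \<and> actions X \<subseteq> actions Y \<and>
     (\<forall>a \<in> actions X. label Y a = label X a) \<and> transitions X \<subseteq> transitions Y"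

abbreviation ts_incl :: "('s, 'a, 'l) ts \<Rightarrow> ('s, 'a, 'l) ts \<Rightarrow> ('s, 'a, 's, 'a, 'l) ts_map" where
  "ts_incl X Y \<equiv> mk_map X Y id id"

lemma ts_incl_hom: "sub_ts X Y \<Longrightarrow> weak_ts X \<Longrightarrow> weak_ts Y \<Longrightarrow> ts_incl X Y \<in> ts_hom X Y"
  by (rule mk_map_hom) (auto simp: sub_ts_def)

lemma ts_incl_comp:
  assumes "sub_ts X Y"
  shows "ts_incl Y Z \<circ>\<^sub>t ts_incl X Y = ts_incl X Z"
  using assms by (auto simp: ts_comp_def mk_map_def sub_ts_def compose_def fun_eq_iff)

abbreviation trans_image ::
    "('s \<Rightarrow> 't) \<Rightarrow> ('a \<Rightarrow> 'b) \<Rightarrow> ('s \<times> 'a list \<times> 's) set \<Rightarrow> 't \<Rightarrow> 'b list \<Rightarrow> 't \<Rightarrow> bool" where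
  "trans_image f h T \<alpha> us \<beta> \<equiv>
     \<exists>\<alpha>' us' \<beta>'. (\<alpha>', us', \<beta>') \<in> T \<and> \<alpha> = f \<alpha>' \<and> us = map h us' \<and> \<beta> = f \<beta>'"

section \<open>Regularity\<close>

text \<open>The existence halves of CSA2 and of the composition axiom: together with uniqueness of
  intermediate states they give regularity, and unlike the axioms themselves they are inherited
  by unions and by images.\<close>

definition good_trans :: "('s \<times> 'a list \<times> 's) set \<Rightarrow> bool" where
  "good_trans T \<longleftrightarrow>
     (\<forall>\<alpha> us vs \<beta>. (\<alpha>, us, \<beta>) \<in> T \<longrightarrow> mset vs = mset us \<longrightarrow> (\<alpha>, vs, \<beta>) \<in> T) \<and>
     (\<forall>\<alpha> us vs \<beta>. (\<alpha>, us @ vs, \<beta>) \<in> T \<longrightarrow> us \<noteq> [] \<longrightarrow> vs \<noteq> [] \<longrightarrow>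
        (\<exists>\<nu>. (\<alpha>, us, \<nu>) \<in> T \<and> (\<nu>, vs, \<beta>) \<in> T)) \<and>
     (\<forall>\<alpha> us vs ws \<beta>. (\<alpha>, us @ vs @ ws, \<beta>) \<in> T \<longrightarrow> us \<noteq> [] \<longrightarrow> vs \<noteq> [] \<longrightarrow> ws \<noteq> [] \<longrightarrow>
        (\<exists>\<nu>1 \<nu>2. (\<alpha>, us, \<nu>1) \<in> T \<and> (\<nu>1, vs @ ws, \<beta>) \<in> T \<and>
           (\<alpha>, us @ vs, \<nu>2) \<in> T \<and> (\<nu>2, ws, \<beta>) \<in> T \<and> (\<nu>1, vs, \<nu>2) \<in> T))"

lemma good_transD:
  assumes "good_trans T"
  shows "(\<alpha>, us, \<beta>) \<in> T \<Longrightarrow> mset vs = mset us \<Longrightarrow> (\<alpha>, vs, \<beta>) \<in> T"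
    "(\<alpha>, us @ vs, \<beta>) \<in> T \<Longrightarrow> us \<noteq> [] \<Longrightarrow> vs \<noteq> [] \<Longrightarrow> \<exists>\<nu>. (\<alpha>, us, \<nu>) \<in> T \<and> (\<nu>, vs, \<beta>) \<in> T"
    "(\<alpha>, us @ vs @ ws, \<beta>) \<in> T \<Longrightarrow> us \<noteq> [] \<Longrightarrow> vs \<noteq> [] \<Longrightarrow> ws \<noteq> [] \<Longrightarrow>
        (\<exists>\<nu>1 \<nu>2. (\<alpha>, us, \<nu>1) \<in> T \<and> (\<nu>1, vs @ ws, \<beta>) \<in> T \<and>
           (\<alpha>, us @ vs, \<nu>2) \<in> T \<and> (\<nu>2, ws, \<beta>) \<in> T \<and> (\<nu>1, vs, \<nu>2) \<in> T)"
  using assms unfolding good_trans_def by blast+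

lemma regular_ts_good:
  assumes X: "regular_ts X"
  shows "good_trans (transitions X)"
  unfolding good_trans_def
proof (intro conjI allI impI)
  note w = regular_ts_weak[OF X]
  fix \<alpha> us vs ws \<beta>
  assume t: "(\<alpha>, us @ vs @ ws, \<beta>) \<in> transitions X" "us \<noteq> []" "vs \<noteq> []" "ws \<noteq> []"
  obtain \<nu>1 where 1: "(\<alpha>, us, \<nu>1) \<in> transitions X" "(\<nu>1, vs @ ws, \<beta>) \<in> transitions X"
    using regular_ts_split[OF X t(1,2)] t(3) by blast
  obtain \<nu>2 where 2: "(\<alpha>, us @ vs, \<nu>2) \<in> transitions X" "(\<nu>2, ws, \<beta>) \<in> transitions X"
    using regular_ts_split[OF X, of \<alpha> "us @ vs" ws \<beta>] t by auto
  show "\<exists>\<nu>1 \<nu>2. (\<alpha>, us, \<nu>1) \<in> transitions X \<and> (\<nu>1, vs @ ws, \<beta>) \<in> transitions X \<and>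
           (\<alpha>, us @ vs, \<nu>2) \<in> transitions X \<and> (\<nu>2, ws, \<beta>) \<in> transitions X \<and>
           (\<nu>1, vs, \<nu>2) \<in> transitions X"
    using 1 2 weak_ts_compD[OF w t(2-4,1) 1 2] by blast
qed (use weak_ts_msetD[OF regular_ts_weak[OF X]] regular_ts_split[OF X] in blast)+

text \<open>The composition axiom speaks of arbitrary intermediate states, whereas
  \<open>good_trans\<close> provides only some. Uniqueness identifies the two, so the axiom follows
  from its existence half.\<close>

lemma regular_tsI:
  assumes ext: "label X \<in> extensional (actions X)"
    and typed: "\<And>\<alpha> us \<beta>. (\<alpha>, us, \<beta>) \<in> transitions X \<Longrightarrow>
        \<alpha> \<in> states X \<and> us \<noteq> [] \<and> set us \<subseteq> actions X \<and> \<beta> \<in> states X"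
    and used: "\<And>u. u \<in> actions X \<Longrightarrow> \<exists>\<alpha> \<beta>. (\<alpha>, [u], \<beta>) \<in> transitions X"
    and good: "good_trans (transitions X)"
    and uniq: "\<And>\<alpha> us vs \<beta> \<nu> \<nu>'. (\<alpha>, us @ vs, \<beta>) \<in> transitions X \<Longrightarrow> us \<noteq> [] \<Longrightarrow> vs \<noteq> [] \<Longrightarrow>
        (\<alpha>, us, \<nu>) \<in> transitions X \<Longrightarrow> (\<nu>, vs, \<beta>) \<in> transitions X \<Longrightarrow>
        (\<alpha>, us, \<nu>') \<in> transitions X \<Longrightarrow> (\<nu>', vs, \<beta>) \<in> transitions X \<Longrightarrow> \<nu> = \<nu>'"
  shows "regular_ts X"
  unfolding regular_ts_def weak_ts_def
proof (intro conjI allI impI ballI)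
  fix \<alpha> \<beta> \<nu>1 \<nu>2 us vs ws
  assume ne: "us \<noteq> []" "vs \<noteq> []" "ws \<noteq> []"
    and t: "(\<alpha>, us @ vs @ ws, \<beta>) \<in> transitions X"
    "(\<alpha>, us, \<nu>1) \<in> transitions X" "(\<nu>1, vs @ ws, \<beta>) \<in> transitions X"
    "(\<alpha>, us @ vs, \<nu>2) \<in> transitions X" "(\<nu>2, ws, \<beta>) \<in> transitions X"
  obtain \<mu>1 \<mu>2 where m: "(\<alpha>, us, \<mu>1) \<in> transitions X" "(\<mu>1, vs @ ws, \<beta>) \<in> transitions X"
    "(\<alpha>, us @ vs, \<mu>2) \<in> transitions X" "(\<mu>2, ws, \<beta>) \<in> transitions X"
    "(\<mu>1, vs, \<mu>2) \<in> transitions X"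
    using good_transD(3)[OF good t(1) ne] by blast
  have "\<nu>1 = \<mu>1" using uniq[of \<alpha> us "vs @ ws" \<beta>] t m ne by blast
  moreover have "\<nu>2 = \<mu>2" using uniq[of \<alpha> "us @ vs" ws \<beta>] t m ne by simp
  ultimately show "(\<nu>1, vs, \<nu>2) \<in> transitions X" using m by simp
next
  fix \<alpha> us \<beta> p
  assume t: "(\<alpha>, us, \<beta>) \<in> transitions X" and p: "1 \<le> p" "p < length us"
  have ne: "take p us \<noteq> []" "drop p us \<noteq> []" and t': "(\<alpha>, take p us @ drop p us, \<beta>) \<in> transitions X"
    using p t by auto
  show "\<exists>!\<nu>. (\<alpha>, take p us, \<nu>) \<in> transitions X \<and> (\<nu>, drop p us, \<beta>) \<in> transitions X"
    using good_transD(2)[OF good t' ne] uniq[OF t' ne] by blast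
qed (use ext typed used good_transD(1)[OF good] in blast)+

text \<open>Weaker than a morphism on purpose: labels do not enter and \<open>B\<close> is not
  assumed to be a transition system, so the condition is available before the axioms for
  \<open>B\<close> are known.\<close>

definition lies_over ::
    "('s, 'a, 'l) ts \<Rightarrow> ('t, 'b, 'l) ts \<Rightarrow> ('s \<Rightarrow> 't) \<Rightarrow> ('a \<Rightarrow> 'b) \<Rightarrow> bool" where
  "lies_over B X f h \<longleftrightarrow> regular_ts X \<and> inj_on f (states B) \<and>
     (\<forall>\<alpha> us \<beta>. (\<alpha>, us, \<beta>) \<in> transitions B \<longrightarrow> (f \<alpha>, map h us, f \<beta>) \<in> transitions X)"

text \<open>Two intermediate states for one splitting in \<open>B\<close> go to intermediate states
  for one splitting in \<open>X\<close>. They agree there by CSA2, and \<open>f\<close> is injective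
  on states.\<close>

lemma regular_ts_overI:
  assumes over: "lies_over B X f h"
    and ext: "label B \<in> extensional (actions B)"
    and typed: "\<And>\<alpha> us \<beta>. (\<alpha>, us, \<beta>) \<in> transitions B \<Longrightarrow>
        \<alpha> \<in> states B \<and> us \<noteq> [] \<and> set us \<subseteq> actions B \<and> \<beta> \<in> states B"
    and used: "\<And>u. u \<in> actions B \<Longrightarrow> \<exists>\<alpha> \<beta>. (\<alpha>, [u], \<beta>) \<in> transitions B"
    and good: "good_trans (transitions B)"
  shows "regular_ts B"
proof (rule regular_tsI[OF ext typed used good])
  have X: "regular_ts X" and inj: "inj_on f (states B)"
    and m: "\<And>\<alpha> us \<beta>. (\<alpha>, us, \<beta>) \<in> transitions B \<Longrightarrow> (f \<alpha>, map h us, f \<beta>) \<in> transitions X"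
    using over by (auto simp: lies_over_def)
  fix \<alpha> us vs \<beta> \<nu> \<nu>'
  assume t: "(\<alpha>, us @ vs, \<beta>) \<in> transitions B" "us \<noteq> []" "vs \<noteq> []"
    "(\<alpha>, us, \<nu>) \<in> transitions B" "(\<nu>, vs, \<beta>) \<in> transitions B"
    "(\<alpha>, us, \<nu>') \<in> transitions B" "(\<nu>', vs, \<beta>) \<in> transitions B"
  have "f \<nu> = f \<nu>'"
    using regular_ts_split[OF X, of "f \<alpha>" "map h us" "map h vs" "f \<beta>"] m[OF t(1)]
      m[OF t(4)] m[OF t(5)] m[OF t(6)] m[OF t(7)] t(2,3) by auto
  then show "\<nu> = \<nu>'" using inj typed[OF t(4)] typed[OF t(6)] by (auto dest: inj_onD)
qed

text \<open>Letters are exchanged position by position, independently of each other;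
  \<open>R\<close> is a relation because an occurrence may be kept as well as exchanged.\<close>

definition subst_trans :: "('a \<Rightarrow> 'b \<Rightarrow> bool) \<Rightarrow> ('s \<times> 'a list \<times> 's) set \<Rightarrow> ('s \<times> 'b list \<times> 's) set" where
  "subst_trans R T = {(\<alpha>, vs, \<beta>). \<exists>us. (\<alpha>, us, \<beta>) \<in> T \<and> list_all2 R us vs}"

text \<open>A transition that can be split has length at least 2, so it does not come from
  \<open>E\<close>. Its word is related to a word of \<open>T\<close>, and splittings and
  permutations of that word are carried along the relation.\<close>

lemma good_trans_subst:
  assumes T: "good_trans T"
    and E: "\<And>\<alpha> us \<beta>. (\<alpha>, us, \<beta>) \<in> E \<Longrightarrow> length us = 1"
  shows "good_trans (E \<union> subst_trans R T)"
proof -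
  let ?T = "E \<union> subst_trans R T"
  have sI: "\<And>\<alpha> us \<beta> vs. (\<alpha>, us, \<beta>) \<in> T \<Longrightarrow> list_all2 R us vs \<Longrightarrow> (\<alpha>, vs, \<beta>) \<in> ?T"
    unfolding subst_trans_def by blast
  have long: "\<exists>us. (\<alpha>, us, \<beta>) \<in> T \<and> list_all2 R us vs"
    if "(\<alpha>, vs, \<beta>) \<in> ?T" "length vs \<noteq> 1" for \<alpha> vs \<beta>
    using that E unfolding subst_trans_def by blast
  show ?thesis
    unfolding good_trans_def
  proof (intro conjI allI impI)
    fix \<alpha> vs ws \<beta> assume t: "(\<alpha>, vs, \<beta>) \<in> ?T" and m: "mset ws = mset vs"
    show "(\<alpha>, ws, \<beta>) \<in> ?T"
    proof (cases "length vs = 1")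
      case True
      then have "ws = vs" using m by (auto simp: length_Suc_conv)
      then show ?thesis using t by simp
    next
      case False
      then obtain us where us: "(\<alpha>, us, \<beta>) \<in> T" "list_all2 R us vs" using long[OF t] by blast
      \<comment> \<open>The reordering fact permutes the left-hand list, while the permuted word
        stands on the right of \<open>R\<close>; hence the reversal.\<close>
      then have "list_all2 (\<lambda>b a. R a b) vs us" by (simp add: list_all2_conv_all_nth)
      then obtain us' where "list_all2 (\<lambda>b a. R a b) ws us'" "mset us' = mset us"
        using list_all2_reorder_left_invariance[OF _ m] by blast
      then show ?thesis
        using sI[of \<alpha> us' \<beta> ws] good_transD(1)[OF T us(1)] by (auto simp: list_all2_conv_all_nth)
    qed
  next
    fix \<alpha> us vs \<beta> assume t: "(\<alpha>, us @ vs, \<beta>) \<in> ?T" and ne: "us \<noteq> []" "vs \<noteq> []"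
    have "length (us @ vs) \<noteq> 1" using ne by (cases us) auto
    then obtain us' vs' where "(\<alpha>, us' @ vs', \<beta>) \<in> T" and r: "list_all2 R us' us" "list_all2 R vs' vs"
      using long[OF t] by (auto simp: list_all2_append2)
    moreover have "us' \<noteq> []" "vs' \<noteq> []" using r ne by auto
    ultimately obtain \<nu> where "(\<alpha>, us', \<nu>) \<in> T" "(\<nu>, vs', \<beta>) \<in> T"
      using good_transD(2)[OF T] by blast
    then show "\<exists>\<nu>. (\<alpha>, us, \<nu>) \<in> ?T \<and> (\<nu>, vs, \<beta>) \<in> ?T" using sI r by blast
  next
    fix \<alpha> us vs ws \<beta>
    assume t: "(\<alpha>, us @ vs @ ws, \<beta>) \<in> ?T" and ne: "us \<noteq> []" "vs \<noteq> []" "ws \<noteq> []"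
    have "length (us @ vs @ ws) \<noteq> 1" using ne by (cases us) auto
    then obtain us' vs' ws' where u: "(\<alpha>, us' @ vs' @ ws', \<beta>) \<in> T"
      and r: "list_all2 R us' us" "list_all2 R vs' vs" "list_all2 R ws' ws"
      using long[OF t] by (auto simp: list_all2_append2)
    moreover have "us' \<noteq> []" "vs' \<noteq> []" "ws' \<noteq> []" using r ne by auto
    ultimately obtain \<nu>1 \<nu>2 where
      "(\<alpha>, us', \<nu>1) \<in> T" "(\<nu>1, vs' @ ws', \<beta>) \<in> T" "(\<alpha>, us' @ vs', \<nu>2) \<in> T" "(\<nu>2, ws', \<beta>) \<in> T"
      "(\<nu>1, vs', \<nu>2) \<in> T"
      using good_transD(3)[OF T u] by blast
    then show "\<exists>\<nu>1 \<nu>2. (\<alpha>, us, \<nu>1) \<in> ?T \<and> (\<nu>1, vs @ ws, \<beta>) \<in> ?T \<and>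
           (\<alpha>, us @ vs, \<nu>2) \<in> ?T \<and> (\<nu>2, ws, \<beta>) \<in> ?T \<and> (\<nu>1, vs, \<nu>2) \<in> ?T"
      using sI r by (meson list_all2_appendI)
  qed
qed

section \<open>Cubes\<close>

text \<open>In transitions of a cube it is applied only where the coordinates in \<open>I\<close>
  are 0, which explains the name.\<close>

definition flip :: "nat list \<Rightarrow> nat set \<Rightarrow> nat list" where
  "flip e I = map (\<lambda>i. if i \<in> I then 1 else e ! i) [0..<length e]"

lemma flip_simps [simp]:
  "length (flip e I) = length e"
  "i < length e \<Longrightarrow> flip e I ! i = (if i \<in> I then 1 else e ! i)"
  by (auto simp: flip_def)

lemma flip_flip: "flip (flip e I) J = flip e (I \<union> J)"
  by (rule nth_equalityI) auto


abbreviation cube_act :: "'l list \<Rightarrow> nat \<Rightarrow> 'l \<times> nat" where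
  "cube_act xs i \<equiv> (xs ! i, i)"

lemma cube_states: "states (cube xs) = {e. length e = length xs \<and> set e \<subseteq> {0, 1}}"
  and cube_actions: "actions (cube xs) = cube_act xs ` {..<length xs}"
  and cube_label: "label (cube xs) = restrict fst (actions (cube xs))"
  by (auto simp: cube_def Let_def)

lemma nth_binary: "set e \<subseteq> {0, 1} \<Longrightarrow> i < length e \<Longrightarrow> e ! i = 0 \<or> e ! i = (1 :: nat)"
  using nth_mem by blast

lemma set_flip:
  assumes "set e \<subseteq> {0, 1}"
  shows "set (flip e I) \<subseteq> {0, 1}"
proof
  fix x assume "x \<in> set (flip e I)"
  then obtain i where "i < length e" "x = flip e I ! i" by (auto simp: in_set_conv_nth)
  then show "x \<in> {0, 1}" using nth_binary[OF assms] by simp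
qed

text \<open>Among 0 and 1, being at most and being different mean 0 before and 1 after. So the final
  vertex is a function of the initial one and of the indices, and the cube is deterministic.\<close>

lemma cube_trans_iff:
  "(e, us, e') \<in> transitions (cube xs) \<longleftrightarrow>
     (\<exists>is. us = map (cube_act xs) is \<and> e \<in> states (cube xs) \<and> is \<noteq> [] \<and> distinct is \<and>
        set is \<subseteq> {..<length xs} \<and> (\<forall>i \<in> set is. e ! i = 0) \<and> e' = flip e (set is))"
  (is "?L \<longleftrightarrow> ?R")
proof
  assume ?L
  then obtain "is" where p: "us = map (cube_act xs) is" "length e = length xs" "set e \<subseteq> {0, 1}"
    "length e' = length xs" "set e' \<subseteq> {0, 1}" "is \<noteq> []" "distinct is" "set is \<subseteq> {..<length xs}"
    "\<forall>i<length xs. e ! i \<le> e' ! i \<and> (e ! i \<noteq> e' ! i \<longleftrightarrow> i \<in> set is)"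
    unfolding cube_def Let_def by auto
  have v: "e ! i = 0 \<or> e ! i = 1" "e' ! i = 0 \<or> e' ! i = 1" if "i < length xs" for i
    using p that nth_binary by auto
  have 0: "\<forall>i \<in> set is. e ! i = 0 \<and> e' ! i = 1"
  proof
    fix i assume "i \<in> set is"
    then show "e ! i = 0 \<and> e' ! i = 1" using p(8,9) v[of i] by fastforce
  qed
  have "e' = flip e (set is)"
    by (rule nth_equalityI) (use p 0 in auto)
  then show ?R using p 0 by (auto simp: cube_states)
next
  assume ?R
  then obtain "is" where p: "us = map (cube_act xs) is" "e \<in> states (cube xs)" "is \<noteq> []"
    "distinct is" "set is \<subseteq> {..<length xs}" "\<forall>i \<in> set is. e ! i = 0" "e' = flip e (set is)"
    by blast
  have "length e = length xs" "set e \<subseteq> {0, 1}" "length e' = length xs" "set e' \<subseteq> {0, 1}"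
    using p set_flip by (auto simp: cube_states simp del: insert_iff)
  moreover have "\<forall>i<length xs. e ! i \<le> e' ! i \<and> (e ! i \<noteq> e' ! i \<longleftrightarrow> i \<in> set is)"
    using p calculation by auto
  ultimately show ?L
    using p(1,3-5) unfolding cube_def Let_def by auto
qed

text \<open>The index in the second component separates actions even when labels repeat in
  \<open>xs\<close>.\<close>

lemma cube_act_inj: "map (cube_act xs) is = map (cube_act xs) js \<longleftrightarrow> is = js"
proof
  assume "map (cube_act xs) is = map (cube_act xs) js"
  then have "map snd (map (cube_act xs) is) = map snd (map (cube_act xs) js)" by simp
  then show "is = js" by (simp add: comp_def)
qed simp

lemma flip_cube: "e \<in> states (cube xs) \<Longrightarrow> flip e I \<in> states (cube xs)"
  using set_flip by (auto simp: cube_states simp del: insert_iff)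

lemma cube_trans_append:
  assumes "(e, map (cube_act xs) (is @ js), e') \<in> transitions (cube xs)" "is \<noteq> []" "js \<noteq> []"
  shows "(e, map (cube_act xs) is, flip e (set is)) \<in> transitions (cube xs)"
    "(flip e (set is), map (cube_act xs) js, e') \<in> transitions (cube xs)"
proof -
  have h: "e \<in> states (cube xs)" "distinct (is @ js)" "set (is @ js) \<subseteq> {..<length xs}"
    "\<forall>i \<in> set (is @ js). e ! i = 0" "e' = flip e (set (is @ js))"
    using assms(1) unfolding cube_trans_iff cube_act_inj by blast+
  show "(e, map (cube_act xs) is, flip e (set is)) \<in> transitions (cube xs)"
    unfolding cube_trans_iff using h assms(2) by auto
  have "\<forall>i \<in> set js. flip e (set is) ! i = 0"
    using h by (auto simp: cube_states subset_iff)
  then show "(flip e (set is), map (cube_act xs) js, e') \<in> transitions (cube xs)"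
    unfolding cube_trans_iff cube_act_inj
    using h assms(3) by (intro exI[of _ js]) (auto simp: flip_flip flip_cube)
qed

lemma cube_trans_determ:
  assumes "(e, us, e1) \<in> transitions (cube xs)" "(e, us, e2) \<in> transitions (cube xs)"
  shows "e1 = e2"
  using assms unfolding cube_trans_iff by (auto simp: cube_act_inj)

lemma cube_trans_map:
  assumes "(e, us, e') \<in> transitions (cube xs)"
  obtains "is" where "us = map (cube_act xs) is"
  using assms unfolding cube_trans_iff by blast

text \<open>Intermediate vertices exist because coordinates may be raised in any order. They are
  unique because the initial vertex and the actions determine the final vertex.\<close>

lemma cube_regular: "regular_ts (cube xs)"
proof (rule regular_tsI)
  show "label (cube xs) \<in> extensional (actions (cube xs))" by (simp add: cube_label)
next
  fix e us e' assume "(e, us, e') \<in> transitions (cube xs)"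
  then show "e \<in> states (cube xs) \<and> us \<noteq> [] \<and> set us \<subseteq> actions (cube xs) \<and> e' \<in> states (cube xs)"
    unfolding cube_trans_iff by (auto simp: flip_cube cube_actions subset_iff)
next
  fix u assume "u \<in> actions (cube xs)"
  then obtain i where i: "u = cube_act xs i" "i < length xs" by (auto simp: cube_actions)
  have "(replicate (length xs) 0, [u], flip (replicate (length xs) 0) (set [i])) \<in> transitions (cube xs)"
    unfolding cube_trans_iff using i by (intro exI[of _ "[i]"]) (auto simp: cube_states)
  then show "\<exists>\<alpha> \<beta>. (\<alpha>, [u], \<beta>) \<in> transitions (cube xs)" by blast
next
  show "good_trans (transitions (cube xs))"
    unfolding good_trans_def
  proof (intro conjI allI impI)
    fix e us vs e' assume t: "(e, us, e') \<in> transitions (cube xs)" and m: "mset vs = mset us"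
    then obtain "is" where p: "us = map (cube_act xs) is" "e \<in> states (cube xs)" "is \<noteq> []"
      "distinct is" "set is \<subseteq> {..<length xs}" "\<forall>i \<in> set is. e ! i = 0" "e' = flip e (set is)"
      unfolding cube_trans_iff by blast
    have "set vs = cube_act xs ` set is"
      using mset_eq_setD[OF m] p(1) by simp
    \<comment> \<open>The permuted word again consists of cube actions, so its indices can be read
      off from the second components.\<close>
    then have "vs = map (cube_act xs) (map snd vs)" by (auto intro!: map_idI[symmetric])
    moreover have ms: "mset (map snd vs) = mset is"
      using m p(1) by (simp add: comp_def multiset.map_comp)
    moreover have "set (map snd vs) = set is" using ms mset_eq_setD by blast
    moreover have "distinct (map snd vs)" using ms p(4) mset_eq_imp_distinct_iff by blast
    moreover have "map snd vs \<noteq> []" using ms p(3) by auto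
    ultimately show "(e, vs, e') \<in> transitions (cube xs)"
      unfolding cube_trans_iff using p by (intro exI[of _ "map snd vs"]) simp
  next
    fix e us vs e' assume t: "(e, us @ vs, e') \<in> transitions (cube xs)" and ne: "us \<noteq> []" "vs \<noteq> []"
    then obtain "is" js where "us = map (cube_act xs) is" "vs = map (cube_act xs) js"
      by (elim cube_trans_map) (auto simp: append_eq_map_conv)
    then show "\<exists>\<nu>. (e, us, \<nu>) \<in> transitions (cube xs) \<and> (\<nu>, vs, e') \<in> transitions (cube xs)"
      using cube_trans_append[of e xs "is" js e'] t ne by auto
  next
    fix e us vs ws e' assume t: "(e, us @ vs @ ws, e') \<in> transitions (cube xs)"
      and ne: "us \<noteq> []" "vs \<noteq> []" "ws \<noteq> []"
    then obtain "is" js ks where i: "us = map (cube_act xs) is" "vs = map (cube_act xs) js"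
      "ws = map (cube_act xs) ks"
      by (elim cube_trans_map) (auto simp: append_eq_map_conv)
    have 1: "(e, map (cube_act xs) is, flip e (set is)) \<in> transitions (cube xs)"
      "(flip e (set is), map (cube_act xs) (js @ ks), e') \<in> transitions (cube xs)"
      using cube_trans_append[of e xs "is" "js @ ks" e'] t ne i by auto
    have 2: "(flip e (set is), map (cube_act xs) js, flip (flip e (set is)) (set js)) \<in> transitions (cube xs)"
      using cube_trans_append[OF 1(2)] ne i by auto
    have 3: "(e, map (cube_act xs) (is @ js), flip e (set (is @ js))) \<in> transitions (cube xs)"
      "(flip e (set (is @ js)), map (cube_act xs) ks, e') \<in> transitions (cube xs)"
      using cube_trans_append[of e xs "is @ js" ks e'] t ne i by auto
    show "\<exists>\<nu>1 \<nu>2. (e, us, \<nu>1) \<in> transitions (cube xs) \<and> (\<nu>1, vs @ ws, e') \<in> transitions (cube xs) \<and>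
           (e, us @ vs, \<nu>2) \<in> transitions (cube xs) \<and> (\<nu>2, ws, e') \<in> transitions (cube xs) \<and>
           (\<nu>1, vs, \<nu>2) \<in> transitions (cube xs)"
      using 1 2 3 i by (intro exI[of _ "flip e (set is)"] exI[of _ "flip e (set (is @ js))"])
        (auto simp: flip_flip)
  qed
qed (use cube_trans_determ in blast)

lemma cube_top:
  assumes "xs \<noteq> []"
  shows "(replicate (length xs) 0, map (cube_act xs) [0..<length xs], replicate (length xs) 1)
    \<in> transitions (cube xs)"
proof -
  let ?n = "length xs"
  have "flip (replicate ?n 0) (set [0..<?n]) = replicate ?n 1" by (rule nth_equalityI) auto
  moreover have "replicate ?n 0 \<in> states (cube xs)" "[0..<?n] \<noteq> []" "set [0..<?n] \<subseteq> {..<?n}"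
    "\<forall>i \<in> set [0..<?n]. replicate ?n 0 ! i = (0 :: nat)"
    using assms by (auto simp: cube_states)
  ultimately show ?thesis unfolding cube_trans_iff cube_act_inj using distinct_upt by metis
qed

lemma cube_weak: "weak_ts (cube xs)"
  by (rule regular_ts_weak[OF cube_regular])

lemma cube_Nil: "states (cube []) = {[]}" "actions (cube []) = {}" "transitions (cube []) = {}"
  by (auto simp: cube_states cube_actions cube_trans_iff)

lemma distinct_single_index:
  assumes "distinct is" "is \<noteq> []" "set is \<subseteq> {..<Suc 0}"
  shows "is = [0]"
proof (cases "is")
  case (Cons a js)
  then have "a = 0" "\<forall>j \<in> set js. j = 0" "0 \<notin> set js" using assms by auto
  then show ?thesis using Cons by (cases js) auto
qed (use assms in simp)

lemma cube_single:
  "states (cube [x]) = {[0], [1]}" "actions (cube [x]) = {(x, 0)}"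
  "transitions (cube [x]) = {([0], [(x, 0)], [1])}"
proof -
  show s: "states (cube [x]) = {[0], [1]}" by (auto simp: cube_states length_Suc_conv)
  show "actions (cube [x]) = {(x, 0)}" by (auto simp: cube_actions)
  have "(e, us, e') \<in> transitions (cube [x]) \<longleftrightarrow> e = [0] \<and> us = [(x, 0)] \<and> e' = [1]" for e us e'
    unfolding cube_trans_iff s
    by (auto dest: distinct_single_index simp: flip_def intro!: exI[of _ "[0]"])
  then show "transitions (cube [x]) = {([0], [(x, 0)], [1])}" by auto
qed

section \<open>States and edges as maps from cubes of dimension 0 and 1\<close>

definition vertex_map :: "('s, 'a, 'l) ts \<Rightarrow> 's \<Rightarrow> (nat list, 'l \<times> nat, 's, 'a, 'l) ts_map" where
  "vertex_map X s = mk_map (cube []) X (\<lambda>_. s) (\<lambda>_. undefined)"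

definition edge_map ::
    "('s, 'a, 'l) ts \<Rightarrow> 's \<Rightarrow> 'a \<Rightarrow> 's \<Rightarrow> (nat list, 'l \<times> nat, 's, 'a, 'l) ts_map" where
  "edge_map X \<alpha> u \<beta> = mk_map (cube [label X u]) X (\<lambda>e. if e = [0] then \<alpha> else \<beta>) (\<lambda>_. u)"

lemma vertex_map_hom: "weak_ts X \<Longrightarrow> s \<in> states X \<Longrightarrow> vertex_map X s \<in> ts_hom (cube []) X"
  unfolding vertex_map_def by (rule mk_map_hom) (auto simp: cube_weak cube_Nil)

lemma vertex_map_simps [simp]: "on_states (vertex_map X s) [] = s" "src (vertex_map X s) = cube []"
  unfolding vertex_map_def by (auto simp: cube_Nil)

lemma edge_map_hom:
  assumes "weak_ts X" "(\<alpha>, [u], \<beta>) \<in> transitions X"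
  shows "edge_map X \<alpha> u \<beta> \<in> ts_hom (cube [label X u]) X"
  unfolding edge_map_def
  by (rule mk_map_hom) (use weak_ts_transD[OF assms] assms in \<open>auto simp: cube_weak cube_single cube_label\<close>)

lemma edge_map_simps [simp]:
  "on_states (edge_map X \<alpha> u \<beta>) [0] = \<alpha>" "on_states (edge_map X \<alpha> u \<beta>) [Suc 0] = \<beta>"
  "on_actions (edge_map X \<alpha> u \<beta>) (label X u, 0) = u" "src (edge_map X \<alpha> u \<beta>) = cube [label X u]"
  unfolding edge_map_def by (auto simp: cube_single)

lemma cube_Nil_homI:
  assumes "f \<in> ts_hom (cube []) X"
  shows "f = vertex_map X (on_states f [])"
  by (rule ts_hom_eqI[OF assms vertex_map_hom])
     (use ts_homD[OF assms] in \<open>auto simp: cube_Nil\<close>)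

text \<open>A regular transition system has a cube with any given transition as its long diagonal: the
  vertex with set of coordinates \<open>I\<close> goes to the intermediate state reached by the actions in \<open>I\<close>.
  To treat the initial and final vertices on the same footing, transitions are indexed by
  multisets of actions, the empty multiset standing for an identity.\<close>

definition mtrans :: "('s, 'a, 'l) ts \<Rightarrow> 's \<Rightarrow> 'a multiset \<Rightarrow> 's \<Rightarrow> bool" where
  "mtrans X \<alpha> m \<beta> \<longleftrightarrow>
     (if m = {#} then \<alpha> = \<beta> else \<exists>us. mset us = m \<and> (\<alpha>, us, \<beta>) \<in> transitions X)"

lemma mtrans_mset:
  assumes "weak_ts X" "us \<noteq> []"
  shows "mtrans X \<alpha> (mset us) \<beta> \<longleftrightarrow> (\<alpha>, us, \<beta>) \<in> transitions X"
  using assms weak_ts_msetD[OF assms(1)] unfolding mtrans_def by auto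

text \<open>CSA2, extended to splittings with an empty half; the intermediate state is then one of
  the end points.\<close>

lemma mtrans_split:
  assumes X: "regular_ts X" and t: "mtrans X \<alpha> (a + b) \<beta>"
  shows "\<exists>!\<nu>. mtrans X \<alpha> a \<nu> \<and> mtrans X \<nu> b \<beta>"
proof (cases "a = {#} \<or> b = {#}")
  case True
  then show ?thesis
  proof
    assume "a = {#}"
    then show ?thesis using t by (intro ex1I[of _ \<alpha>]) (auto simp: mtrans_def)
  next
    assume "b = {#}"
    then show ?thesis using t by (intro ex1I[of _ \<beta>]) (auto simp: mtrans_def)
  qed
next
  case False
  note w = regular_ts_weak[OF X]
  obtain us vs where m: "mset us = a" "mset vs = b" by (meson ex_mset)
  then have ne: "us \<noteq> []" "vs \<noteq> []" using False by auto
  have "(\<alpha>, us @ vs, \<beta>) \<in> transitions X"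
    using t mtrans_mset[OF w, of "us @ vs"] m ne by simp
  from regular_ts_split[OF X this ne] show ?thesis
    using mtrans_mset[OF w ne(1)] mtrans_mset[OF w ne(2)] m by simp
qed

text \<open>The composition axiom with empty outer parts allowed. For empty \<open>b\<close> the
  conclusion would read \<open>\<nu>1 = \<nu>2\<close>, a matter of uniqueness and not of this
  axiom.\<close>

lemma mtrans_comp:
  assumes X: "weak_ts X" and t: "mtrans X \<alpha> (a + b + c) \<beta>" "b \<noteq> {#}"
    "mtrans X \<alpha> a \<nu>1" "mtrans X \<nu>1 (b + c) \<beta>" "mtrans X \<alpha> (a + b) \<nu>2" "mtrans X \<nu>2 c \<beta>"
  shows "mtrans X \<nu>1 b \<nu>2"
proof (cases "a = {#} \<or> c = {#}")
  case True
  then show ?thesis using t by (auto simp: mtrans_def)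
next
  case False
  obtain us vs ws where m: "mset us = a" "mset vs = b" "mset ws = c" by (meson ex_mset)
  then have ne: "us \<noteq> []" "vs \<noteq> []" "ws \<noteq> []" using False t(2) by auto
  show ?thesis
    using weak_ts_compD[OF X ne, of \<alpha> \<beta> \<nu>1 \<nu>2] t mtrans_mset[OF X, of "us @ vs @ ws"]
      mtrans_mset[OF X, of us] mtrans_mset[OF X, of "vs @ ws"] mtrans_mset[OF X, of "us @ vs"]
      mtrans_mset[OF X, of ws] mtrans_mset[OF X, of vs] m ne
    by (simp add: add.assoc)
qed

lemma mset_nth_lessThan: "image_mset ((!) us) (mset_set {..<length us}) = mset us"
  by (metis map_nth mset_map mset_upt atLeast0LessThan)

lemma cube_fill:
  assumes X: "regular_ts X" and t: "(\<alpha>, us, \<beta>) \<in> transitions X"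
  obtains k where "k \<in> ts_hom (cube (map (label X) us)) X"
    "on_states k (replicate (length us) 0) = \<alpha>" "on_states k (replicate (length us) 1) = \<beta>"
    "\<And>i. i < length us \<Longrightarrow> on_actions k (label X (us ! i), i) = us ! i"
proof -
  note w = regular_ts_weak[OF X]
  define n xs where "n = length us" and "xs = map (label X) us"
  define act where "act I = image_mset ((!) us) (mset_set I)" for I
  define ones where "ones e = {i. i < n \<and> e ! i = (1 :: nat)}" for e
  define st where "st I = (THE \<nu>. mtrans X \<alpha> (act I) \<nu> \<and> mtrans X \<nu> (act ({..<n} - I)) \<beta>)" for I
  have act_Un: "act (I \<union> J) = act I + act J" if "I \<subseteq> {..<n}" "J \<subseteq> {..<n}" "I \<inter> J = {}" for I J
    using that finite_subset[OF that(1)] finite_subset[OF that(2)]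
    by (simp add: act_def mset_set_Union)
  have top: "mtrans X \<alpha> (act {..<n}) \<beta>"
    unfolding act_def n_def mset_nth_lessThan using weak_ts_transD[OF w t] t mtrans_mset[OF w] by blast
  have ex1: "\<exists>!\<nu>. mtrans X \<alpha> (act I) \<nu> \<and> mtrans X \<nu> (act ({..<n} - I)) \<beta>" if "I \<subseteq> {..<n}" for I
  proof (rule mtrans_split[OF X])
    have "act {..<n} = act I + act ({..<n} - I)"
      using act_Un[of I "{..<n} - I"] that by (simp add: Un_absorb1)
    then show "mtrans X \<alpha> (act I + act ({..<n} - I)) \<beta>" using top by simp
  qed
  have st: "mtrans X \<alpha> (act I) (st I)" "mtrans X (st I) (act ({..<n} - I)) \<beta>" if "I \<subseteq> {..<n}" for I
    using theI'[OF ex1[OF that]] unfolding st_def by blast+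
  \<comment> \<open>A face goes to a transition by the composition axiom, applied to the three
    blocks \<open>I\<close>, \<open>J\<close> and the remaining indices of the given
    transition.\<close>
  have face: "mtrans X (st I) (act J) (st (I \<union> J))"
    if IJ: "I \<subseteq> {..<n}" "J \<subseteq> {..<n}" "I \<inter> J = {}" "J \<noteq> {}" for I J
  proof (rule mtrans_comp[OF w, of \<alpha> "act I" _ "act ({..<n} - (I \<union> J))" \<beta>])
    have 1: "{..<n} - I = J \<union> ({..<n} - (I \<union> J))" "{..<n} = (I \<union> J) \<union> ({..<n} - (I \<union> J))"
      using IJ by auto
    have "act {..<n} = act (I \<union> J) + act ({..<n} - (I \<union> J))"
      by (subst 1(2), rule act_Un) (use IJ in auto)
    then have "act {..<n} = act I + act J + act ({..<n} - (I \<union> J))"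
      using act_Un[OF IJ(1-3)] by simp
    then show "mtrans X \<alpha> (act I + act J + act ({..<n} - (I \<union> J))) \<beta>" using top by simp
    have "act ({..<n} - I) = act J + act ({..<n} - (I \<union> J))"
      by (subst 1(1), rule act_Un) (use IJ in auto)
    then show "mtrans X (st I) (act J + act ({..<n} - (I \<union> J))) \<beta>" using st(2)[OF IJ(1)] by simp
    show "act J \<noteq> {#}"
      using IJ(4) finite_subset[OF IJ(2)] by (simp add: act_def mset_set_empty_iff)
    show "mtrans X \<alpha> (act I) (st I)" by (rule st(1)[OF IJ(1)])
    show "mtrans X \<alpha> (act I + act J) (st (I \<union> J))"
      using st(1)[of "I \<union> J"] act_Un[OF IJ(1-3)] IJ by simp
    show "mtrans X (st (I \<union> J)) (act ({..<n} - (I \<union> J))) \<beta>"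
      using st(2)[of "I \<union> J"] IJ by simp
  qed
  have st_in: "st I \<in> states X" if "I \<subseteq> {..<n}" for I
    using st[OF that] weak_ts_transD[OF w] weak_ts_transD(1)[OF w t]
    by (auto simp: mtrans_def split: if_splits)
  define k where "k = mk_map (cube xs) X (\<lambda>e. st (ones e)) (\<lambda>(x, i). us ! i)"
  have len: "length xs = n" by (simp add: xs_def n_def)
  have ones_sub: "ones e \<subseteq> {..<n}" for e by (auto simp: ones_def)
  have "k \<in> ts_hom (cube xs) X"
    unfolding k_def
  proof (rule mk_map_hom[OF cube_weak w])
    fix e us' e' assume "(e, us', e') \<in> transitions (cube xs)"
    then obtain "is" where p: "us' = map (cube_act xs) is" "e \<in> states (cube xs)" "is \<noteq> []"
      "distinct is" "set is \<subseteq> {..<n}" "\<forall>i \<in> set is. e ! i = 0" "e' = flip e (set is)"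
      unfolding cube_trans_iff len by blast
    have e': "ones e' = ones e \<union> set is"
      using p(2,5) unfolding p(7) ones_def by (auto simp: cube_states len split: if_splits)
    have "mtrans X (st (ones e)) (act (set is)) (st (ones e'))"
      unfolding e' by (rule face[OF ones_sub p(5)]) (use p in \<open>auto simp: ones_def\<close>)
    moreover have "act (set is) = mset (map ((!) us) is)"
      using p(4) by (simp add: act_def mset_set_set)
    ultimately have "(st (ones e), map ((!) us) is, st (ones e')) \<in> transitions X"
      using mtrans_mset[OF w, of "map ((!) us) is"] p(3) by (simp del: mset_map)
    moreover have "map (\<lambda>(x, i). us ! i) us' = map ((!) us) is" by (simp add: p(1))
    ultimately show "(st (ones e), map (\<lambda>(x, i). us ! i) us', st (ones e')) \<in> transitions X" by simp
  qed (use weak_ts_transD(3)[OF w t] st_in[OF ones_sub] in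
        \<open>auto simp: cube_actions xs_def cube_label\<close>)
  moreover have "on_states k (replicate (length us) 0) = \<alpha>"
  proof -
    have "replicate n 0 \<in> states (cube xs)" by (auto simp: cube_states len)
    moreover have "ones (replicate n 0) = {}" by (auto simp: ones_def)
    moreover have "st {} = \<alpha>" using st(1)[of "{}"] by (simp add: act_def mtrans_def)
    ultimately show ?thesis unfolding k_def by (simp flip: n_def)
  qed
  moreover have "on_states k (replicate (length us) 1) = \<beta>"
  proof -
    have "replicate n 1 \<in> states (cube xs)" by (auto simp: cube_states len)
    moreover have "ones (replicate n 1) = {..<n}" by (auto simp: ones_def)
    moreover have "st {..<n} = \<beta>" using st(2)[of "{..<n}"] by (simp add: act_def mtrans_def)
    ultimately show ?thesis unfolding k_def by (simp flip: n_def)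
  qed
  moreover have "on_actions k (label X (us ! i), i) = us ! i" if "i < length us" for i
  proof -
    have "(label X (us ! i), i) \<in> actions (cube xs)"
      using that by (auto simp: cube_actions xs_def intro!: image_eqI[of _ _ i])
    then show ?thesis unfolding k_def by simp
  qed
  ultimately show ?thesis using that unfolding xs_def by blast
qed

section \<open>Trivial fibrations and cofibrations\<close>

text \<open>With only 1-transitions there is nothing to split, compose or permute; only typing and
  the use of all actions remain to be checked.\<close>

lemma regular_ts_graphI:
  assumes "label X \<in> extensional (actions X)"
    "\<And>\<alpha> us \<beta>. (\<alpha>, us, \<beta>) \<in> transitions X \<Longrightarrow>
        \<alpha> \<in> states X \<and> (\<exists>u \<in> actions X. us = [u]) \<and> \<beta> \<in> states X"
    "\<And>u. u \<in> actions X \<Longrightarrow> \<exists>\<alpha> \<beta>. (\<alpha>, [u], \<beta>) \<in> transitions X"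
  shows "regular_ts X"
proof (rule regular_tsI)
  have long: False if "(\<alpha>, us @ vs, \<beta>) \<in> transitions X" "us \<noteq> []" "vs \<noteq> []" for \<alpha> us vs \<beta>
    using assms(2)[OF that(1)] that(2,3) by (auto simp: append_eq_Cons_conv)
  have "vs = us" if "(\<alpha>, us, \<beta>) \<in> transitions X" "mset vs = mset us" for \<alpha> us vs \<beta>
    using assms(2)[OF that(1)] that(2) by auto
  then show "good_trans (transitions X)"
    unfolding good_trans_def using long by (metis Nil_is_append_conv)
  show "\<nu> = \<nu>'" if "(\<alpha>, us @ vs, \<beta>) \<in> transitions X" "us \<noteq> []" "vs \<noteq> []" for \<alpha> us vs \<beta> \<nu> \<nu>'
    using long[OF that] by blast
  show "\<alpha> \<in> states X \<and> us \<noteq> [] \<and> set us \<subseteq> actions X \<and> \<beta> \<in> states X"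
    if "(\<alpha>, us, \<beta>) \<in> transitions X" for \<alpha> us \<beta>
    using assms(2)[OF that] by auto
qed (use assms in auto)

section \<open>The generating cofibrations as maps of transition systems\<close>

lemma discrete_regular: "regular_ts (discrete A)"
  by (rule regular_ts_graphI) (auto simp: discrete_def)

lemma double_transition_regular: "regular_ts (double_transition x)"
  by (rule regular_ts_graphI) (auto simp: double_transition_def)

lemma cube_boundary_single:
  "states (cube_boundary [x]) = {[0], [1]}" "actions (cube_boundary [x]) = {}"
  "transitions (cube_boundary [x]) = {}"
  by (auto simp: cube_boundary_def Let_def cube_single)

lemma cube_boundary_sel:
  "states (cube_boundary xs) = states (cube xs)"
  "length xs \<noteq> 1 \<Longrightarrow> actions (cube_boundary xs) = actions (cube xs)"
  "label (cube_boundary xs) = restrict fst (actions (cube_boundary xs))"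
  "transitions (cube_boundary xs) = {(\<alpha>, us, \<beta>) \<in> transitions (cube xs). length us \<noteq> length xs}"
  by (auto simp: cube_boundary_def Let_def)

lemma cube_trans_length:
  assumes "(e, us, e') \<in> transitions (cube xs)"
  shows "length us \<le> length xs"
proof -
  obtain "is" where "us = map (cube_act xs) is" "distinct is" "set is \<subseteq> {..<length xs}"
    using assms unfolding cube_trans_iff by blast
  then show ?thesis using card_mono[of "{..<length xs}" "set is"] by (simp add: distinct_card)
qed

text \<open>Permuting preserves the length, and the composition axiom yields a proper part of a word
  of length at most \<open>length xs\<close>, so no removed transition is ever demanded. For a
  single label nothing is left but the two states.\<close>

lemma cube_boundary_weak: "weak_ts (cube_boundary xs)"
proof (cases "length xs = 1")
  case True
  then obtain x where "xs = [x]" by (auto simp: length_Suc_conv)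
  then show ?thesis by (auto simp: weak_ts_def cube_boundary_single cube_boundary_sel(3))
next
  case False
  show ?thesis
    unfolding weak_ts_def
  proof (intro conjI allI impI)
    fix \<alpha> us \<beta> assume "(\<alpha>, us, \<beta>) \<in> transitions (cube_boundary xs)"
    then have "(\<alpha>, us, \<beta>) \<in> transitions (cube xs)" by (simp add: cube_boundary_sel)
    from weak_ts_transD[OF cube_weak this] False
    show "\<alpha> \<in> states (cube_boundary xs)" "us \<noteq> []" "set us \<subseteq> actions (cube_boundary xs)"
      "\<beta> \<in> states (cube_boundary xs)"
      by (simp_all add: cube_boundary_sel)
  next
    fix \<alpha> us vs \<beta> assume "(\<alpha>, us, \<beta>) \<in> transitions (cube_boundary xs)" "mset vs = mset us"
    then show "(\<alpha>, vs, \<beta>) \<in> transitions (cube_boundary xs)"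
      using weak_ts_msetD[OF cube_weak, of \<alpha> us \<beta> xs vs] mset_eq_length[of vs us]
      by (simp add: cube_boundary_sel)
  next
    fix \<alpha> \<beta> \<nu>1 \<nu>2 us vs ws
    assume t: "us \<noteq> []" "vs \<noteq> []" "ws \<noteq> []" "(\<alpha>, us @ vs @ ws, \<beta>) \<in> transitions (cube_boundary xs)"
      "(\<alpha>, us, \<nu>1) \<in> transitions (cube_boundary xs)" "(\<nu>1, vs @ ws, \<beta>) \<in> transitions (cube_boundary xs)"
      "(\<alpha>, us @ vs, \<nu>2) \<in> transitions (cube_boundary xs)" "(\<nu>2, ws, \<beta>) \<in> transitions (cube_boundary xs)"
    have "(\<nu>1, vs, \<nu>2) \<in> transitions (cube xs)"
      using weak_ts_compD[OF cube_weak t(1-3), of \<alpha> \<beta> xs \<nu>1 \<nu>2] t(4-) by (simp add: cube_boundary_sel)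
    moreover have "length us > 0" "length us + length vs \<le> length xs"
      using t(1,4) cube_trans_length[of \<alpha> "us @ vs @ ws" \<beta> xs] by (auto simp: cube_boundary_sel)
    moreover from calculation have "length vs < length xs" by linarith
    ultimately show "(\<nu>1, vs, \<nu>2) \<in> transitions (cube_boundary xs)" by (simp add: cube_boundary_sel)
  qed (simp add: cube_boundary_sel(3))
qed

lemma empty_to_point_mk:
  "empty_to_point = mk_map (discrete {}) (discrete {[0]}) (\<lambda>_. [0]) (\<lambda>_. undefined)"
  by (auto simp: empty_to_point_def mk_map_def discrete_def)

lemma two_points_to_point_mk:
  "two_points_to_point = mk_map (discrete {[0], [1]}) (discrete {[0]}) (\<lambda>_. [0]) (\<lambda>_. undefined)"
  by (auto simp: two_points_to_point_def mk_map_def discrete_def)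

lemma boundary_inclusion_mk: "boundary_inclusion xs = ts_incl (cube_boundary xs) (cube xs)"
  by (auto simp: boundary_inclusion_def mk_map_def)

lemma cube_to_double_mk:
  "cube_to_double x =
     mk_map (cube [x]) (double_transition x) (\<lambda>s. if s = [0] then [1] else [2]) id"
  by (auto simp: cube_to_double_def mk_map_def)

lemma cube_boundary_sub: "sub_ts (cube_boundary xs) (cube xs)"
  by (auto simp: sub_ts_def cube_boundary_def Let_def cube_label)

lemma ts_hom_src_tgt: "f \<in> ts_hom X Y \<Longrightarrow> f \<in> ts_hom (src f) (tgt f)"
  by (simp add: ts_homD(1,2))

text \<open>Besides being maps, the generators share injectivity on actions, which is what the
  lifting argument asks of them.\<close>

lemma generating_cofibration_hom:
  assumes "i \<in> generating_cofibrations"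
  shows "i \<in> ts_hom (src i) (tgt i)" "inj_on (on_actions i) (actions (src i))"
proof -
  have "empty_to_point \<in> ts_hom (discrete {}) (discrete {[0]})"
    unfolding empty_to_point_mk
    by (rule mk_map_hom) (auto simp: regular_ts_weak discrete_regular, auto simp: discrete_def)
  moreover have "two_points_to_point \<in> ts_hom (discrete {[0], [1]}) (discrete {[0]})"
    unfolding two_points_to_point_mk
    by (rule mk_map_hom) (auto simp: regular_ts_weak discrete_regular, auto simp: discrete_def)
  moreover have "boundary_inclusion xs \<in> ts_hom (cube_boundary xs) (cube xs)" for xs :: "'a list"
    unfolding boundary_inclusion_mk
    by (rule ts_incl_hom[OF cube_boundary_sub cube_boundary_weak cube_weak])
  moreover have "cube_to_double x \<in> ts_hom (cube [x]) (double_transition x)" for x :: 'a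
    unfolding cube_to_double_mk
    by (rule mk_map_hom[OF cube_weak regular_ts_weak[OF double_transition_regular]])
      (auto simp: cube_single cube_label, auto simp: double_transition_def)
  ultimately show "i \<in> ts_hom (src i) (tgt i)"
    using assms ts_hom_src_tgt unfolding generating_cofibrations_def by blast
  show "inj_on (on_actions i) (actions (src i))"
    using assms unfolding generating_cofibrations_def
    by (auto simp: empty_to_point_mk two_points_to_point_mk boundary_inclusion_mk cube_to_double_mk
        cube_single discrete_def inj_on_def)
qed

text \<open>For a morphism this makes \<open>src p\<close> the target with each action split into a
  nonempty family of interchangeable copies.\<close>

definition action_cover :: "('s, 'a, 't, 'b, 'l) ts_map \<Rightarrow> bool" where
  "action_cover p \<longleftrightarrow> bij_betw (on_states p) (states (src p)) (states (tgt p)) \<and>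
     actions (tgt p) \<subseteq> on_actions p ` actions (src p) \<and>
     (\<forall>\<alpha> us \<beta>. \<alpha> \<in> states (src p) \<longrightarrow> \<beta> \<in> states (src p) \<longrightarrow> set us \<subseteq> actions (src p) \<longrightarrow>
        (on_states p \<alpha>, map (on_actions p) us, on_states p \<beta>) \<in> transitions (tgt p) \<longrightarrow>
        (\<alpha>, us, \<beta>) \<in> transitions (src p))"

text \<open>States are lifted by inverting the bijection. Actions are lifted one by one, with values
  prescribed by \<open>u\<close> on the image of \<open>i\<close>. Transitions then lift by
  themselves because \<open>p\<close> reflects them.\<close>

lemma action_cover_lifting:
  assumes p: "p \<in> ts_hom (src p) (tgt p)" "action_cover p"
    and i: "i \<in> ts_hom (src i) (tgt i)" "inj_on (on_actions i) (actions (src i))"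
  shows "has_lifting i p"
  unfolding has_lifting_def
proof (intro ballI impI)
  fix u v assume u: "u \<in> ts_hom (src i) (src p)" and v: "v \<in> ts_hom (tgt i) (tgt p)"
    and eq: "p \<circ>\<^sub>t u = v \<circ>\<^sub>t i"
  note dp = ts_homD[OF p(1)] and di = ts_homD[OF i(1)] and du = ts_homD[OF u] and dv = ts_homD[OF v]
  have eqs: "on_states p (on_states u s) = on_states v (on_states i s)" if "s \<in> states (src i)" for s
    using arg_cong[OF eq, of "\<lambda>f. on_states f s"] that du by simp
  have eqa: "on_actions p (on_actions u a) = on_actions v (on_actions i a)" if "a \<in> actions (src i)" for a
    using arg_cong[OF eq, of "\<lambda>f. on_actions f a"] that du by simp
  have bij: "bij_betw (on_states p) (states (src p)) (states (tgt p))"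
    and surj: "actions (tgt p) \<subseteq> on_actions p ` actions (src p)"
    using p(2) by (auto simp: action_cover_def)
  define hs where "hs = (\<lambda>t. inv_into (states (src p)) (on_states p) (on_states v t))"
  \<comment> \<open>Injectivity of \<open>i\<close> on actions makes the first branch well defined;
    in the second branch any preimage will do.\<close>
  define ha where "ha = (\<lambda>b. if b \<in> on_actions i ` actions (src i)
     then on_actions u (inv_into (actions (src i)) (on_actions i) b)
     else inv_into (actions (src p)) (on_actions p) (on_actions v b))"
  have hs: "hs t \<in> states (src p)" "on_states p (hs t) = on_states v t" if "t \<in> states (tgt i)" for t
    using dv(5)[OF that] bij_betw_imp_surj_on[OF bij] unfolding hs_def
    by (auto intro: inv_into_into f_inv_into_f)
  have ha: "ha b \<in> actions (src p) \<and> on_actions p (ha b) = on_actions v b" if b: "b \<in> actions (tgt i)" for b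
  proof (cases "b \<in> on_actions i ` actions (src i)")
    case True
    then obtain a where "a \<in> actions (src i)" "b = on_actions i a" by blast
    then show ?thesis using du(6) eqa i(2) by (auto simp: ha_def)
  next
    case False
    then show ?thesis using dv(6)[OF b] surj unfolding ha_def
      by (auto intro: inv_into_into f_inv_into_f)
  qed
  define h where "h = mk_map (tgt i) (src p) hs ha"
  have h: "h \<in> ts_hom (tgt i) (src p)"
    unfolding h_def
  proof (rule mk_map_hom)
    fix a assume "a \<in> actions (tgt i)"
    then show "label (src p) (ha a) = label (tgt i) a"
      using ha[of a] dp(7)[of "ha a"] dv(7)[of a] by simp
  next
    fix \<alpha> us \<beta> assume t: "(\<alpha>, us, \<beta>) \<in> transitions (tgt i)"
    note tt = weak_ts_transD[OF di(4) t]
    have "map (on_actions p) (map ha us) = map (on_actions v) us"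
      using ha tt(3) by auto
    then have "(on_states p (hs \<alpha>), map (on_actions p) (map ha us), on_states p (hs \<beta>)) \<in> transitions (tgt p)"
      using dv(8)[OF t] hs tt by (simp del: map_map map_eq_conv)
    then show "(hs \<alpha>, map ha us, hs \<beta>) \<in> transitions (src p)"
      using p(2) hs tt ha unfolding action_cover_def
      by (smt (verit) image_subset_iff list.set_map subset_iff)
  qed (use di dp hs ha in auto)
  moreover have "h \<circ>\<^sub>t i = u"
  proof (rule ts_hom_eqI[OF ts_comp_hom[OF i(1) h] u])
    fix s assume s: "s \<in> states (src i)"
    have "on_states p (hs (on_states i s)) = on_states p (on_states u s)"
      using hs(2)[OF di(5)[OF s]] eqs[OF s] by simp
    then have "hs (on_states i s) = on_states u s"
      using bij_betw_imp_inj_on[OF bij] hs(1)[OF di(5)[OF s]] du(5)[OF s] by (auto dest: inj_onD)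
    then show "on_states (h \<circ>\<^sub>t i) s = on_states u s" using s di(5) by (simp add: h_def)
  next
    fix a assume a: "a \<in> actions (src i)"
    then have "ha (on_actions i a) = on_actions u a" using i(2) by (simp add: ha_def)
    then show "on_actions (h \<circ>\<^sub>t i) a = on_actions u a" using a di(6) by (simp add: h_def)
  qed
  moreover have "p \<circ>\<^sub>t h = v"
    by (rule ts_hom_eqI[OF ts_comp_hom[OF h p(1)] v]) (use hs ha in \<open>auto simp: h_def\<close>)
  ultimately show "\<exists>h\<in>ts_hom (tgt i) (src p). h \<circ>\<^sub>t i = u \<and> p \<circ>\<^sub>t h = v" by blast
qed

lemma has_liftingE:
  assumes "has_lifting i p" "i \<in> ts_hom A B" "u \<in> ts_hom A (src p)" "v \<in> ts_hom B (tgt p)"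
    "p \<in> ts_hom (src p) (tgt p)"
    "\<And>s. s \<in> states A \<Longrightarrow> on_states p (on_states u s) = on_states v (on_states i s)"
    "\<And>a. a \<in> actions A \<Longrightarrow> on_actions p (on_actions u a) = on_actions v (on_actions i a)"
  obtains h where "h \<in> ts_hom B (src p)"
    "\<And>s. s \<in> states A \<Longrightarrow> on_states h (on_states i s) = on_states u s"
    "\<And>a. a \<in> actions A \<Longrightarrow> on_actions h (on_actions i a) = on_actions u a"
    "\<And>s. s \<in> states B \<Longrightarrow> on_states p (on_states h s) = on_states v s"
    "\<And>a. a \<in> actions B \<Longrightarrow> on_actions p (on_actions h a) = on_actions v a"
proof -
  note i = ts_homD[OF assms(2)] and u = ts_homD[OF assms(3)] and v = ts_homD[OF assms(4)]
  have "p \<circ>\<^sub>t u = v \<circ>\<^sub>t i"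
    by (rule ts_hom_eqI[OF ts_comp_hom[OF assms(3,5)] ts_comp_hom[OF assms(2,4)]])
       (use assms(6,7) i u in auto)
  then obtain h where h: "h \<in> ts_hom B (src p)" "h \<circ>\<^sub>t i = u" "p \<circ>\<^sub>t h = v"
    using assms(1,3,4) i unfolding has_lifting_def by blast
  show ?thesis
  proof (rule that[OF h(1)])
    show "on_states h (on_states i s) = on_states u s" if "s \<in> states A" for s
      using arg_cong[OF h(2), of "\<lambda>f. on_states f s"] that i by simp
    show "on_actions h (on_actions i s) = on_actions u s" if "s \<in> actions A" for s
      using arg_cong[OF h(2), of "\<lambda>f. on_actions f s"] that i by simp
    show "on_states p (on_states h s) = on_states v s" if "s \<in> states B" for s
      using arg_cong[OF h(3), of "\<lambda>f. on_states f s"] that ts_homD[OF h(1)] by simp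
    show "on_actions p (on_actions h s) = on_actions v s" if "s \<in> actions B" for s
      using arg_cong[OF h(3), of "\<lambda>f. on_actions f s"] that ts_homD[OF h(1)] by simp
  qed
qed

lemma generating_cofibrations_mem:
  "empty_to_point \<in> generating_cofibrations" "two_points_to_point \<in> generating_cofibrations"
  "xs \<noteq> [] \<Longrightarrow> boundary_inclusion xs \<in> generating_cofibrations"
  "cube_to_double x \<in> generating_cofibrations"
  by (auto simp: generating_cofibrations_def)

text \<open>Each generator contributes one clause. The two maps between discrete systems give the
  bijection on states. The boundary of the 1-cube lifts edges and so, the target being regular,
  actions. \<open>cube_to_double\<close> carries a given action to further edges. The boundaries of
  higher cubes lift longer transitions, by induction on the length.\<close>

lemma action_cover_if_lifting:
  fixes p :: "('s, 'a, 't, 'b, 'l) ts_map"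
  assumes p: "p \<in> ts_hom (src p) (tgt p)" and X: "regular_ts (src p)" and Y: "regular_ts (tgt p)"
    and lift: "\<And>i. i \<in> generating_cofibrations \<Longrightarrow> has_lifting i p"
  shows "action_cover p"
proof -
  let ?D0 = "discrete {} :: (nat list, 'l \<times> nat, 'l) ts"
  let ?D1 = "discrete {[0]} :: (nat list, 'l \<times> nat, 'l) ts"
  let ?D2 = "discrete {[0], [1]} :: (nat list, 'l \<times> nat, 'l) ts"
  note dp = ts_homD[OF p]
  have genh: "i \<in> ts_hom (src i) (tgt i)" if "i \<in> generating_cofibrations" for i :: "(nat list, 'l \<times> nat, nat list, 'l \<times> nat, 'l) ts_map"
    using generating_cofibration_hom[OF that] by simp
  have surj: "\<exists>s \<in> states (src p). on_states p s = y" if y: "y \<in> states (tgt p)" for y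
  proof -
    have i: "empty_to_point \<in> ts_hom ?D0 ?D1"
      using genh[OF generating_cofibrations_mem(1)] by (simp add: empty_to_point_mk)
    have u: "mk_map ?D0 (src p) (\<lambda>_. undefined) (\<lambda>_. undefined) \<in> ts_hom ?D0 (src p)"
      by (rule mk_map_hom[OF regular_ts_weak[OF discrete_regular]]) (use dp in \<open>auto simp: discrete_def\<close>)
    have v: "mk_map ?D1 (tgt p) (\<lambda>_. y) (\<lambda>_. undefined) \<in> ts_hom ?D1 (tgt p)"
      by (rule mk_map_hom[OF regular_ts_weak[OF discrete_regular]]) (use dp y in \<open>auto simp: discrete_def\<close>)
    obtain h where "h \<in> ts_hom ?D1 (src p)"
      "\<And>s. s \<in> states ?D1 \<Longrightarrow> on_states p (on_states h s) = y"
      by (rule has_liftingE[OF lift[OF generating_cofibrations_mem(1)] i u v p]) (auto simp: discrete_def)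
    then show ?thesis using ts_homD(5) by (fastforce simp: discrete_def)
  qed
  have inj: "s = t" if st: "s \<in> states (src p)" "t \<in> states (src p)" "on_states p s = on_states p t" for s t
  proof -
    have i: "two_points_to_point \<in> ts_hom ?D2 ?D1"
      using genh[OF generating_cofibrations_mem(2)] by (simp add: two_points_to_point_mk)
    have u: "mk_map ?D2 (src p) (\<lambda>e. if e = [0] then s else t) (\<lambda>_. undefined)
        \<in> ts_hom ?D2 (src p)"
      by (rule mk_map_hom[OF regular_ts_weak[OF discrete_regular]]) (use dp st in \<open>auto simp: discrete_def\<close>)
    have v: "mk_map ?D1 (tgt p) (\<lambda>_. on_states p s) (\<lambda>_. undefined)
        \<in> ts_hom ?D1 (tgt p)"
      by (rule mk_map_hom[OF regular_ts_weak[OF discrete_regular]]) (use dp st in \<open>auto simp: discrete_def\<close>)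
    show ?thesis
    proof (rule has_liftingE[OF lift[OF generating_cofibrations_mem(2)] i u v p])
      fix h
      assume "\<And>e. e \<in> states ?D2 \<Longrightarrow> on_states h (on_states two_points_to_point e) =
        on_states (mk_map ?D2 (src p) (\<lambda>e. if e = [0] then s else t) (\<lambda>_. undefined)) e"
      from this[of "[0]"] this[of "[1]"] show "s = t"
        by (simp add: discrete_def two_points_to_point_mk)
    qed (use st in \<open>auto simp: discrete_def two_points_to_point_mk\<close>)
  qed
  have bij: "bij_betw (on_states p) (states (src p)) (states (tgt p))"
    using surj inj dp(5) by (auto simp: bij_betw_def inj_on_def image_iff)
  \<comment> \<open>The boundary of a 1-cube has no action, so the lift yields some action over
    \<open>b\<close>, over which there is no control yet.\<close>
  have edge: "\<exists>a. (\<alpha>, [a], \<beta>) \<in> transitions (src p) \<and> on_actions p a = b"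
    if t: "\<alpha> \<in> states (src p)" "\<beta> \<in> states (src p)" "(on_states p \<alpha>, [b], on_states p \<beta>) \<in> transitions (tgt p)"
    for \<alpha> \<beta> b
  proof -
    define x where "x = label (tgt p) b"
    have i: "boundary_inclusion [x] \<in> ts_hom (cube_boundary [x]) (cube [x])"
      using genh[OF generating_cofibrations_mem(3), of "[x]"] by (simp add: boundary_inclusion_mk)
    have u: "mk_map (cube_boundary [x]) (src p) (\<lambda>e. if e = [0] then \<alpha> else \<beta>) (\<lambda>_. undefined)
        \<in> ts_hom (cube_boundary [x]) (src p)"
      by (rule mk_map_hom) (use dp t in \<open>auto simp: ts_homD[OF i] cube_boundary_single\<close>)
    have v: "edge_map (tgt p) (on_states p \<alpha>) b (on_states p \<beta>) \<in> ts_hom (cube [x]) (tgt p)"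
      unfolding x_def by (rule edge_map_hom[OF dp(4) t(3)])
    obtain h where h: "h \<in> ts_hom (cube [x]) (src p)"
      "\<And>s. s \<in> states (cube_boundary [x]) \<Longrightarrow> on_states h s = (if s = [0] then \<alpha> else \<beta>)"
      "on_actions p (on_actions h (x, 0)) = b"
      by (rule has_liftingE[OF lift[OF generating_cofibrations_mem(3)] i u v p])
         (auto simp: boundary_inclusion_mk cube_boundary_single cube_single x_def)
    have "(on_states h [0], [on_actions h (x, 0)], on_states h [1]) \<in> transitions (src p)"
      using ts_homD(8)[OF h(1), of "[0]" "[(x, 0)]" "[1]"] by (simp add: cube_single)
    then show ?thesis using h(2)[of "[0]"] h(2)[of "[1]"] h(3) by (auto simp: cube_boundary_single)
  qed
  have acts: "actions (tgt p) \<subseteq> on_actions p ` actions (src p)"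
  proof
    fix b assume "b \<in> actions (tgt p)"
    then obtain a' b' where t: "(a', [b], b') \<in> transitions (tgt p)" using regular_ts_usedD[OF Y] by blast
    obtain \<alpha> \<beta> where "\<alpha> \<in> states (src p)" "\<beta> \<in> states (src p)" "on_states p \<alpha> = a'" "on_states p \<beta> = b'"
      using surj weak_ts_transD[OF dp(4) t] by metis
    then obtain a where "(\<alpha>, [a], \<beta>) \<in> transitions (src p)" "on_actions p a = b" using edge t by blast
    then show "b \<in> on_actions p ` actions (src p)" using weak_ts_transD(3)[OF dp(3)] by fastforce
  qed
  \<comment> \<open>Now the action is prescribed. Regularity of the source gives it some edge, and
    lifting against \<open>cube_to_double\<close> adds the required one with the same
    action.\<close>
  have edge_refl: "(\<alpha>, [a], \<beta>) \<in> transitions (src p)"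
    if t: "\<alpha> \<in> states (src p)" "\<beta> \<in> states (src p)" "a \<in> actions (src p)"
      "(on_states p \<alpha>, [on_actions p a], on_states p \<beta>) \<in> transitions (tgt p)" for \<alpha> a \<beta>
  proof -
    define x where "x = label (src p) a"
    obtain \<gamma> \<delta> where e: "(\<gamma>, [a], \<delta>) \<in> transitions (src p)" using regular_ts_usedD[OF X t(3)] by blast
    have e': "(on_states p \<gamma>, [on_actions p a], on_states p \<delta>) \<in> transitions (tgt p)"
      using dp(8)[OF e] by simp
    have i: "cube_to_double x \<in> ts_hom (cube [x]) (double_transition x)"
      using genh[OF generating_cofibrations_mem(4)] by (simp add: cube_to_double_mk)
    have u: "edge_map (src p) \<gamma> a \<delta> \<in> ts_hom (cube [x]) (src p)"
      unfolding x_def by (rule edge_map_hom[OF dp(3) e])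
    define f where "f = (\<lambda>e. if e = [1] then \<gamma> else if e = [2] then \<delta> else if e = [3::nat] then \<alpha> else \<beta>)"
    have v: "mk_map (double_transition x) (tgt p) (\<lambda>e. on_states p (f e)) (\<lambda>_. on_actions p a)
        \<in> ts_hom (double_transition x) (tgt p)"
      by (rule mk_map_hom[OF ts_homD(4)[OF i] dp(4)])
        (use t e e' weak_ts_transD[OF dp(3) e] dp(5,6,7) in
          \<open>auto simp: double_transition_def f_def x_def\<close>)
    obtain h where h: "h \<in> ts_hom (double_transition x) (src p)"
      "on_actions h (x, 0) = a"
      "\<And>s. s \<in> {[1],[2],[3],[4]} \<Longrightarrow> on_states p (on_states h s) = on_states p (f s)"
      by (rule has_liftingE[OF lift[OF generating_cofibrations_mem(4)] i u v p])
         (auto simp: cube_to_double_mk cube_single x_def f_def double_transition_def)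
    have s: "on_states h [3] = \<alpha>" "on_states h [4] = \<beta>"
      using inj[OF ts_homD(5)[OF h(1)] t(1), of "[3]"] inj[OF ts_homD(5)[OF h(1)] t(2), of "[4]"]
        h(3)[of "[3]"] h(3)[of "[4]"] by (auto simp: f_def double_transition_def)
    have "(on_states h [3], [on_actions h (x, 0)], on_states h [4]) \<in> transitions (src p)"
      using ts_homD(8)[OF h(1), of "[3]" "[(x, 0)]" "[4]"] by (simp add: double_transition_def)
    then show ?thesis using s h(2) by simp
  qed
  have "(\<alpha>, us, \<beta>) \<in> transitions (src p)"
    if "\<alpha> \<in> states (src p)" "\<beta> \<in> states (src p)" "set us \<subseteq> actions (src p)"
      "(on_states p \<alpha>, map (on_actions p) us, on_states p \<beta>) \<in> transitions (tgt p)" for \<alpha> us \<beta>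
    using that
  proof (induction "length us" arbitrary: \<alpha> us \<beta> rule: less_induct)
    case less
    have ne: "us \<noteq> []" using weak_ts_transD(2)[OF dp(4) less.prems(4)] by simp
    show ?case
    proof (cases "length us = 1")
      case True
      then obtain a where "us = [a]" by (auto simp: length_Suc_conv)
      then show ?thesis using edge_refl less.prems by simp
    next
      case False
      \<comment> \<open>The transition downstairs is filled to a cube. The induction hypothesis
        lifts all its transitions of smaller length, which gives a map from the boundary to
        \<open>src p\<close>; the boundary inclusion then supplies the long diagonal.\<close>
      define n xs where "n = length us" and "xs = map (label (src p)) us"
      have len: "length xs = n" "xs \<noteq> []" "length xs \<noteq> 1" using False ne by (auto simp: n_def xs_def)
      have xs: "map (label (tgt p)) (map (on_actions p) us) = xs"
        using dp(7) less.prems(3) by (auto simp: xs_def)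
      obtain k where k: "k \<in> ts_hom (cube xs) (tgt p)"
        "on_states k (replicate n 0) = on_states p \<alpha>" "on_states k (replicate n 1) = on_states p \<beta>"
        "\<And>i. i < n \<Longrightarrow> on_actions k (xs ! i, i) = on_actions p (us ! i)"
      proof (rule cube_fill[OF Y less.prems(4)])
        fix k assume k: "k \<in> ts_hom (cube (map (label (tgt p)) (map (on_actions p) us))) (tgt p)"
          "on_states k (replicate (length (map (on_actions p) us)) 0) = on_states p \<alpha>"
          "on_states k (replicate (length (map (on_actions p) us)) 1) = on_states p \<beta>"
          "\<And>i. i < length (map (on_actions p) us) \<Longrightarrow>
             on_actions k (label (tgt p) (map (on_actions p) us ! i), i) = map (on_actions p) us ! i"
        show thesis
        proof (rule that)
          show "k \<in> ts_hom (cube xs) (tgt p)" using k(1) xs by metis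
          fix i assume "i < n"
          then show "on_actions k (xs ! i, i) = on_actions p (us ! i)"
            using k(4)[of i] dp(7)[of "us ! i"] less.prems(3) by (simp add: n_def xs_def subset_iff)
        qed (use k(2,3) in \<open>simp_all add: n_def\<close>)
      qed
      note dk = ts_homD[OF k(1)]
      define f where "f = (\<lambda>e. inv_into (states (src p)) (on_states p) (on_states k e))"
      have f: "f e \<in> states (src p)" "on_states p (f e) = on_states k e" if "e \<in> states (cube xs)" for e
        using dk(5)[OF that] bij_betw_imp_surj_on[OF bij] unfolding f_def
        by (auto intro: inv_into_into f_inv_into_f)
      have i: "boundary_inclusion xs \<in> ts_hom (cube_boundary xs) (cube xs)"
        using genh[OF generating_cofibrations_mem(3)[OF len(2)]] by (simp add: boundary_inclusion_mk)
      have act: "a = (xs ! snd a, snd a)" "snd a < n" if "a \<in> actions (cube xs)" for a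
        using that len by (auto simp: cube_actions)
      have u: "mk_map (cube_boundary xs) (src p) f (\<lambda>a. us ! snd a) \<in> ts_hom (cube_boundary xs) (src p)"
      proof (rule mk_map_hom[OF ts_homD(3)[OF i] dp(3)])
        fix \<gamma> vs \<delta> assume t: "(\<gamma>, vs, \<delta>) \<in> transitions (cube_boundary xs)"
        then have t': "(\<gamma>, vs, \<delta>) \<in> transitions (cube xs)" "length vs \<noteq> n"
          using len by (auto simp: cube_boundary_sel)
        note tt = weak_ts_transD[OF cube_weak t'(1)]
        have "on_actions k a = on_actions p (us ! snd a)" if "a \<in> set vs" for a
          using act[of a] k(4)[of "snd a"] that tt(3) by (metis subsetD)
        then have "map (on_actions p) (map (\<lambda>a. us ! snd a) vs) = map (on_actions k) vs" by simp
        then have "(on_states p (f \<gamma>), map (on_actions p) (map (\<lambda>a. us ! snd a) vs), on_states p (f \<delta>))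
            \<in> transitions (tgt p)"
          using dk(8)[OF t'(1)] f(2) tt by (simp del: map_map map_eq_conv)
        moreover have "set (map (\<lambda>a. us ! snd a) vs) \<subseteq> actions (src p)"
          using act tt(3) less.prems(3) nth_mem by (fastforce simp: n_def)
        ultimately show "(f \<gamma>, map (\<lambda>a. us ! snd a) vs, f \<delta>) \<in> transitions (src p)"
          using less.hyps[of "map (\<lambda>a. us ! snd a) vs"] f(1) tt t'(2) cube_trans_length[OF t'(1)] len
          by (simp add: n_def)
      next
        fix a assume "a \<in> actions (cube_boundary xs)"
        then have a: "a \<in> actions (cube xs)" "label (cube_boundary xs) a = fst a"
          using len by (auto simp: cube_boundary_sel)
        show "us ! snd a \<in> actions (src p)" using act(2)[OF a(1)] less.prems(3) by (auto simp: n_def)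
        show "label (src p) (us ! snd a) = label (cube_boundary xs) a"
          using act[OF a(1)] a(2) by (metis fst_conv n_def nth_map xs_def)
      qed (use f in \<open>auto simp: cube_boundary_sel\<close>)
      \<comment> \<open>From dimension 2 on the boundary has all actions of the cube, so the lift is
        bound to carry the prescribed word \<open>us\<close>.\<close>
      obtain h where h: "h \<in> ts_hom (cube xs) (src p)"
        "\<And>s. s \<in> states (cube_boundary xs) \<Longrightarrow> on_states h s = f s"
        "\<And>a. a \<in> actions (cube_boundary xs) \<Longrightarrow> on_actions h a = us ! snd a"
      proof (rule has_liftingE[OF lift[OF generating_cofibrations_mem(3)[OF len(2)]] i u k(1) p])
        fix a assume a: "a \<in> actions (cube_boundary xs)"
        then have "a \<in> actions (cube xs)" using len by (auto simp: cube_boundary_sel)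
        then have "on_actions k a = on_actions p (us ! snd a)" using act k(4) by metis
        then show "on_actions p (on_actions (mk_map (cube_boundary xs) (src p) f (\<lambda>a. us ! snd a)) a) =
            on_actions k (on_actions (boundary_inclusion xs) a)"
          using a by (simp add: boundary_inclusion_mk)
      qed (use f in \<open>auto simp: boundary_inclusion_mk cube_boundary_sel(1)\<close>)
      have zero: "replicate n 0 \<in> states (cube xs)" "replicate n 1 \<in> states (cube xs)"
        using len by (auto simp: cube_states)
      have fab: "f (replicate n 0) = \<alpha>" "f (replicate n 1) = \<beta>"
        using f[OF zero(1)] f[OF zero(2)] inj less.prems(1,2) k(2,3) by auto
      have "(replicate n 0, map (cube_act xs) [0..<n], replicate n 1) \<in> transitions (cube xs)"
        using cube_top[OF len(2)] unfolding len(1) .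
      from ts_homD(8)[OF h(1) this]
      have "(\<alpha>, map (on_actions h) (map (cube_act xs) [0..<n]), \<beta>) \<in> transitions (src p)"
        using h(2) zero fab by (simp add: cube_boundary_sel(1))
      moreover have "map (on_actions h) (map (cube_act xs) [0..<n]) = us"
      proof (rule nth_equalityI)
        fix i assume "i < length (map (on_actions h) (map (cube_act xs) [0..<n]))"
        then have "i < n" by simp
        then show "map (on_actions h) (map (cube_act xs) [0..<n]) ! i = us ! i"
          using h(3)[of "cube_act xs i"] len by (auto simp: cube_boundary_sel(2) cube_actions)
      qed (simp add: n_def)
      ultimately show ?thesis by simp
    qed
  qed
  then show ?thesis using bij acts unfolding action_cover_def by blast
qed

lemma rts_mapsD:
  assumes "f \<in> rts_maps \<kappa>"
  shows "f \<in> ts_hom (src f) (tgt f)" "regular_ts (src f)" "regular_ts (tgt f)"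
    "src f \<in> rts \<kappa>" "tgt f \<in> rts \<kappa>"
  using assms by (auto simp: rts_maps_def rts_def)

lemma rts_mapsI: "f \<in> ts_hom X Y \<Longrightarrow> X \<in> rts \<kappa> \<Longrightarrow> Y \<in> rts \<kappa> \<Longrightarrow> f \<in> rts_maps \<kappa>"
  using ts_homD(1,2)[of f X Y] by (simp add: rts_maps_def)

text \<open>Cofibrations are defined by lifting against \<open>rlp\<close>, whose members are action
  covers; these lift against every map that is injective on actions.\<close>

lemma cofibrationsI:
  assumes "i \<in> rts_maps \<kappa>" "inj_on (on_actions i) (actions (src i))"
  shows "i \<in> cofibrations \<kappa>"
  unfolding cofibrations_def
proof (intro CollectI conjI ballI)
  fix p :: "('a, 'a, 'a, 'a, 'b) ts_map" assume p: "p \<in> rlp \<kappa> generating_cofibrations"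
  then have p': "p \<in> rts_maps \<kappa>" by (simp add: rlp_def)
  show "has_lifting i p"
    by (rule action_cover_lifting[OF rts_mapsD(1)[OF p'] action_cover_if_lifting[OF rts_mapsD(1-3)[OF p']]])
      (use p assms rts_mapsD in \<open>auto simp: rlp_def\<close>)
qed fact

lemma action_cover_rlp:
  fixes p :: "('u, 'u, 'u, 'u, 'l) ts_map"
  assumes "p \<in> rts_maps \<kappa>" "action_cover p"
  shows "p \<in> rlp \<kappa> (cofibrations \<kappa> :: ('u, 'u, 'u, 'u, 'l) ts_map set)"
proof -
  have "p \<in> rlp \<kappa> generating_cofibrations"
    using assms action_cover_lifting[OF rts_mapsD(1)[OF assms(1)] assms(2)] generating_cofibration_hom
    by (auto simp: rlp_def)
  then show ?thesis using assms(1) by (auto simp: rlp_def cofibrations_def)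
qed

section \<open>Localizers and inclusions\<close>

text \<open>Room for constructions inside a fixed type: a set of fewer than \<kappa> elements never
  exhausts \<open>'u\<close>, so fresh actions can be chosen there. \<open>U\<close> serves to fix
  the type.\<close>

locale large_type =
  fixes \<kappa> :: "'k rel" and U :: "'u itself"
  assumes card: "Card_order \<kappa>" and uncountable: "natLeq <o \<kappa>" and enough: "\<kappa> \<le>o |UNIV :: 'u set|"
begin

lemma infinite_Field: "infinite (Field \<kappa>)"
  using ordLess_imp_ordLeq[OF uncountable] ordIso_symmetric[OF card_of_Field_ordIso[OF card]]
    infinite_iff_natLeq_ordLeq ordLeq_ordIso_trans by blast

lemma finite_small: "finite A \<Longrightarrow> |A| <o \<kappa>"
  using finite_iff_ordLess_natLeq ordLess_transitive uncountable by blast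

lemma insert_small: "|A| <o \<kappa> \<Longrightarrow> |insert a A| <o \<kappa>"
  using card_of_Un_ordLess_infinite_Field[OF infinite_Field card _ finite_small[of "{a}"], of A] by simp

lemma fresh_element:
  assumes "|A :: 'u set| <o \<kappa>"
  obtains w where "w \<notin> A"
proof -
  have "A \<noteq> UNIV" using assms enough not_ordLess_ordLeq by blast
  then show ?thesis using that by blast
qed

end

lemma rtsI: "regular_ts X \<Longrightarrow> |states X| <o \<kappa> \<Longrightarrow> |actions X| <o \<kappa> \<Longrightarrow> X \<in> rts \<kappa>"
  by (simp add: rts_def wts_def regular_ts_weak)

lemma rtsD:
  assumes "X \<in> rts \<kappa>"
  shows "regular_ts X" "weak_ts X" "|states X| <o \<kappa>" "|actions X| <o \<kappa>"
  using assms by (auto simp: rts_def wts_def)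

lemma ts_incl_rts_maps: "X \<in> rts \<kappa> \<Longrightarrow> Y \<in> rts \<kappa> \<Longrightarrow> sub_ts X Y \<Longrightarrow> ts_incl X Y \<in> rts_maps \<kappa>"
  by (rule rts_mapsI[OF ts_incl_hom]) (auto dest: rtsD)

lemma ts_incl_cofibration:
  assumes "X \<in> rts \<kappa>" "Y \<in> rts \<kappa>" "sub_ts X Y"
  shows "ts_incl X Y \<in> cofibrations \<kappa>"
  by (rule cofibrationsI[OF ts_incl_rts_maps[OF assms]]) (simp add: inj_on_def)

text \<open>A criterion for pushouts of inclusions with constant states. Injectivity concerns the
  new actions of \<open>K'\<close> only: \<open>fa\<close> may identify the actions of
  \<open>K\<close>, and when \<open>K'\<close> has no new action the pushout merely adds
  transitions. The mediating map is \<open>v\<close> on \<open>B\<close> and is forced by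
  \<open>w\<close> on everything new.\<close>

lemma pushout_incl:
  assumes ob: "K \<in> Ob" "K' \<in> Ob" "B \<in> Ob" "B' \<in> Ob"
    and sub: "sub_ts K K'" "sub_ts B B'" and st: "states K' = states K" "states B' = states B"
    and k: "mk_map K B fs fa \<in> ts_hom K B" and k': "mk_map K' B' fs fa \<in> ts_hom K' B'"
    and inj: "inj_on fa (actions K' - actions K)"
    and new: "fa ` (actions K' - actions K) \<inter> actions B = {}"
    and acts: "actions B' \<subseteq> actions B \<union> fa ` actions K'"
    and trans: "\<And>\<alpha> us \<beta>. (\<alpha>, us, \<beta>) \<in> transitions B' \<Longrightarrow> (\<alpha>, us, \<beta>) \<notin> transitions B \<Longrightarrow>
        trans_image fs fa (transitions K') \<alpha> us \<beta>"
  shows "ts_pushout Ob (ts_incl K K') (mk_map K B fs fa) (ts_incl B B') (mk_map K' B' fs fa)"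
proof -
  note dk = ts_homD[OF k] and dk' = ts_homD[OF k']
  have subK: "states K \<subseteq> states K'" "actions K \<subseteq> actions K'" "transitions K \<subseteq> transitions K'"
    and subB: "states B \<subseteq> states B'" "actions B \<subseteq> actions B'" "transitions B \<subseteq> transitions B'"
      "\<And>a. a \<in> actions B \<Longrightarrow> label B' a = label B a"
    using sub by (auto simp: sub_ts_def)
  have i: "ts_incl K K' \<in> ts_hom K K'" by (rule ts_incl_hom[OF sub(1) dk(3) dk'(3)])
  have j: "ts_incl B B' \<in> ts_hom B B'" by (rule ts_incl_hom[OF sub(2) dk(4) dk'(4)])
  have faK: "fa a \<in> actions B" if "a \<in> actions K" for a using dk(6)[OF that] that by simp
  have fsK: "fs s \<in> states B" if "s \<in> states K" for s using dk(5)[OF that] that by simp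
  have comm: "ts_incl B B' \<circ>\<^sub>t mk_map K B fs fa = mk_map K' B' fs fa \<circ>\<^sub>t ts_incl K K'"
    by (rule ts_hom_eqI[OF ts_comp_hom[OF k j] ts_comp_hom[OF i k']])
       (use subK faK fsK in \<open>auto simp: subset_iff\<close>)
  have univ: "\<exists>!g. g \<in> ts_hom B' Z \<and> g \<circ>\<^sub>t ts_incl B B' = v \<and> g \<circ>\<^sub>t mk_map K' B' fs fa = w"
    if v: "v \<in> ts_hom B Z" and w: "w \<in> ts_hom K' Z"
      and eq: "v \<circ>\<^sub>t mk_map K B fs fa = w \<circ>\<^sub>t ts_incl K K'" for Z v w
  proof -
    note dv = ts_homD[OF v] and dw = ts_homD[OF w]
    have eqs: "on_states v (fs s) = on_states w s" if "s \<in> states K" for s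
      using arg_cong[OF eq, of "\<lambda>f. on_states f s"] that subK by auto
    have eqa: "on_actions v (fa a) = on_actions w a" if "a \<in> actions K" for a
      using arg_cong[OF eq, of "\<lambda>f. on_actions f a"] that subK by auto
    \<comment> \<open>An action outside \<open>B\<close> has exactly one preimage among the new
      actions of \<open>K'\<close>, and \<open>w\<close> is evaluated there.\<close>
    define ga where "ga = (\<lambda>b. if b \<in> actions B then on_actions v b
      else on_actions w (inv_into (actions K' - actions K) fa b))"
    have gaK: "ga (fa a) = on_actions w a" if "a \<in> actions K'" for a
    proof (cases "a \<in> actions K")
      case True
      then show ?thesis using faK eqa by (simp add: ga_def)
    next
      case False
      then show ?thesis using that new inj by (auto simp: ga_def)
    qed
    have gaB: "ga b = on_actions v b" if "b \<in> actions B" for b using that by (simp add: ga_def)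
    define g where "g = mk_map B' Z (on_states v) ga"
    have g: "g \<in> ts_hom B' Z"
      unfolding g_def
    proof (rule mk_map_hom[OF dk'(4) dv(4)])
      fix b assume b: "b \<in> actions B'"
      have "ga b \<in> actions Z \<and> label Z (ga b) = label B' b"
      proof (cases "b \<in> actions B")
        case True
        then show ?thesis using gaB dv(6,7) subB(4) by simp
      next
        case False
        then obtain a where a: "a \<in> actions K'" "b = fa a" using b acts by blast
        then show ?thesis using gaK dw(6,7) dk'(7)[OF a(1)] by simp
      qed
      then show "ga b \<in> actions Z" "label Z (ga b) = label B' b" by blast+
    next
      fix \<alpha> us \<beta> assume t: "(\<alpha>, us, \<beta>) \<in> transitions B'"
      show "(on_states v \<alpha>, map ga us, on_states v \<beta>) \<in> transitions Z"
      proof (cases "(\<alpha>, us, \<beta>) \<in> transitions B")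
        case True
        then have "map ga us = map (on_actions v) us"
          using weak_ts_transD(3)[OF dk(4)] gaB by (auto simp: subset_iff)
        then show ?thesis using dv(8)[OF True] by (simp del: map_eq_conv)
      next
        case False
        obtain \<alpha>' us' \<beta>' where t': "(\<alpha>', us', \<beta>') \<in> transitions K'"
          and e: "\<alpha> = fs \<alpha>'" "us = map fa us'" "\<beta> = fs \<beta>'"
          using trans[OF t False] by blast
        note tt = weak_ts_transD[OF dk'(3) t']
        have "map ga us = map (on_actions w) us'" using tt(3) gaK e(2) by auto
        then show ?thesis using dw(8)[OF t'] eqs tt e st by (simp del: map_eq_conv)
      qed
    qed (use dv st in auto)
    have g1: "g \<circ>\<^sub>t ts_incl B B' = v"
      by (rule ts_hom_eqI[OF ts_comp_hom[OF j g] v])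
         (use subB gaB in \<open>auto simp: g_def subset_iff\<close>)
    have g2: "g \<circ>\<^sub>t mk_map K' B' fs fa = w"
      by (rule ts_hom_eqI[OF ts_comp_hom[OF k' g] w])
         (use dk'(5,6) gaK eqs st in \<open>auto simp: g_def\<close>)
    show ?thesis
    proof (rule ex1I[of _ g])
      fix h assume h: "h \<in> ts_hom B' Z \<and> h \<circ>\<^sub>t ts_incl B B' = v \<and> h \<circ>\<^sub>t mk_map K' B' fs fa = w"
      show "h = g"
      proof (rule ts_hom_eqI[OF _ g])
        show "h \<in> ts_hom B' Z" using h by blast
        fix s assume s: "s \<in> states B'"
        then show "on_states h s = on_states g s"
          using h st by (auto simp: g_def)
      next
        fix b assume b: "b \<in> actions B'"
        show "on_actions h b = on_actions g b"
        proof (cases "b \<in> actions B")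
          case True
          then show ?thesis using h b by (auto simp: g_def ga_def)
        next
          case False
          then obtain a where a: "a \<in> actions K'" "b = fa a" using b acts by blast
          have "on_actions h b = on_actions w a"
            using h a by auto
          then show ?thesis using gaK[OF a(1)] a b by (simp add: g_def)
        qed
      qed
    qed (use g g1 g2 in blast)
  qed
  show ?thesis
    unfolding ts_pushout_def using ob i k j k' comm univ by blast
qed

section \<open>Closure properties of a fixed localizer\<close>

locale localizer = large_type \<kappa> U for \<kappa> :: "'k rel" and U :: "'u itself" +
  fixes W :: "('u, 'u, 'u, 'u, 'l) ts_map set"
  assumes localizer: "grothendieck_localizer \<kappa> W"
begin

lemma W_rts_maps: "f \<in> W \<Longrightarrow> f \<in> rts_maps \<kappa>"
  using localizer unfolding grothendieck_localizer_def by blast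

lemma W_comp:
  assumes "f \<in> W" "g \<in> W" "tgt f = src g"
  shows "g \<circ>\<^sub>t f \<in> W"
  using localizer W_rts_maps assms unfolding grothendieck_localizer_def by blast

lemma W_cancel_right:
  assumes "g \<in> rts_maps \<kappa>" "tgt f = src g" "f \<in> W" "g \<circ>\<^sub>t f \<in> W"
  shows "g \<in> W"
  using localizer W_rts_maps assms unfolding grothendieck_localizer_def by blast

lemma W_cancel_left:
  assumes "f \<in> rts_maps \<kappa>" "tgt f = src g" "g \<in> W" "g \<circ>\<^sub>t f \<in> W"
  shows "f \<in> W"
  using localizer W_rts_maps assms unfolding grothendieck_localizer_def by blast

lemma W_cover: "f \<in> rts_maps \<kappa> \<Longrightarrow> action_cover f \<Longrightarrow> f \<in> W"
  using action_cover_rlp localizer unfolding grothendieck_localizer_def by blast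

lemma W_id:
  assumes "X \<in> rts \<kappa>"
  shows "ts_id X \<in> W"
proof (rule W_cover)
  show "ts_id X \<in> rts_maps \<kappa>" by (rule rts_mapsI[OF ts_id_hom]) (use assms rtsD in blast)+
  have "map (on_actions (ts_id X)) us = us" if "set us \<subseteq> actions X" for us
    using that by (auto simp: ts_id_mk intro!: map_idI)
  then show "action_cover (ts_id X)"
    unfolding action_cover_def bij_betw_def by (auto simp: ts_id_mk inj_on_def image_iff)
qed

lemma W_pushout:
  assumes "f \<in> W" "f \<in> cofibrations \<kappa>" "ts_pushout (rts \<kappa>) f u f' u'"
  shows "f' \<in> W"
  using localizer assms unfolding grothendieck_localizer_def by blast

lemma W_pushout_incl:
  assumes W: "ts_incl K K' \<in> W"
    and ob: "B \<in> rts \<kappa>" "B' \<in> rts \<kappa>"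
    and sub: "sub_ts K K'" "sub_ts B B'" and st: "states K' = states K" "states B' = states B"
    and k: "mk_map K B fs fa \<in> ts_hom K B" and k': "mk_map K' B' fs fa \<in> ts_hom K' B'"
    and inj: "inj_on fa (actions K' - actions K)"
    and new: "fa ` (actions K' - actions K) \<inter> actions B = {}"
    and acts: "actions B' \<subseteq> actions B \<union> fa ` actions K'"
    and trans: "\<And>\<alpha> us \<beta>. (\<alpha>, us, \<beta>) \<in> transitions B' \<Longrightarrow> (\<alpha>, us, \<beta>) \<notin> transitions B \<Longrightarrow>
        trans_image fs fa (transitions K') \<alpha> us \<beta>"
  shows "ts_incl B B' \<in> W"
proof -
  have K: "K \<in> rts \<kappa>" "K' \<in> rts \<kappa>" using rts_mapsD(4,5)[OF W_rts_maps[OF W]] by auto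
  show ?thesis
    by (rule W_pushout[OF W ts_incl_cofibration[OF K sub(1)]
          pushout_incl[OF K ob sub st k k' inj new acts trans]])
qed

lemma W_incl_comp:
  assumes "ts_incl X Y \<in> W" "ts_incl Y Z \<in> W" "sub_ts X Y"
  shows "ts_incl X Z \<in> W"
  using W_comp[OF assms(1,2)] ts_incl_comp[OF assms(3)] by simp

lemma W_incl_cancel:
  assumes "ts_incl X Y \<in> W" "ts_incl X Z \<in> W" "sub_ts X Y" "sub_ts Y Z"
  shows "ts_incl Y Z \<in> W"
proof (rule W_cancel_right[OF _ _ assms(1)])
  show "ts_incl Y Z \<in> rts_maps \<kappa>"
    using ts_incl_rts_maps[OF _ _ assms(4)] rts_mapsD(5)[OF W_rts_maps[OF assms(1)]]
      rts_mapsD(5)[OF W_rts_maps[OF assms(2)]] by auto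
  show "ts_incl Y Z \<circ>\<^sub>t ts_incl X Y \<in> W" using assms(2) ts_incl_comp[OF assms(3)] by simp
qed simp

end

section \<open>Adding an edge and duplicating an action\<close>

text \<open>The action \<open>v\<close>, fresh or already present, gets one edge parallel to an edge of \<open>u\<close>,
  respectively all transitions in which \<open>u\<close> takes part.\<close>

definition add_edge :: "'s \<Rightarrow> 'a \<Rightarrow> 'a \<Rightarrow> 's \<Rightarrow> ('s, 'a, 'l) ts \<Rightarrow> ('s, 'a, 'l) ts" where
  "add_edge \<alpha> u v \<beta> B = \<lparr>states = states B, actions = insert v (actions B),
     label = (label B)(v := label B u), transitions = insert (\<alpha>, [v], \<beta>) (transitions B)\<rparr>"

text \<open>Each occurrence of \<open>u\<close> is kept or replaced on its own, so a word in which
  \<open>u\<close> is repeated also yields words that mix \<open>u\<close> and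
  \<open>v\<close>.\<close>

abbreviation may_replace :: "'a \<Rightarrow> 'a \<Rightarrow> 'a \<Rightarrow> 'a \<Rightarrow> bool" where
  "may_replace u v a b \<equiv> b = a \<or> a = u \<and> b = v"

definition dup_action :: "'a \<Rightarrow> 'a \<Rightarrow> ('s, 'a, 'l) ts \<Rightarrow> ('s, 'a, 'l) ts" where
  "dup_action u v B = \<lparr>states = states B, actions = insert v (actions B),
     label = (label B)(v := label B u), transitions = subst_trans (may_replace u v) (transitions B)\<rparr>"

lemma add_edge_sel [simp]:
  "states (add_edge \<alpha> u v \<beta> B) = states B" "actions (add_edge \<alpha> u v \<beta> B) = insert v (actions B)"
  "label (add_edge \<alpha> u v \<beta> B) = (label B)(v := label B u)"
  "transitions (add_edge \<alpha> u v \<beta> B) = insert (\<alpha>, [v], \<beta>) (transitions B)"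
  by (auto simp: add_edge_def)

lemma dup_action_sel [simp]:
  "states (dup_action u v B) = states B" "actions (dup_action u v B) = insert v (actions B)"
  "label (dup_action u v B) = (label B)(v := label B u)"
  "transitions (dup_action u v B) = subst_trans (may_replace u v) (transitions B)"
  by (auto simp: dup_action_def)

lemma subst_trans_refl: "(\<And>a. R a a) \<Longrightarrow> T \<subseteq> subst_trans R T"
  unfolding subst_trans_def by (auto intro: list_all2_refl)

lemma subst_transI: "(\<alpha>, us, \<beta>) \<in> T \<Longrightarrow> list_all2 R us vs \<Longrightarrow> (\<alpha>, vs, \<beta>) \<in> subst_trans R T"
  unfolding subst_trans_def by blast

lemma subst_transE:
  assumes "(\<alpha>, vs, \<beta>) \<in> subst_trans R T"
  obtains us where "(\<alpha>, us, \<beta>) \<in> T" "list_all2 R us vs"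
  using assms unfolding subst_trans_def by blast

lemma list_all2_map_eq:
  assumes "list_all2 R us vs" "\<And>a b. a \<in> set us \<Longrightarrow> R a b \<Longrightarrow> h b = h' a"
  shows "map h vs = map h' us"
  using assms(1)
  by (intro nth_equalityI) (auto simp: list_all2_conv_all_nth intro!: assms(2))

lemma list_all2_set:
  assumes "list_all2 R us vs" "b \<in> set vs"
  obtains a where "a \<in> set us" "R a b"
proof -
  obtain i where "i < length vs" "b = vs ! i" using assms(2) by (auto simp: in_set_conv_nth)
  then show ?thesis using that[of "us ! i"] assms(1) by (auto simp: list_all2_conv_all_nth)
qed

lemma lies_overD:
  assumes "lies_over B X f h"
  shows "regular_ts X" "inj_on f (states B)"
    "(\<alpha>, us, \<beta>) \<in> transitions B \<Longrightarrow> (f \<alpha>, map h us, f \<beta>) \<in> transitions X"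
  using assms by (auto simp: lies_over_def)

lemma upd_extensional: "f \<in> extensional A \<Longrightarrow> f(v := y) \<in> extensional (insert v A)"
  by (auto simp: extensional_def)

lemma subst_good:
  assumes "good_trans T"
  shows "good_trans (subst_trans R T)"
  using good_trans_subst[OF assms, of "{}" R] by simp

text \<open>Because of \<open>h v = h u\<close> the new edge lies over an edge already present in
  \<open>X\<close>, and being of length 1 it creates no splittings.\<close>

lemma regular_add_edge:
  assumes B: "regular_ts B" and over: "lies_over B X f h"
    and e: "(\<alpha>, [u], \<beta>) \<in> transitions B" and hv: "h v = h u"
  shows "lies_over (add_edge \<alpha> u v \<beta> B) X f h" "regular_ts (add_edge \<alpha> u v \<beta> B)"
proof -
  note w = regular_ts_weak[OF B] and o = lies_overD[OF over]
  note te = weak_ts_transD[OF w e]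
  show over': "lies_over (add_edge \<alpha> u v \<beta> B) X f h"
    unfolding lies_over_def using o(1,2) o(3) o(3)[OF e] hv by auto
  \<comment> \<open>Substitution by equality changes nothing, so the general fact about
    substitutions with extra edges covers the addition of a single edge.\<close>
  have "subst_trans (=) T = T" for T :: "('a \<times> 'b list \<times> 'a) set"
    unfolding subst_trans_def by (auto simp: list.rel_eq)
  then have good: "good_trans (insert (\<alpha>, [v], \<beta>) (transitions B))"
    using good_trans_subst[OF regular_ts_good[OF B], of "{(\<alpha>, [v], \<beta>)}" "(=)"] by simp
  show "regular_ts (add_edge \<alpha> u v \<beta> B)"
  proof (rule regular_ts_overI[OF over'])
    show "label (add_edge \<alpha> u v \<beta> B) \<in> extensional (actions (add_edge \<alpha> u v \<beta> B))"
      using w by (simp add: weak_ts_def upd_extensional)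
    show "\<exists>\<alpha>' \<beta>'. (\<alpha>', [a], \<beta>') \<in> transitions (add_edge \<alpha> u v \<beta> B)"
      if "a \<in> actions (add_edge \<alpha> u v \<beta> B)" for a
      using that B by (cases "a = v") (auto simp: regular_ts_def)
    show "\<gamma> \<in> states (add_edge \<alpha> u v \<beta> B) \<and> us \<noteq> [] \<and> set us \<subseteq> actions (add_edge \<alpha> u v \<beta> B) \<and>
        \<delta> \<in> states (add_edge \<alpha> u v \<beta> B)"
      if "(\<gamma>, us, \<delta>) \<in> transitions (add_edge \<alpha> u v \<beta> B)" for \<gamma> us \<delta>
      using that te weak_ts_transD[OF w, of \<gamma> us \<delta>] by auto
  qed (use good in simp)
qed

lemma regular_dup_action:
  assumes B: "regular_ts B" and over: "lies_over B X f h"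
    and u: "u \<in> actions B" and hv: "h v = h u"
  shows "lies_over (dup_action u v B) X f h" "regular_ts (dup_action u v B)"
proof -
  note w = regular_ts_weak[OF B] and o = lies_overD[OF over]
  show over': "lies_over (dup_action u v B) X f h"
    unfolding lies_over_def
  proof (intro conjI allI impI)
    fix \<alpha> vs \<beta> assume "(\<alpha>, vs, \<beta>) \<in> transitions (dup_action u v B)"
    then obtain us where us: "(\<alpha>, us, \<beta>) \<in> transitions B" "list_all2 (may_replace u v) us vs"
      by (auto elim: subst_transE)
    have "map h vs = map h us" by (rule list_all2_map_eq[OF us(2)]) (use hv in auto)
    then show "(f \<alpha>, map h vs, f \<beta>) \<in> transitions X" using o(3)[OF us(1)] by (simp del: map_eq_conv)
  qed (use o in auto)
  show "regular_ts (dup_action u v B)"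
  proof (rule regular_ts_overI[OF over'])
    show "label (dup_action u v B) \<in> extensional (actions (dup_action u v B))"
      using w by (simp add: weak_ts_def upd_extensional)
    show "\<exists>\<alpha> \<beta>. (\<alpha>, [a], \<beta>) \<in> transitions (dup_action u v B)"
      if a: "a \<in> actions (dup_action u v B)" for a
    proof -
      have "\<exists>b. b \<in> actions B \<and> may_replace u v b a" using a u by auto
      then obtain b where "b \<in> actions B" "may_replace u v b a" by blast
      moreover from this(1) obtain \<alpha> \<beta> where "(\<alpha>, [b], \<beta>) \<in> transitions B"
        using regular_ts_usedD[OF B] by blast
      ultimately show ?thesis using subst_transI[of \<alpha> "[b]" \<beta> _ "may_replace u v" "[a]"] by auto
    qed
    show "\<gamma> \<in> states (dup_action u v B) \<and> us \<noteq> [] \<and> set us \<subseteq> actions (dup_action u v B) \<and>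
        \<delta> \<in> states (dup_action u v B)"
      if t: "(\<gamma>, us, \<delta>) \<in> transitions (dup_action u v B)" for \<gamma> us \<delta>
    proof -
      obtain us' where us': "(\<gamma>, us', \<delta>) \<in> transitions B" "list_all2 (may_replace u v) us' us"
        using t by (auto elim: subst_transE)
      have "set us \<subseteq> insert v (set us')" using us'(2) by (auto elim!: list_all2_set)
      then show ?thesis using weak_ts_transD[OF w us'(1)] us'(2) by auto
    qed
  qed (use subst_good[OF regular_ts_good[OF B]] in simp)
qed

lemma sub_add_edge:
  assumes "v \<in> actions B \<Longrightarrow> label B v = label B u"
  shows "sub_ts B (add_edge \<alpha> u v \<beta> B)"
  using assms by (auto simp: sub_ts_def)

lemma sub_dup_action:
  assumes "v \<in> actions B \<Longrightarrow> label B v = label B u"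
  shows "sub_ts B (dup_action u v B)"
  using assms subst_trans_refl[of "may_replace u v"] by (auto simp: sub_ts_def)

lemma sub_add_edge_dup_action:
  assumes "(\<alpha>, [u], \<beta>) \<in> transitions B"
  shows "sub_ts (add_edge \<alpha> u v \<beta> B) (dup_action u v B)"
  using subst_transI[OF assms, of "may_replace u v" "[v]"] subst_trans_refl[of "may_replace u v"]
  by (auto simp: sub_ts_def)

text \<open>For a fresh \<open>v\<close> the system \<open>B\<close> serves as its own base, with
  \<open>v\<close> sent to \<open>u\<close>.\<close>

lemma lies_over_fresh:
  assumes "regular_ts B" "v \<notin> actions B"
  shows "lies_over B B id (id(v := u))"
  unfolding lies_over_def
proof (intro conjI allI impI)
  fix \<alpha> us \<beta> assume t: "(\<alpha>, us, \<beta>) \<in> transitions B"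
  have "map (id(v := u)) us = us"
    using weak_ts_transD(3)[OF regular_ts_weak[OF assms(1)] t] assms(2) by (intro map_idI) auto
  then show "(id \<alpha>, map (id(v := u)) us, id \<beta>) \<in> transitions B" using t by simp
qed (use assms in auto)

lemma ts_isoI:
  assumes f: "f \<in> ts_hom X Y"
    and s: "bij_betw (on_states f) (states X) (states Y)"
    and a: "bij_betw (on_actions f) (actions X) (actions Y)"
    and t: "\<And>\<alpha> us \<beta>. (\<alpha>, us, \<beta>) \<in> transitions Y \<Longrightarrow> trans_image (on_states f) (on_actions f) (transitions X) \<alpha> us \<beta>"
  shows "ts_iso f"
proof -
  note d = ts_homD[OF f]
  let ?s = "inv_into (states X) (on_states f)" and ?a = "inv_into (actions X) (on_actions f)"
  have s1: "?s y \<in> states X" "on_states f (?s y) = y" if "y \<in> states Y" for y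
    using s that by (auto simp: bij_betw_def intro: inv_into_into f_inv_into_f)
  have a1: "?a y \<in> actions X" "on_actions f (?a y) = y" if "y \<in> actions Y" for y
    using a that by (auto simp: bij_betw_def intro: inv_into_into f_inv_into_f)
  have s2: "?s (on_states f y) = y" if "y \<in> states X" for y
    using s that by (simp add: bij_betw_def)
  have a2: "?a (on_actions f y) = y" if "y \<in> actions X" for y
    using a that by (simp add: bij_betw_def)
  have g: "mk_map Y X ?s ?a \<in> ts_hom Y X"
  proof (rule mk_map_hom[OF d(4,3)])
    fix b assume b: "b \<in> actions Y"
    then show "label X (?a b) = label Y b" using d(7)[OF a1(1)[OF b]] a1(2)[OF b] by simp
  next
    fix \<alpha> us \<beta> assume "(\<alpha>, us, \<beta>) \<in> transitions Y"
    then obtain \<alpha>' us' \<beta>' where u: "(\<alpha>', us', \<beta>') \<in> transitions X"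
      "\<alpha> = on_states f \<alpha>'" "us = map (on_actions f) us'" "\<beta> = on_states f \<beta>'" using t by blast
    note tt = weak_ts_transD[OF d(3) u(1)]
    have "map ?a us = us'" unfolding u(3) map_map using a2 tt(3) by (intro map_idI) auto
    then show "(?s \<alpha>, map ?a us, ?s \<beta>) \<in> transitions X" using u s2 tt by (simp del: map_map)
  qed (use s1 a1 in auto)
  have "mk_map Y X ?s ?a \<circ>\<^sub>t f = ts_id X"
    by (rule ts_hom_eqI[OF ts_comp_hom[OF f g] ts_id_hom[OF d(3)]])
       (use d s2 a2 in \<open>auto simp: ts_id_mk\<close>)
  moreover have "f \<circ>\<^sub>t mk_map Y X ?s ?a = ts_id Y"
    by (rule ts_hom_eqI[OF ts_comp_hom[OF g f] ts_id_hom[OF d(4)]])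
       (use d s1 a1 in \<open>auto simp: ts_id_mk\<close>)
  ultimately show ?thesis using f g d(1,2) unfolding ts_iso_def by auto
qed

section \<open>Copies of the maps \<open>p_map x\<close> inside one type\<close>

lemma coprod_edge_sel:
  "states (ts_coprod (cube [x]) (cube [x])) = {Inl [0], Inl [1], Inr [0], Inr [1]}"
  "actions (ts_coprod (cube [x]) (cube [x])) = {Inl (x, 0), Inr (x, 0)}"
  "label (ts_coprod (cube [x]) (cube [x])) (Inl (x, 0)) = x"
  "label (ts_coprod (cube [x]) (cube [x])) (Inr (x, 0)) = x"
  "transitions (ts_coprod (cube [x]) (cube [x])) =
     {(Inl [0], [Inl (x, 0)], Inl [1]), (Inr [0], [Inr (x, 0)], Inr [1])}"
  unfolding ts_coprod_def by (auto simp: cube_single cube_label)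

lemma double_transition_sel:
  "states (double_transition x) = {[1], [2], [3], [4]}"
  "actions (double_transition x) = {(x, 0)}"
  "label (double_transition x) (x, 0) = x"
  "transitions (double_transition x) = {([1], [(x, 0)], [2]), ([3], [(x, 0)], [4])}"
  by (auto simp: double_transition_def)

lemma p_map_mk:
  "p_map x = mk_map (ts_coprod (cube [x]) (cube [x])) (double_transition x)
     (case_sum (\<lambda>s. if s = [0] then [1] else [2]) (\<lambda>s. if s = [0] then [3] else [4])) (case_sum id id)"
  by (simp add: p_map_def mk_map_def Let_def)

lemma coprod_edge_weak: "weak_ts (ts_coprod (cube [x]) (cube [x]))"
proof (rule regular_ts_weak[OF regular_ts_graphI])
  show "label (ts_coprod (cube [x]) (cube [x])) \<in> extensional (actions (ts_coprod (cube [x]) (cube [x])))"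
    by (simp add: ts_coprod_def)
qed (auto simp: coprod_edge_sel)

lemma p_map_hom: "p_map x \<in> ts_hom (ts_coprod (cube [x]) (cube [x])) (double_transition x)"
  unfolding p_map_mk
  by (rule mk_map_hom[OF coprod_edge_weak regular_ts_weak[OF double_transition_regular]])
    (auto simp: coprod_edge_sel double_transition_sel)

definition graph_ts :: "'s set \<Rightarrow> 'a set \<Rightarrow> 'l \<Rightarrow> ('s \<times> 'a \<times> 's) set \<Rightarrow> ('s, 'a, 'l) ts" where
  "graph_ts S L x E = \<lparr>states = S, actions = L, label = restrict (\<lambda>_. x) L,
     transitions = {(\<alpha>, [u], \<beta>) | \<alpha> u \<beta>. (\<alpha>, u, \<beta>) \<in> E}\<rparr>"

lemma graph_ts_sel [simp]:
  "states (graph_ts S L x E) = S" "actions (graph_ts S L x E) = L"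
  "label (graph_ts S L x E) = restrict (\<lambda>_. x) L"
  "(\<alpha>, us, \<beta>) \<in> transitions (graph_ts S L x E) \<longleftrightarrow> (\<exists>u. us = [u] \<and> (\<alpha>, u, \<beta>) \<in> E)"
  by (auto simp: graph_ts_def)

lemma graph_ts_regular:
  assumes "E \<subseteq> S \<times> L \<times> S" "L \<subseteq> (fst \<circ> snd) ` E"
  shows "regular_ts (graph_ts S L x E)"
  by (rule regular_ts_graphI) (use assms in force)+

context large_type
begin

lemma dup_action_rts:
  fixes B :: "('u, 'u, 'l) ts"
  assumes "B \<in> rts \<kappa>" "regular_ts (dup_action u v B)"
  shows "dup_action u v B \<in> rts \<kappa>"
  by (rule rtsI) (use assms rtsD[OF assms(1)] insert_small in auto)

lemma add_edge_rts:
  fixes B :: "('u, 'u, 'l) ts"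
  assumes "B \<in> rts \<kappa>" "regular_ts (add_edge \<alpha> u v \<beta> B)"
  shows "add_edge \<alpha> u v \<beta> B \<in> rts \<kappa>"
  by (rule rtsI) (use assms rtsD[OF assms(1)] insert_small in auto)

lemma graph_ts_rts:
  fixes S L :: "'u set"
  assumes "E \<subseteq> S \<times> L \<times> S" "L \<subseteq> (fst \<circ> snd) ` E" "finite S" "finite L"
  shows "graph_ts S L x E \<in> rts \<kappa>"
  by (rule rtsI[OF graph_ts_regular]) (use assms finite_small in auto)

lemma four_elements:
  obtains s1 s2 s3 s4 :: 'u where "distinct [s1, s2, s3, s4]"
proof -
  have "\<exists>w. w \<notin> A" if "finite A" for A :: "'u set"
    using fresh_element[OF finite_small[OF that]] by blast
  then obtain s1 s2 s3 s4 :: 'u where "s2 \<notin> {s1}" "s3 \<notin> {s1, s2}" "s4 \<notin> {s1, s2, s3}"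
    by (metis finite.emptyI finite.insertI)
  then show ?thesis using that[of s1 s2 s3 s4] by auto
qed

end

text \<open>The states \<open>s1\<close> and \<open>s2\<close> double as names of actions.\<close>

abbreviation two_edges where
  "two_edges s1 s2 s3 s4 x \<equiv> graph_ts {s1, s2, s3, s4} {s1, s2} x {(s1, s1, s2), (s3, s2, s4)}"

abbreviation double_edge where
  "double_edge s1 s2 s3 s4 x \<equiv> graph_ts {s1, s2, s3, s4} {s2} x {(s1, s2, s2), (s3, s2, s4)}"

text \<open>\<open>p_maps\<close> contains the copies of \<open>p_map x\<close> up to isomorphism of
  arrows; gluing requires a concrete copy with states and actions in \<open>'u\<close>.\<close>

lemma two_edges_p_map:
  fixes s1 s2 s3 s4 :: 'u and x :: 'l
  assumes d: "distinct [s1, s2, s3, s4]"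
  defines "q \<equiv> mk_map (two_edges s1 s2 s3 s4 x) (double_edge s1 s2 s3 s4 x) id (\<lambda>_. s2)"
  shows "q \<in> ts_hom (two_edges s1 s2 s3 s4 x) (double_edge s1 s2 s3 s4 x)" "arrow_iso q (p_map x)"
proof -
  let ?K = "two_edges s1 s2 s3 s4 x" and ?D = "double_edge s1 s2 s3 s4 x"
    and ?C = "ts_coprod (cube [x]) (cube [x])" and ?E = "double_transition x"
  have w: "weak_ts ?K" "weak_ts ?D" by (rule regular_ts_weak[OF graph_ts_regular]; force)+
  have wE: "weak_ts ?E" by (rule regular_ts_weak[OF double_transition_regular])
  show q: "q \<in> ts_hom ?K ?D"
    unfolding q_def by (rule mk_map_hom[OF w]) auto
  define a where "a = mk_map ?K ?C (\<lambda>s. if s = s1 then Inl [0] else if s = s2 then Inl [1]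
      else if s = s3 then Inr [0] else Inr [1]) (\<lambda>u. if u = s1 then Inl (x, 0) else Inr (x, 0))"
  define b where "b = mk_map ?D ?E (\<lambda>s. if s = s1 then [1] else if s = s2 then [2]
      else if s = s3 then [3] else [4]) (\<lambda>_. (x, 0))"
  have a: "a \<in> ts_hom ?K ?C"
    unfolding a_def by (rule mk_map_hom[OF w(1) coprod_edge_weak]) (use d in \<open>auto simp: coprod_edge_sel\<close>)
  have b: "b \<in> ts_hom ?D ?E"
    unfolding b_def by (rule mk_map_hom[OF w(2) wE]) (use d in \<open>auto simp: double_transition_sel\<close>)
  have "ts_iso a"
  proof (rule ts_isoI[OF a])
    fix \<alpha> us \<beta> assume "(\<alpha>, us, \<beta>) \<in> transitions ?C"
    then consider "(\<alpha>, us, \<beta>) = (Inl [0], [Inl (x, 0)], Inl [1])"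
      | "(\<alpha>, us, \<beta>) = (Inr [0], [Inr (x, 0)], Inr [1])"
      by (auto simp: coprod_edge_sel)
    then show "trans_image (on_states a) (on_actions a) (transitions ?K) \<alpha> us \<beta>"
    proof cases
      case 1
      then show ?thesis
        using d by (intro exI[of _ s1] exI[of _ "[s1]"] exI[of _ s2]) (auto simp: a_def)
    next
      case 2
      then show ?thesis
        using d by (intro exI[of _ s3] exI[of _ "[s2]"] exI[of _ s4]) (auto simp: a_def)
    qed
  qed (use d in \<open>auto simp: bij_betw_def inj_on_def coprod_edge_sel a_def\<close>)
  moreover have "ts_iso b"
  proof (rule ts_isoI[OF b])
    fix \<alpha> us \<beta> assume "(\<alpha>, us, \<beta>) \<in> transitions ?E"
    then consider "(\<alpha>, us, \<beta>) = ([1], [(x, 0)], [2])" | "(\<alpha>, us, \<beta>) = ([3], [(x, 0)], [4])"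
      by (auto simp: double_transition_sel)
    then show "trans_image (on_states b) (on_actions b) (transitions ?D) \<alpha> us \<beta>"
    proof cases
      case 1
      then show ?thesis
        using d by (intro exI[of _ s1] exI[of _ "[s2]"] exI[of _ s2]) (auto simp: b_def)
    next
      case 2
      then show ?thesis
        using d by (intro exI[of _ s3] exI[of _ "[s2]"] exI[of _ s4]) (auto simp: b_def)
    qed
  qed (use d in \<open>auto simp: bij_betw_def inj_on_def double_transition_sel b_def\<close>)
  moreover have "b \<circ>\<^sub>t q = p_map x \<circ>\<^sub>t a"
  proof (rule ts_hom_eqI[OF ts_comp_hom[OF q b] ts_comp_hom[OF a p_map_hom]])
    fix s assume "s \<in> states ?K"
    then show "on_states (b \<circ>\<^sub>t q) s = on_states (p_map x \<circ>\<^sub>t a) s"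
      using d by (auto simp: a_def b_def q_def p_map_mk coprod_edge_sel)
  next
    fix u assume "u \<in> actions ?K"
    then show "on_actions (b \<circ>\<^sub>t q) u = on_actions (p_map x \<circ>\<^sub>t a) u"
      using d by (auto simp: a_def b_def q_def p_map_mk coprod_edge_sel)
  qed
  ultimately show "arrow_iso q (p_map x)"
    using ts_homD(1,2)[OF q] ts_homD(1,2)[OF a] ts_homD(1,2)[OF b] ts_homD(1,2)[OF p_map_hom[of x]]
    unfolding arrow_iso_def by metis
qed

locale p_localizer = localizer \<kappa> U W for \<kappa> :: "'k rel" and U :: "'u itself"
    and W :: "('u, 'u, 'u, 'u, 'l) ts_map set" +
  assumes p_maps: "p_maps \<kappa> \<subseteq> W"

context localizer
begin

lemma W_dup_fresh:
  assumes B: "B \<in> rts \<kappa>" and u: "u \<in> actions B" and v: "v \<notin> actions B"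
  shows "ts_incl B (dup_action u v B) \<in> W" "dup_action u v B \<in> rts \<kappa>"
proof -
  note w = rtsD[OF B]
  let ?D = "dup_action u v B" and ?h = "id(v := u)"
  have uv: "u \<noteq> v" using u v by blast
  show D: "?D \<in> rts \<kappa>"
    using dup_action_rts[OF B] regular_dup_action[OF w(1) lies_over_fresh[OF w(1) v, of u] u] uv by simp
  have sub: "sub_ts B ?D" by (rule sub_dup_action) (use v in simp)
  define r where "r = mk_map ?D B id ?h"
  have r: "r \<in> ts_hom ?D B"
    unfolding r_def
  proof (rule mk_map_hom[OF rtsD(2)[OF D] w(2)])
    fix \<alpha> vs \<beta> assume "(\<alpha>, vs, \<beta>) \<in> transitions ?D"
    then obtain us where us: "(\<alpha>, us, \<beta>) \<in> transitions B" "list_all2 (may_replace u v) us vs"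
      by (auto elim: subst_transE)
    have "map ?h vs = map id us"
      by (rule list_all2_map_eq[OF us(2)]) (use weak_ts_transD(3)[OF w(2) us(1)] v in auto)
    then show "(id \<alpha>, map ?h vs, id \<beta>) \<in> transitions B" using us(1) by simp
  qed (use u v in auto)
  have r': "r \<in> rts_maps \<kappa>" by (rule rts_mapsI[OF r D B])
  have "action_cover r"
    unfolding action_cover_def
  proof (intro conjI allI impI)
    fix \<alpha> us \<beta>
    assume s: "\<alpha> \<in> states (src r)" "\<beta> \<in> states (src r)" "set us \<subseteq> actions (src r)"
      and t: "(on_states r \<alpha>, map (on_actions r) us, on_states r \<beta>) \<in> transitions (tgt r)"
    have "map (on_actions r) us = map ?h us" using s(3) by (auto simp: r_def)
    then have "(\<alpha>, map ?h us, \<beta>) \<in> transitions B" using s t by (simp add: r_def del: map_eq_conv)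
    \<comment> \<open>Every word arises from its image under \<open>?h\<close> by restoring the
      occurrences of \<open>v\<close>; this is why \<open>r\<close> reflects transitions.\<close>
    moreover have "list_all2 (may_replace u v) (map ?h us) us"
      by (auto simp: list_all2_conv_all_nth)
    ultimately show "(\<alpha>, us, \<beta>) \<in> transitions (src r)"
      by (auto simp: r_def intro: subst_transI)
  qed (use v in \<open>auto simp: r_def bij_betw_def inj_on_def image_iff\<close>)
  then have rW: "r \<in> W" by (rule W_cover[OF r'])
  have "r \<circ>\<^sub>t ts_incl B ?D = ts_id B"
    by (rule ts_hom_eqI[OF ts_comp_hom[OF ts_incl_hom[OF sub w(2) rtsD(2)[OF D]] r] ts_id_hom[OF w(2)]])
       (use v in \<open>auto simp: r_def ts_id_mk\<close>)
  then show "ts_incl B ?D \<in> W"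
    using W_cancel_left[OF ts_incl_rts_maps[OF B D sub] _ rW] W_id[OF B] by (simp add: r_def)
qed

lemma W_add_edge_fresh:
  assumes B: "B \<in> rts \<kappa>" and e: "(\<alpha>, [u], \<beta>) \<in> transitions B" and v: "v \<notin> actions B"
  shows "ts_incl B (add_edge \<alpha> u v \<beta> B) \<in> W" "add_edge \<alpha> u v \<beta> B \<in> rts \<kappa>"
proof -
  note w = rtsD[OF B]
  note te = weak_ts_transD[OF w(2) e]
  let ?B' = "add_edge \<alpha> u v \<beta> B"
  have u: "u \<in> actions B" using te by simp
  show B': "?B' \<in> rts \<kappa>"
    using add_edge_rts[OF B] regular_add_edge[OF w(1) lies_over_fresh[OF w(1) v, of u] e] by simp
  obtain s1 s2 s3 s4 :: 'u where d: "distinct [s1, s2, s3, s4]" by (rule four_elements)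
  \<comment> \<open>In a system with a single edge, duplicating the action amounts to adding one
    parallel edge. Pushed out along the given edge of \<open>u\<close>, this becomes
    \<open>add_edge\<close>.\<close>
  define K where "K = graph_ts {s1, s2} {s1} (label B u) {(s1, s1, s2)}"
  have K: "K \<in> rts \<kappa>" unfolding K_def by (rule graph_ts_rts) auto
  have K': "ts_incl K (dup_action s1 s2 K) \<in> W" "dup_action s1 s2 K \<in> rts \<kappa>"
    using W_dup_fresh[OF K, of s1 s2] d by (auto simp: K_def)
  have TK: "(\<gamma>, vs, \<delta>) \<in> transitions (dup_action s1 s2 K) \<longleftrightarrow>
      \<gamma> = s1 \<and> \<delta> = s2 \<and> (vs = [s1] \<or> vs = [s2])" for \<gamma> vs \<delta>
    by (auto simp: subst_trans_def K_def list_all2_Cons1)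
  let ?fs = "\<lambda>s. if s = s1 then \<alpha> else \<beta>" and ?fa = "\<lambda>a. if a = s1 then u else v"
  show "ts_incl B ?B' \<in> W"
  proof (rule W_pushout_incl[OF K'(1) B B'])
    show "sub_ts K (dup_action s1 s2 K)" by (rule sub_dup_action) (use d in \<open>auto simp: K_def\<close>)
    show "sub_ts B ?B'" by (rule sub_add_edge) (use v in simp)
    show "mk_map K B ?fs ?fa \<in> ts_hom K B"
      by (rule mk_map_hom[OF rtsD(2)[OF K] w(2)]) (use te e d in \<open>auto simp: K_def\<close>)
    show "mk_map (dup_action s1 s2 K) ?B' ?fs ?fa \<in> ts_hom (dup_action s1 s2 K) ?B'"
    proof (rule mk_map_hom[OF rtsD(2)[OF K'(2)] rtsD(2)[OF B']])
      fix \<gamma> vs \<delta> assume "(\<gamma>, vs, \<delta>) \<in> transitions (dup_action s1 s2 K)"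
      then show "(?fs \<gamma>, map ?fa vs, ?fs \<delta>) \<in> transitions ?B'"
        unfolding TK using d e by auto
    qed (use te d in \<open>auto simp: K_def\<close>)
    show "trans_image ?fs ?fa (transitions (dup_action s1 s2 K)) \<gamma> us \<delta>"
      if "(\<gamma>, us, \<delta>) \<in> transitions ?B'" "(\<gamma>, us, \<delta>) \<notin> transitions B" for \<gamma> us \<delta>
      unfolding TK using that d by (intro exI[of _ s1] exI[of _ "[s2]"] exI[of _ s2]) auto
  qed (use d v in \<open>auto simp: K_def inj_on_def\<close>)
qed

lemma W_add_edge_dup_fresh:
  assumes "B \<in> rts \<kappa>" "(\<alpha>, [u], \<beta>) \<in> transitions B" "v \<notin> actions B"
  shows "ts_incl (add_edge \<alpha> u v \<beta> B) (dup_action u v B) \<in> W"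
proof (rule W_incl_cancel[OF W_add_edge_fresh(1)[OF assms] W_dup_fresh(1)[OF assms(1) _ assms(3)]])
  show "u \<in> actions B" using weak_ts_transD(3)[OF rtsD(2)[OF assms(1)] assms(2)] by simp
  show "sub_ts B (add_edge \<alpha> u v \<beta> B)" by (rule sub_add_edge) (use assms(3) in simp)
qed (rule sub_add_edge_dup_action[OF assms(2)])

end

context p_localizer
begin

text \<open>The cofibration that replaces \<open>p\<^sub>x\<close>.\<close>

lemma W_two_edges:
  fixes s1 s2 s3 s4 :: 'u
  assumes d: "distinct [s1, s2, s3, s4]"
  shows "ts_incl (two_edges s1 s2 s3 s4 x) (add_edge s1 s2 s1 s2 (double_edge s1 s2 s3 s4 x)) \<in> W"
proof -
  let ?K = "two_edges s1 s2 s3 s4 x" and ?D = "double_edge s1 s2 s3 s4 x"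
  let ?E = "add_edge s1 s2 s1 s2 ?D"
  have K: "?K \<in> rts \<kappa>" by (rule graph_ts_rts) force+
  have D: "?D \<in> rts \<kappa>" by (rule graph_ts_rts) force+
  have e: "(s1, [s2], s2) \<in> transitions ?D" and f: "s1 \<notin> actions ?D" using d by auto
  note DE = W_add_edge_fresh[OF D e f]
  have sub: "sub_ts ?D ?E" by (rule sub_add_edge) (use d in auto)
  have subK: "sub_ts ?K ?E" using d by (auto simp: sub_ts_def)
  \<comment> \<open>\<open>r\<close> merges the two actions again. It does not reflect the edge from
    \<open>s3\<close> to \<open>s4\<close>, so it is no action cover; it lies in \<open>W\<close>
    because its section, the inclusion of \<open>?D\<close>, does. On \<open>?K\<close> it restricts
    to the copy of \<open>p_map x\<close>.\<close>
  define r where "r = mk_map ?E ?D id (\<lambda>_. s2)"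
  have r: "r \<in> ts_hom ?E ?D"
    unfolding r_def by (rule mk_map_hom[OF rtsD(2)[OF DE(2)] rtsD(2)[OF D]]) auto
  have r': "r \<in> rts_maps \<kappa>" by (rule rts_mapsI[OF r DE(2) D])
  have "r \<circ>\<^sub>t ts_incl ?D ?E = ts_id ?D"
    by (rule ts_hom_eqI[OF ts_comp_hom[OF ts_incl_hom[OF sub rtsD(2)[OF D] rtsD(2)[OF DE(2)]] r]
          ts_id_hom[OF rtsD(2)[OF D]]]) (auto simp: r_def ts_id_mk)
  then have rW: "r \<in> W"
    using W_cancel_right[OF r' _ DE(1)] W_id[OF D] by (simp add: r_def)
  define q where "q = mk_map ?K ?D id (\<lambda>_. s2)"
  have q: "q \<in> ts_hom ?K ?D" "arrow_iso q (p_map x)"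
    using two_edges_p_map[OF d, of x] by (auto simp: q_def)
  have "q \<in> p_maps \<kappa>" using rts_mapsI[OF q(1) K D] q(2) by (auto simp: p_maps_def)
  then have qW: "q \<in> W" using p_maps by blast
  have "r \<circ>\<^sub>t ts_incl ?K ?E = q"
    by (rule ts_hom_eqI[OF ts_comp_hom[OF ts_incl_hom[OF subK rtsD(2)[OF K] rtsD(2)[OF DE(2)]] r] q(1)])
       (auto simp: r_def q_def)
  then show ?thesis
    using W_cancel_left[OF ts_incl_rts_maps[OF K DE(2) subK] _ rW] qW by (simp add: r_def)
qed

text \<open>By regularity \<open>v\<close> already has an edge somewhere. Together with the edge of
  \<open>u\<close> it gives a map from \<open>two_edges\<close> to \<open>B\<close>, along which the
  cofibration that replaces \<open>p_map x\<close> is pushed out.\<close>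

lemma W_add_edge:
  assumes B: "B \<in> rts \<kappa>" and over: "lies_over B X f h"
    and e: "(\<alpha>, [u], \<beta>) \<in> transitions B" and v: "v \<in> actions B" "h v = h u" "label B v = label B u"
  shows "ts_incl B (add_edge \<alpha> u v \<beta> B) \<in> W"
proof -
  note w = rtsD[OF B]
  note te = weak_ts_transD[OF w(2) e]
  let ?B' = "add_edge \<alpha> u v \<beta> B"
  have u: "u \<in> actions B" using te by simp
  have B': "?B' \<in> rts \<kappa>"
    using add_edge_rts[OF B] regular_add_edge[OF w(1) over e v(2)] by simp
  obtain \<gamma> \<delta> where e': "(\<gamma>, [v], \<delta>) \<in> transitions B" using regular_ts_usedD[OF w(1) v(1)] by blast
  note te' = weak_ts_transD[OF w(2) e']
  obtain s1 s2 s3 s4 :: 'u where d: "distinct [s1, s2, s3, s4]" by (rule four_elements)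
  \<comment> \<open>Here \<open>s2\<close> stands for \<open>u\<close>, with its edge from
    \<open>s2\<close> to \<open>s1\<close>, and \<open>s1\<close> stands for \<open>v\<close>, with
    its edge from \<open>s4\<close> to \<open>s3\<close>. \<open>K'\<close> adds an edge of
    \<open>s1\<close> from \<open>s2\<close> to \<open>s1\<close>.\<close>
  define K where "K = two_edges s2 s1 s4 s3 (label B u)"
  define K' where "K' = add_edge s2 s1 s2 s1 (double_edge s2 s1 s4 s3 (label B u))"
  have W: "ts_incl K K' \<in> W" unfolding K_def K'_def by (rule W_two_edges) (use d in auto)
  note KK = rts_mapsD(4,5)[OF W_rts_maps[OF W], simplified]
  let ?fs = "\<lambda>s. if s = s2 then \<alpha> else if s = s1 then \<beta> else if s = s4 then \<gamma> else \<delta>"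
    and ?fa = "\<lambda>a. if a = s2 then u else v"
  show "ts_incl B ?B' \<in> W"
  proof (rule W_pushout_incl[OF W B B'])
    show "sub_ts K K'" using d by (auto simp: sub_ts_def K_def K'_def)
    show "sub_ts B ?B'" by (rule sub_add_edge) (use v in simp)
    show "mk_map K B ?fs ?fa \<in> ts_hom K B"
      by (rule mk_map_hom[OF rtsD(2)[OF KK(1)] w(2)]) (use te te' e e' d v in \<open>auto simp: K_def\<close>)
    show "mk_map K' ?B' ?fs ?fa \<in> ts_hom K' ?B'"
    proof (rule mk_map_hom[OF rtsD(2)[OF KK(2)] rtsD(2)[OF B']])
      fix \<mu> us \<nu> assume "(\<mu>, us, \<nu>) \<in> transitions K'"
      then consider "(\<mu>, us, \<nu>) = (s2, [s1], s1)" | "(\<mu>, us, \<nu>) = (s2, [s2], s1)"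
        | "(\<mu>, us, \<nu>) = (s4, [s1], s3)"
        by (auto simp: K'_def)
      then show "(?fs \<mu>, map ?fa us, ?fs \<nu>) \<in> transitions ?B'"
        by cases (use d e e' in auto)
    next
      fix s assume "s \<in> states K'"
      then show "?fs s \<in> states ?B'" using te(1,4) te'(1,4) by simp
    next
      fix a assume "a \<in> actions K'"
      then have a: "a = s1 \<or> a = s2" by (auto simp: K'_def)
      show "?fa a \<in> actions ?B'" using u by simp
      have "label K' a = label B u" using a d by (auto simp: K'_def)
      then show "label ?B' (?fa a) = label K' a" using v(3) by simp
    qed
    show "trans_image ?fs ?fa (transitions K') \<mu> us \<nu>"
      if "(\<mu>, us, \<nu>) \<in> transitions ?B'" "(\<mu>, us, \<nu>) \<notin> transitions B" for \<mu> us \<nu>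
      using that d by (intro exI[of _ s2] exI[of _ "[s1]"] exI[of _ s1]) (auto simp: K'_def)
  qed (use d v in \<open>auto simp: K_def K'_def\<close>)
qed

text \<open>Duplicate \<open>u\<close> under a fresh name \<open>z\<close>, starting from a single edge; then identify \<open>z\<close> with \<open>v\<close>.\<close>

lemma W_dup_action:
  assumes B: "B \<in> rts \<kappa>" and over: "lies_over B X f h"
    and uv: "u \<in> actions B" "v \<in> actions B" "h v = h u" "label B v = label B u"
  shows "ts_incl B (dup_action u v B) \<in> W"
proof -
  note w = rtsD[OF B]
  obtain \<alpha> \<beta> where e: "(\<alpha>, [u], \<beta>) \<in> transitions B" using regular_ts_usedD[OF w(1) uv(1)] by blast
  note te = weak_ts_transD[OF w(2) e]
  obtain z where z: "z \<notin> actions B" using fresh_element[OF w(4)] .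
  let ?B1 = "add_edge \<alpha> u v \<beta> B" and ?K = "add_edge \<alpha> u z \<beta> B" and ?K' = "dup_action u z B"
    and ?B' = "dup_action u v B"
  have ins: "insert v (actions B) = actions B" using uv by blast
  have lab: "(label B)(v := label B u) = label B" using uv(4) by (simp add: fun_upd_idem)
  have B1: "?B1 \<in> rts \<kappa>" using add_edge_rts[OF B] regular_add_edge[OF w(1) over e uv(3)] by simp
  have B': "?B' \<in> rts \<kappa>" using dup_action_rts[OF B] regular_dup_action[OF w(1) over uv(1,3)] by simp
  note K = W_add_edge_fresh(2)[OF B e z] and K' = W_dup_fresh(2)[OF B uv(1) z]
  let ?fa = "id(z := v)"
  have fa: "map ?fa us = us" if "(\<mu>, us, \<nu>) \<in> transitions B" for \<mu> us \<nu>
    using weak_ts_transD(3)[OF w(2) that] z by (intro map_idI) auto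
  \<comment> \<open>\<open>?B1\<close> contains the edge of \<open>v\<close> to which the single
    edge of \<open>z\<close> in \<open>?K\<close> is sent, so the pushout starts from there.\<close>
  have "ts_incl ?B1 ?B' \<in> W"
  proof (rule W_pushout_incl[OF W_add_edge_dup_fresh[OF B e z] B1 B'])
    show "sub_ts ?K ?K'" by (rule sub_add_edge_dup_action[OF e])
    show "sub_ts ?B1 ?B'" by (rule sub_add_edge_dup_action[OF e])
    show "mk_map ?K ?B1 id ?fa \<in> ts_hom ?K ?B1"
    proof (rule mk_map_hom[OF rtsD(2)[OF K] rtsD(2)[OF B1]])
      fix \<mu> us \<nu> assume "(\<mu>, us, \<nu>) \<in> transitions ?K"
      then show "(id \<mu>, map ?fa us, id \<nu>) \<in> transitions ?B1" using fa by auto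
    qed (use z uv ins lab in auto)
    show "mk_map ?K' ?B' id ?fa \<in> ts_hom ?K' ?B'"
    proof (rule mk_map_hom[OF rtsD(2)[OF K'] rtsD(2)[OF B']])
      fix \<mu> vs \<nu> assume "(\<mu>, vs, \<nu>) \<in> transitions ?K'"
      then obtain us where us: "(\<mu>, us, \<nu>) \<in> transitions B" "list_all2 (may_replace u z) us vs"
        by (auto elim: subst_transE)
      have "z \<notin> set us" using weak_ts_transD(3)[OF w(2) us(1)] z by blast
      then have "list_all2 (may_replace u v) us (map ?fa vs)"
        using us(2) by (auto simp: list_all2_conv_all_nth)
      then show "(id \<mu>, map ?fa vs, id \<nu>) \<in> transitions ?B'" using us(1) by (auto intro: subst_transI)
    qed (use z uv ins lab in auto)
    fix \<mu> vs \<nu> assume "(\<mu>, vs, \<nu>) \<in> transitions ?B'"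
    then obtain us where us: "(\<mu>, us, \<nu>) \<in> transitions B" "list_all2 (may_replace u v) us vs"
      by (auto elim: subst_transE)
    have zus: "z \<notin> set us" using weak_ts_transD(3)[OF w(2) us(1)] z by blast
    have len: "length us = length vs" and n: "\<And>i. i < length vs \<Longrightarrow> may_replace u v (us ! i) (vs ! i)"
      using us(2) by (auto simp: list_all2_conv_all_nth)
    \<comment> \<open>The letter \<open>z\<close> marks exactly the positions at which
      \<open>u\<close> was changed into \<open>v\<close>; renaming \<open>z\<close> to
      \<open>v\<close> then gives back \<open>vs\<close>.\<close>
    define ws where "ws = map (\<lambda>i. if vs ! i = us ! i then us ! i else z) [0..<length vs]"
    have "list_all2 (may_replace u z) us ws"
      using len n by (auto simp: list_all2_conv_all_nth ws_def)
    moreover have "vs = map ?fa ws"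
    proof (rule nth_equalityI)
      fix i assume i: "i < length vs"
      then have "us ! i \<noteq> z" using zus len by (metis nth_mem)
      then show "vs ! i = map ?fa ws ! i" using n[OF i] i by (auto simp: ws_def)
    qed (simp add: ws_def)
    ultimately show "trans_image id ?fa (transitions ?K') \<mu> vs \<nu>"
      using us(1) by (intro exI[of _ \<mu>] exI[of _ ws] exI[of _ \<nu>]) (auto intro: subst_transI)
  qed (auto simp: ins)
  then show ?thesis
    using W_incl_comp[OF W_add_edge[OF B over e uv(2-4)]] sub_add_edge[of v B u \<alpha> \<beta>] uv(4) by simp
qed

end

section \<open>Duplicating all actions\<close>

lemma underS_subset_Field: "underS r j \<subseteq> Field r"
  by (auto simp: underS_def Field_def)

text \<open>All \<open>X i\<close> have the same states and actions, so a single leg of a cocone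
  already provides the mediating map. Only transitions have to be collected, and each comes from
  some \<open>X i\<close>.\<close>

lemma union_colimit:
  assumes Z: "Z \<in> Ob" "weak_ts Z" and J: "J \<noteq> {}"
    and X: "\<And>i. i \<in> J \<Longrightarrow> weak_ts (X i) \<and> sub_ts (X i) Z \<and> states (X i) = states Z \<and> actions (X i) = actions Z"
    and TZ: "transitions Z \<subseteq> (\<Union>i \<in> J. transitions (X i))"
    and A: "\<And>i h j. (i, h, j) \<in> A \<Longrightarrow> i \<in> J \<and> j \<in> J \<and> sub_ts (X i) (X j) \<and> h = ts_incl (X i) (X j)"
    and dir: "\<And>i j. i \<in> J \<Longrightarrow> j \<in> J \<Longrightarrow> (i, ts_incl (X i) (X j), j) \<in> A \<or> (j, ts_incl (X j) (X i), i) \<in> A"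
  shows "ts_colimit Ob J X A Z (\<lambda>i. ts_incl (X i) Z)"
  unfolding ts_colimit_def
proof (intro conjI ballI allI impI)
  have inc: "ts_incl (X i) Z \<in> ts_hom (X i) Z" if "i \<in> J" for i
    using ts_incl_hom[of "X i" Z] X[OF that] Z(2) by blast
  show "ts_cocone J X A Z (\<lambda>i. ts_incl (X i) Z)"
    unfolding ts_cocone_def
  proof (intro conjI ballI allI impI)
    fix i h j assume "(i, h, j) \<in> A"
    then show "ts_incl (X j) Z \<circ>\<^sub>t h = ts_incl (X i) Z" using A ts_incl_comp by blast
  qed (use inc in blast)
  fix Z' c' assume c': "ts_cocone J X A Z' c'"
  have ch: "c' i \<in> ts_hom (X i) Z'" if "i \<in> J" for i using c' that by (auto simp: ts_cocone_def)
  obtain i0 where i0: "i0 \<in> J" using J by blast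
  have arrow: "c' j \<circ>\<^sub>t ts_incl (X i) (X j) = c' i" if "(i, ts_incl (X i) (X j), j) \<in> A" for i j
    using c' that by (auto simp: ts_cocone_def)
  have same_states: "on_states (c' i) s = on_states (c' i0) s" if "i \<in> J" "s \<in> states Z" for i s
  proof -
    have "on_states (c' i) s = on_states (c' j) s" if "(i, ts_incl (X i) (X j), j) \<in> A" for i j
      using arrow A[OF that] X \<open>s \<in> states Z\<close> by (metis id_apply mk_map_simps(1,3) that ts_comp_simps(3))
    then show ?thesis using dir[OF that(1) i0] by metis
  qed
  have same_actions: "on_actions (c' i) a = on_actions (c' i0) a" if "i \<in> J" "a \<in> actions Z" for i a
  proof -
    have "on_actions (c' i) a = on_actions (c' j) a" if "(i, ts_incl (X i) (X j), j) \<in> A" for i j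
      using arrow A[OF that] X \<open>a \<in> actions Z\<close> by (metis id_apply mk_map_simps(1,4) that ts_comp_simps(4))
    then show ?thesis using dir[OF that(1) i0] by metis
  qed
  have c0: "c' i0 \<in> ts_hom (X i0) Z'" by (rule ch[OF i0])
  note d0 = ts_homD[OF c0] and X0 = X[OF i0]
  define g where "g = mk_map Z Z' (on_states (c' i0)) (on_actions (c' i0))"
  have g: "g \<in> ts_hom Z Z'"
    unfolding g_def
  proof (rule mk_map_hom[OF Z(2) d0(4)])
    fix \<alpha> us \<beta> assume "(\<alpha>, us, \<beta>) \<in> transitions Z"
    then obtain i where i: "i \<in> J" "(\<alpha>, us, \<beta>) \<in> transitions (X i)" using TZ by blast
    note tt = weak_ts_transD[OF conjunct1[OF X[OF i(1)]] i(2)]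
    have "map (on_actions (c' i0)) us = map (on_actions (c' i)) us"
      using same_actions[OF i(1)] tt X[OF i(1)] by auto
    then show "(on_states (c' i0) \<alpha>, map (on_actions (c' i0)) us, on_states (c' i0) \<beta>) \<in> transitions Z'"
      using ts_homD(8)[OF ch[OF i(1)] i(2)] same_states[OF i(1)] tt X[OF i(1)]
      by (simp del: map_eq_conv)
  next
    fix a assume "a \<in> actions Z"
    then show "label Z' (on_actions (c' i0) a) = label Z a"
      using d0(7)[of a] X0 by (auto simp: sub_ts_def)
  qed (use d0 X0 in auto)
  show "\<exists>!g. g \<in> ts_hom Z Z' \<and> (\<forall>i\<in>J. g \<circ>\<^sub>t ts_incl (X i) Z = c' i)"
  proof (rule ex1I[of _ g])
    show "g \<in> ts_hom Z Z' \<and> (\<forall>i\<in>J. g \<circ>\<^sub>t ts_incl (X i) Z = c' i)"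
    proof (intro conjI ballI g)
      fix i assume i: "i \<in> J"
      show "g \<circ>\<^sub>t ts_incl (X i) Z = c' i"
        by (rule ts_hom_eqI[OF ts_comp_hom[OF inc[OF i] g] ch[OF i]])
           (use X[OF i] same_states[OF i] same_actions[OF i] in \<open>auto simp: g_def\<close>)
    qed
    fix h assume h: "h \<in> ts_hom Z Z' \<and> (\<forall>i\<in>J. h \<circ>\<^sub>t ts_incl (X i) Z = c' i)"
    then have "c' i0 = h \<circ>\<^sub>t ts_incl (X i0) Z" using i0 by simp
    then show "h = g"
      using X0 by (intro ts_hom_eqI[OF conjunct1[OF h] g]) (auto simp: g_def)
  qed
qed (use Z in blast)

context localizer
begin

text \<open>Closure under transfinite composition for subsystems of \<open>Z\<close> with constant
  states and actions, where continuity at limits says that transitions are unions.\<close>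

lemma W_chain:
  fixes r :: "'u rel"
  assumes r: "Well_order r" "|Field r| <o \<kappa>"
    and Z: "Z \<in> rts \<kappa>"
    and X: "\<And>i. i \<in> Field r \<Longrightarrow> X i \<in> rts \<kappa> \<and> sub_ts (X i) Z \<and> states (X i) = states Z \<and> actions (X i) = actions Z"
    and mono: "\<And>i j. (i, j) \<in> r \<Longrightarrow> transitions (X i) \<subseteq> transitions (X j)"
    and succ: "\<And>i j. i \<in> Field r \<Longrightarrow> j \<in> Field r \<Longrightarrow> underS r j = under r i \<Longrightarrow> ts_incl (X i) (X j) \<in> W"
    and lim: "\<And>j. j \<in> Field r \<Longrightarrow> underS r j \<noteq> {} \<Longrightarrow> \<nexists>i. i \<in> Field r \<and> underS r j = under r i \<Longrightarrow>
        transitions (X j) \<subseteq> (\<Union>i \<in> underS r j. transitions (X i))"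
    and TZ: "transitions Z \<subseteq> (\<Union>i \<in> Field r. transitions (X i))"
    and i0: "i0 \<in> Field r" "underS r i0 = {}"
  shows "ts_incl (X i0) Z \<in> W"
proof -
  have wo: "wo_rel r" using r(1) by (simp add: wo_rel_def)
  have sub: "sub_ts (X i) (X j)" if "(i, j) \<in> r" for i j
    using X[of i] X[of j] mono[OF that] FieldI1[OF that] FieldI2[OF that] by (auto simp: sub_ts_def)
  have hom: "ts_incl (X i) (X j) \<in> ts_hom (X i) (X j)" if "(i, j) \<in> r" for i j
    by (rule ts_incl_hom[OF sub[OF that]])
       (use X rtsD(2) FieldI1[OF that] FieldI2[OF that] in blast)+
  have tot: "(i, j) \<in> r \<or> (j, i) \<in> r" if "i \<in> Field r" "j \<in> Field r" for i j
    using wo_rel.TOTALS[OF wo] that by blast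
  have "ts_incl (X i0) Z \<in> transfinite_compositions \<kappa> (W \<inter> cofibrations \<kappa>)"
    unfolding transfinite_compositions_def
  proof (intro CollectI exI[of _ r] exI[of _ X] exI[of _ "\<lambda>i j. ts_incl (X i) (X j)"] exI[of _ Z]
      exI[of _ "\<lambda>i. ts_incl (X i) Z"] exI[of _ i0] conjI ballI allI impI)
    fix i assume "i \<in> Field r"
    then show "X i \<in> rts \<kappa>" "ts_incl (X i) (X i) = ts_id (X i)" using X by (auto simp: ts_id_mk)
  next
    fix i j k assume ij: "(i, j) \<in> r" and "(j, k) \<in> r"
    then show "ts_incl (X j) (X k) \<circ>\<^sub>t ts_incl (X i) (X j) = ts_incl (X i) (X k)"
      using ts_incl_comp[OF sub[OF ij]] by simp
  next
    fix i j assume ij: "i \<in> Field r" "j \<in> Field r" "underS r j = under r i"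
    have "(i, j) \<in> r"
    proof -
      have "i \<in> under r i" using wo_rel.REFL[OF wo] ij(1) by (auto simp: under_def refl_on_def)
      then show ?thesis using ij(3) by (auto simp: underS_def)
    qed
    then show "ts_incl (X i) (X j) \<in> W \<inter> cofibrations \<kappa>"
      using succ[OF ij] ts_incl_cofibration[OF _ _ sub] X ij(1,2) by blast
  next
    fix j assume j: "j \<in> Field r" "underS r j \<noteq> {}" "\<nexists>i. i \<in> Field r \<and> underS r j = under r i"
    have F: "underS r j \<subseteq> Field r" by (rule underS_subset_Field)
    show "ts_colimit (rts \<kappa>) (underS r j) X
        {(i, ts_incl (X i) (X i'), i') |i i'. (i, i') \<in> r \<and> i' \<in> underS r j} (X j) (\<lambda>i. ts_incl (X i) (X j))"
    proof (rule union_colimit)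
      show "X j \<in> rts \<kappa>" "weak_ts (X j)" using X[OF j(1)] rtsD(2) by blast+
      show "weak_ts (X i) \<and> sub_ts (X i) (X j) \<and> states (X i) = states (X j) \<and> actions (X i) = actions (X j)"
        if "i \<in> underS r j" for i
        using X[of i] X[OF j(1)] F that sub[of i j] rtsD(2)[of "X i" \<kappa>] by (auto simp: underS_def)
      show "transitions (X j) \<subseteq> (\<Union>i \<in> underS r j. transitions (X i))" by (rule lim[OF j])
      fix i h i' assume "(i, h, i') \<in> {(i, ts_incl (X i) (X i'), i') |i i'. (i, i') \<in> r \<and> i' \<in> underS r j}"
      then have h: "h = ts_incl (X i) (X i')" "(i, i') \<in> r" "i' \<in> underS r j" by auto
      moreover have "i \<in> underS r j"
        using h(2,3) wo_rel.TRANS[OF wo] wo_rel.ANTISYM[OF wo]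
        by (auto simp: underS_def trans_def antisym_def)
      ultimately show "i \<in> underS r j \<and> i' \<in> underS r j \<and> sub_ts (X i) (X i') \<and> h = ts_incl (X i) (X i')"
        using sub by blast
    qed (use j tot F in blast)+
  next
    show "ts_colimit (rts \<kappa>) (Field r) X {(i, ts_incl (X i) (X i'), i') |i i'. (i, i') \<in> r} Z
        (\<lambda>i. ts_incl (X i) Z)"
    proof (rule union_colimit)
      show "weak_ts (X i) \<and> sub_ts (X i) Z \<and> states (X i) = states Z \<and> actions (X i) = actions Z"
        if "i \<in> Field r" for i using X[OF that] rtsD(2) by blast
      fix i h i' assume "(i, h, i') \<in> {(i, ts_incl (X i) (X i'), i') |i i'. (i, i') \<in> r}"
      then show "i \<in> Field r \<and> i' \<in> Field r \<and> sub_ts (X i) (X i') \<and> h = ts_incl (X i) (X i')"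
        using sub by (auto intro: FieldI1 FieldI2)
    qed (use Z rtsD(2) i0 tot TZ in blast)+
  qed (use r i0 hom in auto)
  then show ?thesis using localizer unfolding grothendieck_localizer_def by blast
qed

end

text \<open>Derivability takes the place of transfinite recursion: a transition is present at
  \<open>i\<close> if it arises from \<open>T\<close> by finitely many substitutions, performed at
  increasing indices below \<open>i\<close>.\<close>

inductive stage :: "'i rel \<Rightarrow> ('i \<Rightarrow> 'a \<times> 'a) \<Rightarrow> ('s \<times> 'a list \<times> 's) set \<Rightarrow> 'i \<Rightarrow> 's \<Rightarrow> 'a list \<Rightarrow> 's \<Rightarrow> bool"
  for r g T where
  stage_base: "(\<alpha>, us, \<beta>) \<in> T \<Longrightarrow> stage r g T i \<alpha> us \<beta>"
| stage_step: "j \<in> underS r i \<Longrightarrow> stage r g T j \<alpha> us \<beta> \<Longrightarrow>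
    list_all2 (may_replace (fst (g j)) (snd (g j))) us vs \<Longrightarrow> stage r g T i \<alpha> vs \<beta>"

definition stage_trans where
  "stage_trans r g T i = {(\<alpha>, us, \<beta>). stage r g T i \<alpha> us \<beta>}"

lemma stage_trans_eq:
  "stage_trans r g T i =
     T \<union> (\<Union>j \<in> underS r i. subst_trans (may_replace (fst (g j)) (snd (g j))) (stage_trans r g T j))"
proof (intro set_eqI iffI)
  fix t assume "t \<in> stage_trans r g T i"
  then obtain \<alpha> us \<beta> where t: "t = (\<alpha>, us, \<beta>)" "stage r g T i \<alpha> us \<beta>" by (auto simp: stage_trans_def)
  from t(2) show "t \<in> T \<union> (\<Union>j \<in> underS r i. subst_trans (may_replace (fst (g j)) (snd (g j))) (stage_trans r g T j))"
    unfolding t(1) by cases (auto simp: stage_trans_def intro: subst_transI)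
next
  fix t assume "t \<in> T \<union> (\<Union>j \<in> underS r i. subst_trans (may_replace (fst (g j)) (snd (g j))) (stage_trans r g T j))"
  then show "t \<in> stage_trans r g T i"
    by (cases t) (auto simp: stage_trans_def elim!: subst_transE intro: stage.intros)
qed

lemma good_trans_Union:
  assumes "\<And>T. T \<in> \<T> \<Longrightarrow> good_trans T"
  shows "good_trans (\<Union>\<T>)"
  unfolding good_trans_def
proof (intro conjI allI impI)
  fix \<alpha> us vs \<beta> assume "(\<alpha>, us, \<beta>) \<in> \<Union>\<T>" "mset vs = mset us"
  then show "(\<alpha>, vs, \<beta>) \<in> \<Union>\<T>" using good_transD(1)[OF assms] by blast
next
  fix \<alpha> us vs \<beta> assume t: "(\<alpha>, us @ vs, \<beta>) \<in> \<Union>\<T>" "us \<noteq> []" "vs \<noteq> []"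
  then obtain T where T: "T \<in> \<T>" "(\<alpha>, us @ vs, \<beta>) \<in> T" by blast
  show "\<exists>\<nu>. (\<alpha>, us, \<nu>) \<in> \<Union>\<T> \<and> (\<nu>, vs, \<beta>) \<in> \<Union>\<T>"
    using good_transD(2)[OF assms[OF T(1)] T(2) t(2,3)] T(1) by blast
next
  fix \<alpha> us vs ws \<beta> assume t: "(\<alpha>, us @ vs @ ws, \<beta>) \<in> \<Union>\<T>" "us \<noteq> []" "vs \<noteq> []" "ws \<noteq> []"
  then obtain T where T: "T \<in> \<T>" "(\<alpha>, us @ vs @ ws, \<beta>) \<in> T" by blast
  show "\<exists>\<nu>1 \<nu>2. (\<alpha>, us, \<nu>1) \<in> \<Union>\<T> \<and> (\<nu>1, vs @ ws, \<beta>) \<in> \<Union>\<T> \<and>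
      (\<alpha>, us @ vs, \<nu>2) \<in> \<Union>\<T> \<and> (\<nu>2, ws, \<beta>) \<in> \<Union>\<T> \<and> (\<nu>1, vs, \<nu>2) \<in> \<Union>\<T>"
    using good_transD(3)[OF assms[OF T(1)] T(2) t(2-4)] T(1) by blast
qed

lemma stage_good:
  assumes "Well_order r" "good_trans T"
  shows "good_trans (stage_trans r g T i)"
proof -
  have wo: "wo_rel r" using assms(1) by (simp add: wo_rel_def)
  show ?thesis
  proof (induction i rule: wo_rel.well_order_induct[OF wo])
    case (1 i)
    have "good_trans (\<Union>(insert T ((\<lambda>j. subst_trans (may_replace (fst (g j)) (snd (g j))) (stage_trans r g T j)) ` underS r i)))"
      by (rule good_trans_Union) (use assms(2) 1 in \<open>auto intro!: subst_good simp: underS_def\<close>)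
    then show ?case by (subst stage_trans_eq) simp
  qed
qed

lemma stage_mono:
  assumes "Well_order r" "(i, j) \<in> r"
  shows "stage_trans r g T i \<subseteq> stage_trans r g T j"
proof -
  have "underS r i \<subseteq> underS r j"
    using underS_incr[of r i j] assms by (auto simp: well_order_on_def linear_order_on_def
        partial_order_on_def preorder_on_def)
  then show ?thesis by (subst (1 2) stage_trans_eq) blast
qed

text \<open>Since \<open>may_replace\<close> is reflexive, the substitution at \<open>i\<close>
  contains the whole stage \<open>i\<close>, and so all that was accumulated earlier.\<close>

lemma stage_succ:
  assumes r: "Well_order r" and i: "i \<in> Field r" and ij: "underS r j = under r i"
  shows "stage_trans r g T j = subst_trans (may_replace (fst (g i)) (snd (g i))) (stage_trans r g T i)"
    (is "_ = ?S i")
proof -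
  have wo: "wo_rel r" using r by (simp add: wo_rel_def)
  have "under r i = insert i (underS r i)"
    using wo_rel.REFL[OF wo] i by (auto simp: under_def underS_def refl_on_def)
  then have "stage_trans r g T j = stage_trans r g T i \<union> ?S i"
    using stage_trans_eq[of r g T j] stage_trans_eq[of r g T i] ij by auto
  moreover have "stage_trans r g T i \<subseteq> ?S i" by (rule subst_trans_refl) simp
  ultimately show ?thesis by blast
qed

text \<open>A substitution performed at \<open>k\<close> shows at every later index. If
  \<open>j\<close> is no successor, such an index exists strictly between \<open>k\<close> and
  \<open>j\<close>.\<close>

lemma stage_lim:
  assumes r: "Well_order r" and j: "j \<in> Field r" "underS r j \<noteq> {}"
    and lim: "\<nexists>i. i \<in> Field r \<and> underS r j = under r i"
  shows "stage_trans r g T j \<subseteq> (\<Union>i \<in> underS r j. stage_trans r g T i)"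
proof
  have wo: "wo_rel r" using r by (simp add: wo_rel_def)
  fix t assume "t \<in> stage_trans r g T j"
  then consider "t \<in> T"
    | k where "k \<in> underS r j" "t \<in> subst_trans (may_replace (fst (g k)) (snd (g k))) (stage_trans r g T k)"
    by (subst (asm) stage_trans_eq) blast
  then show "t \<in> (\<Union>i \<in> underS r j. stage_trans r g T i)"
  proof cases
    case 1
    then show ?thesis using j(2) by (subst stage_trans_eq) blast
  next
    case (2 k)
    have kj: "k \<in> Field r" "(k, j) \<in> r" "k \<noteq> j" using 2(1) underS_subset_Field[of r j] by (auto simp: underS_def)
    have "under r k \<subseteq> underS r j"
      using kj wo_rel.TRANS[OF wo] wo_rel.ANTISYM[OF wo]
      by (auto simp: under_def underS_def trans_def antisym_def)
    then obtain k' where k': "k' \<in> underS r j" "k' \<notin> under r k" using lim kj(1) by blast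
    have "k' \<in> Field r" using k'(1) underS_subset_Field[of r j] by blast
    then have "k \<in> underS r k'"
      using k'(2) wo_rel.TOTALS[OF wo] wo_rel.REFL[OF wo] kj(1) by (auto simp: under_def underS_def refl_on_def)
    then have "t \<in> stage_trans r g T k'" using 2(2) by (subst stage_trans_eq) blast
    then show ?thesis using k'(1) by blast
  qed
qed

context large_type
begin

text \<open>The index set \<open>I\<close> is in bijection with \<open>P \<times> I\<close>, so
  every pair occurs once for each element of \<open>I\<close>. For a cardinal order that many
  occurrences cannot be confined to a proper initial segment.\<close>

lemma fair_enumeration:
  fixes L :: "'u set" and P :: "('u \<times> 'u) set"
  assumes L: "|L| <o \<kappa>" and P: "P \<subseteq> L \<times> L" "P \<noteq> {}"
  obtains r :: "'u rel" and g where "Card_order r" "infinite (Field r)" "|Field r| <o \<kappa>"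
    "\<And>i. i \<in> Field r \<Longrightarrow> g i \<in> P"
    "\<And>i p. i \<in> Field r \<Longrightarrow> p \<in> P \<Longrightarrow> \<exists>j. (i, j) \<in> r \<and> g j = p"
proof -
  \<comment> \<open>The summand of natural numbers makes the index set infinite even for finite
    \<open>L\<close>. The sum is then moved into \<open>'u\<close>, where the well-orders of
    \<open>transfinite_compositions\<close> live.\<close>
  let ?C = "L <+> (UNIV :: nat set)"
  have nat: "|UNIV :: nat set| <o \<kappa>"
    using ordIso_ordLess_trans[OF card_of_nat uncountable] .
  have C: "|?C| <o \<kappa>" by (rule card_of_Plus_ordLess_infinite_Field[OF infinite_Field card L nat])
  then have "|?C| \<le>o |UNIV :: 'u set|" using enough ordLess_imp_ordLeq ordLeq_transitive by blast
  then obtain e :: "'u + nat \<Rightarrow> 'u" where e: "inj_on e ?C" by (auto simp flip: card_of_ordLeq)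
  define I where "I = e ` ?C"
  have IC: "|?C| =o |I|" unfolding I_def by (rule card_of_ordIsoI[of e]) (use e in \<open>simp add: bij_betw_def\<close>)
  have I: "|I| <o \<kappa>" using ordIso_ordLess_trans[OF ordIso_symmetric[OF IC] C] .
  have inf: "infinite I" using finite_imageD[OF _ e] unfolding I_def by auto
  have "infinite (Field |?C| )" by (simp add: Field_card_of)
  then have "|L \<times> L| \<le>o |?C|"
    by (rule card_of_Times_ordLeq_infinite_Field[OF _ card_of_Plus1 card_of_Plus1 card_of_Card_order])
  then have "|P| \<le>o |?C|" using ordLeq_transitive[OF card_of_mono1[OF P(1)]] by blast
  then have PI: "|P| \<le>o |I|" using IC ordLeq_ordIso_trans by blast
  have "|P \<times> I| =o |I|" using card_of_Times_infinite[OF inf P(2) PI] by blast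
  then obtain b where b: "bij_betw b I (P \<times> I)"
    using ordIso_symmetric unfolding card_of_ordIso[symmetric] by (metis bij_betw_inv_into)
  have C: "Card_order |I|" by (rule card_of_Card_order)
  have wo: "wo_rel |I|" by (simp add: wo_rel_def card_of_Well_order)
  show ?thesis
  proof (rule that[of "|I|" "\<lambda>i. fst (b i)"])
    show "Card_order |I|" "infinite (Field |I| )" "|Field |I|| <o \<kappa>"
      using C inf I by (simp_all add: Field_card_of)
    show "fst (b i) \<in> P" if "i \<in> Field |I|" for i
      using bij_betw_apply[OF b, of i] that by (simp add: Field_card_of mem_Times_iff)
    fix i p assume i: "i \<in> Field |I|" and p: "p \<in> P"
    show "\<exists>j. (i, j) \<in> |I| \<and> fst (b j) = p"
    proof (rule ccontr)
      assume no: "\<nexists>j. (i, j) \<in> |I| \<and> fst (b j) = p"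
      \<comment> \<open>\<open>f\<close> runs through the occurrences of \<open>p\<close>. If all of
        them lay below \<open>i\<close>, then \<open>I\<close> would embed into the strict initial
        segment at \<open>i\<close>, which is smaller.\<close>
      define f where "f = (\<lambda>k. inv_into I b (p, k))"
      have f: "f k \<in> I" "b (f k) = (p, k)" if "k \<in> I" for k
        using b p that unfolding f_def by (auto simp: bij_betw_def intro: inv_into_into f_inv_into_f)
      have "f k \<in> underS |I| i" if "k \<in> I" for k
      proof -
        have "(i, f k) \<notin> |I|" using no f(2)[OF that] by auto
        then show ?thesis
          using wo_rel.TOTALS[OF wo] wo_rel.REFL[OF wo] i f(1)[OF that]
          by (auto simp: underS_def Field_card_of refl_on_def)
      qed
      moreover have "inj_on f I" using f(2) by (metis inj_onI snd_conv)
      ultimately have "|I| \<le>o |underS |I| i|" by (auto simp flip: card_of_ordLeq)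
      then show False using card_of_underS[OF C i] not_ordLess_ordLeq by blast
    qed
  qed
qed

end

context p_localizer
begin

text \<open>\<open>S\<close> is generated from \<open>A\<close>, by exchanging actions with equal
  image. It becomes the full preimage of the transitions of \<open>X\<close> once these are known to
  lift to \<open>A\<close>.\<close>

lemma W_saturate:
  assumes A: "A \<in> rts \<kappa>" and over: "lies_over A X f h"
    and lab: "\<And>u. u \<in> actions A \<Longrightarrow> label X (h u) = label A u"
  defines "S \<equiv> A\<lparr>transitions := subst_trans (\<lambda>a b. b \<in> actions A \<and> h a = h b) (transitions A)\<rparr>"
  shows "S \<in> rts \<kappa>" "ts_incl A S \<in> W"
proof -
  note w = rtsD[OF A] and o = lies_overD[OF over]
  let ?L = "actions A" and ?T = "transitions A" and ?R = "\<lambda>a b. b \<in> actions A \<and> h a = h b"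
  let ?at = "\<lambda>T. A\<lparr>transitions := T\<rparr>"
  have ext: "label A \<in> extensional ?L" using w(2) by (simp add: weak_ts_def)
  have TS: "?T \<subseteq> subst_trans ?R ?T"
  proof
    fix t assume t: "t \<in> ?T"
    obtain \<alpha> us \<beta> where [simp]: "t = (\<alpha>, us, \<beta>)" by (cases t)
    have "list_all2 ?R us us"
      using weak_ts_transD(3)[OF w(2), of \<alpha> us \<beta>] t by (auto simp: list_all2_same)
    then show "t \<in> subst_trans ?R ?T" using t by (auto intro: subst_transI)
  qed
  \<comment> \<open>Exchanging actions within the fibres of \<open>h\<close> keeps the image in
    \<open>X\<close>. So any system between \<open>A\<close> and \<open>S\<close> with
    \<open>good_trans\<close> is regular, which settles \<open>S\<close> and all stages at
    once.\<close>
  have at: "lies_over (?at T) X f h" "?at T \<in> rts \<kappa>"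
    if T: "?T \<subseteq> T" "T \<subseteq> subst_trans ?R ?T" "good_trans T" for T
  proof -
    show over': "lies_over (?at T) X f h"
      unfolding lies_over_def
    proof (intro conjI allI impI)
      fix \<alpha> vs \<beta> assume "(\<alpha>, vs, \<beta>) \<in> transitions (?at T)"
      then obtain us where us: "(\<alpha>, us, \<beta>) \<in> ?T" "list_all2 ?R us vs"
        using T(2) by (auto elim: subst_transE)
      have "map h vs = map h us" by (rule list_all2_map_eq[OF us(2)]) simp
      then show "(f \<alpha>, map h vs, f \<beta>) \<in> transitions X" using o(3)[OF us(1)] by (simp del: map_eq_conv)
    qed (use o in auto)
    have "regular_ts (?at T)"
    proof (rule regular_ts_overI[OF over'])
      fix \<alpha> vs \<beta> assume "(\<alpha>, vs, \<beta>) \<in> transitions (?at T)"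
      then obtain us where us: "(\<alpha>, us, \<beta>) \<in> ?T" "list_all2 ?R us vs"
        using T(2) by (auto elim: subst_transE)
      then show "\<alpha> \<in> states (?at T) \<and> vs \<noteq> [] \<and> set vs \<subseteq> actions (?at T) \<and> \<beta> \<in> states (?at T)"
        using weak_ts_transD[OF w(2) us(1)] by (auto elim: list_all2_set)
    next
      fix u assume "u \<in> actions (?at T)"
      then show "\<exists>\<alpha> \<beta>. (\<alpha>, [u], \<beta>) \<in> transitions (?at T)"
        using T(1) w(1) by (fastforce simp: regular_ts_def)
    qed (use ext T in auto)
    then show "?at T \<in> rts \<kappa>" using w by (intro rtsI) auto
  qed
  have good_S: "good_trans (subst_trans ?R ?T)" by (rule subst_good[OF regular_ts_good[OF w(1)]])
  show S: "S \<in> rts \<kappa>" unfolding S_def by (rule at(2)[OF TS order_refl good_S])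
  show "ts_incl A S \<in> W"
  \<comment> \<open>Without actions there is no pair to enumerate; there are no transitions either,
    and the inclusion is an identity.\<close>
  proof (cases "?L = {}")
    case True
    then have "subst_trans ?R ?T = {}" "?T = {}"
      using weak_ts_transD(2,3)[OF w(2)] by (auto elim!: subst_transE)
    then have "S = A" by (simp add: S_def)
    then show ?thesis using W_id[OF A] by (simp add: ts_id_mk)
  next
    case False
    let ?P = "{(u, v). u \<in> ?L \<and> v \<in> ?L \<and> h u = h v}"
    obtain r :: "'u rel" and g where r: "Card_order r" "infinite (Field r)" "|Field r| <o \<kappa>"
      and gP: "\<And>i. i \<in> Field r \<Longrightarrow> g i \<in> ?P"
      and fair: "\<And>i p. i \<in> Field r \<Longrightarrow> p \<in> ?P \<Longrightarrow> \<exists>j. (i, j) \<in> r \<and> g j = p"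
      by (rule fair_enumeration[OF w(4), of ?P]) (use False in auto)
    have wr: "Well_order r" using r(1) by (simp add: card_order_on_def)
    have wo: "wo_rel r" using wr by (simp add: wo_rel_def)
    have gD: "fst (g i) \<in> ?L" "snd (g i) \<in> ?L" "h (fst (g i)) = h (snd (g i))" if "i \<in> Field r" for i
      using gP[OF that] by auto
    define T where "T = stage_trans r g ?T"
    have T1: "?T \<subseteq> T i" for i unfolding T_def by (subst stage_trans_eq) blast
    have T3: "good_trans (T i)" for i
      unfolding T_def by (rule stage_good[OF wr regular_ts_good[OF w(1)]])
    have "(\<alpha>, us, \<beta>) \<in> subst_trans ?R ?T" if "stage r g ?T i \<alpha> us \<beta>" for i \<alpha> us \<beta>
      using that
    proof (induction)
      case (stage_base \<alpha> us \<beta> i)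
      then show ?case using TS by blast
    next
      case (stage_step j i \<alpha> us \<beta> vs)
      have j: "j \<in> Field r" using stage_step.hyps(1) underS_subset_Field[of r i] by blast
      obtain us' where us': "(\<alpha>, us', \<beta>) \<in> ?T" "list_all2 ?R us' us"
        using stage_step.IH by (auto elim: subst_transE)
      have "list_all2 ?R us' vs"
        using us'(2) stage_step.hyps(3) gD[OF j] by (fastforce simp: list_all2_conv_all_nth)
      then show ?case using us'(1) by (rule subst_transI[rotated])
    qed
    then have T2: "T i \<subseteq> subst_trans ?R ?T" for i by (auto simp: T_def stage_trans_def)
    note atT = at[OF T1 T2 T3]
    obtain i0 where i0: "i0 \<in> Field r" "underS r i0 = {}"
    proof -
      have "Field r \<noteq> {}" using r(2) by auto
      then obtain i where "i \<in> Field r" "\<And>j. j \<in> Field r \<Longrightarrow> (i, j) \<in> r"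
        using wo_rel.minim_in[OF wo, of "Field r"] wo_rel.minim_least[OF wo, of "Field r"] by blast
      moreover from this have "underS r i = {}"
        using wo_rel.ANTISYM[OF wo] underS_subset_Field[of r i] by (fastforce simp: underS_def antisym_def)
      ultimately show ?thesis using that by blast
    qed
    have "ts_incl (?at (T i0)) S \<in> W"
    proof (rule W_chain[OF wr r(3) S _ _ _ _ _ i0])
      show "?at (T i) \<in> rts \<kappa> \<and> sub_ts (?at (T i)) S \<and> states (?at (T i)) = states S \<and>
          actions (?at (T i)) = actions S" for i
        using atT(2)[of i] T2[of i] by (auto simp: sub_ts_def S_def)
      show "transitions (?at (T i)) \<subseteq> transitions (?at (T j))" if "(i, j) \<in> r" for i j
        using stage_mono[OF wr that] by (simp add: T_def)
      show "transitions (?at (T j)) \<subseteq> (\<Union>i \<in> underS r j. transitions (?at (T i)))"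
        if "j \<in> Field r" "underS r j \<noteq> {}" "\<nexists>i. i \<in> Field r \<and> underS r j = under r i" for j
        using stage_lim[OF wr that] by (simp add: T_def)
      show "ts_incl (?at (T i)) (?at (T j)) \<in> W"
        if ij: "i \<in> Field r" "j \<in> Field r" "underS r j = under r i" for i j
      proof -
        let ?u = "fst (g i)" and ?v = "snd (g i)"
        have lab': "label A ?v = label A ?u" using lab gD[OF ij(1)] by metis
        have "?at (T j) = dup_action ?u ?v (?at (T i))"
          using stage_succ[OF wr ij(1,3), of g ?T] gD[OF ij(1)] lab'
          by (simp add: dup_action_def T_def insert_absorb fun_upd_idem)
        moreover have "ts_incl (?at (T i)) (dup_action ?u ?v (?at (T i))) \<in> W"
          by (rule W_dup_action[OF atT(2,1)]) (use gD[OF ij(1)] lab' in auto)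
        ultimately show ?thesis by simp
      qed
      show "transitions S \<subseteq> (\<Union>i \<in> Field r. transitions (?at (T i)))"
      proof
        fix t assume "t \<in> transitions S"
        then obtain \<alpha> vs \<beta> where t: "t = (\<alpha>, vs, \<beta>)" "(\<alpha>, vs, \<beta>) \<in> subst_trans ?R ?T"
          unfolding S_def by (cases t) auto
        then obtain us where us: "(\<alpha>, us, \<beta>) \<in> ?T" "list_all2 ?R us vs" by (auto elim: subst_transE)
        note tt = weak_ts_transD[OF w(2) us(1)]
        have len: "length us = length vs" using us(2) by (rule list_all2_lengthD)
        \<comment> \<open>The word is rewritten from left to right: letter \<open>n\<close> is
          changed at an index where its pair is enumerated, at or after the stage reached so
          far.\<close>
        have "n \<le> length vs \<Longrightarrow> \<exists>i \<in> Field r. (\<alpha>, take n vs @ drop n us, \<beta>) \<in> T i" for n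
        proof (induction n)
          case 0
          then show ?case using us(1) T1 i0(1) by auto
        next
          case (Suc n)
          then obtain i where i: "i \<in> Field r" "(\<alpha>, take n vs @ drop n us, \<beta>) \<in> T i" by auto
          have n: "n < length vs" "n < length us" using Suc.prems len by auto
          have "(us ! n, vs ! n) \<in> ?P"
            using n us(2) tt(3) by (auto simp: list_all2_conv_all_nth)
          then obtain j where j: "(i, j) \<in> r" "g j = (us ! n, vs ! n)" using fair[OF i(1)] by blast
          \<comment> \<open>The substitution indexed by \<open>j\<close> takes effect only at later
            indices. There is one, because an infinite cardinal order has no last element.\<close>
          obtain k where k: "j \<noteq> k" "(j, k) \<in> r"
            using infinite_Card_order_limit[OF r(1,2) FieldI2[OF j(1)]] by blast
          have "(\<alpha>, take n vs @ drop n us, \<beta>) \<in> T j"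
            using i(2) stage_mono[OF wr j(1), of g ?T] by (auto simp: T_def)
          moreover have "list_all2 (may_replace (us ! n) (vs ! n)) (take n vs @ drop n us)
              (take (Suc n) vs @ drop (Suc n) us)"
            using n by (simp add: take_Suc_conv_app_nth Cons_nth_drop_Suc[symmetric] list_all2_appendI
                list.rel_refl)
          ultimately have "(\<alpha>, take (Suc n) vs @ drop (Suc n) us, \<beta>) \<in> T k"
            using k j(2) unfolding T_def
            by (subst stage_trans_eq) (auto simp: underS_def intro!: bexI[of _ j] subst_transI)
          then show ?case using FieldI2[OF k(2)] by blast
        qed
        from this[of "length vs"] len show "t \<in> (\<Union>i \<in> Field r. transitions (?at (T i)))"
          by (auto simp: t(1))
      qed
    qed
    moreover have "T i0 = ?T" unfolding T_def by (subst stage_trans_eq) (simp add: i0(2))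
    ultimately show ?thesis by simp
  qed
qed

lemma W_if_transitions_lift:
  assumes f: "f \<in> rts_maps \<kappa>"
    and bij: "bij_betw (on_states f) (states (src f)) (states (tgt f))"
    and lift: "\<And>\<alpha> us \<beta>. (\<alpha>, us, \<beta>) \<in> transitions (tgt f) \<Longrightarrow>
        trans_image (on_states f) (on_actions f) (transitions (src f)) \<alpha> us \<beta>"
  shows "f \<in> W"
proof -
  define A X fs h where "A = src f" and "X = tgt f" and "fs = on_states f" and "h = on_actions f"
  have A: "A \<in> rts \<kappa>" and X: "X \<in> rts \<kappa>" and hom: "f \<in> ts_hom A X"
    using rts_mapsD[OF f] by (auto simp: A_def X_def)
  note w = rtsD[OF A] and d = ts_homD[OF hom, folded fs_def h_def]
  note lift' = lift[folded A_def X_def fs_def h_def]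
  have inj: "inj_on fs (states A)" using bij by (simp add: bij_betw_def fs_def A_def)
  have over: "lies_over A X fs h"
    unfolding lies_over_def using rtsD(1)[OF X] inj d(8) by blast
  let ?R = "\<lambda>a b. b \<in> actions A \<and> h a = h b"
  define S where "S = A\<lparr>transitions := subst_trans ?R (transitions A)\<rparr>"
  have S: "S \<in> rts \<kappa>" "ts_incl A S \<in> W"
    using W_saturate[OF A over d(7)] by (simp_all add: S_def)
  define p where "p = mk_map S X fs h"
  have p: "p \<in> ts_hom S X"
    unfolding p_def
  proof (rule mk_map_hom[OF rtsD(2)[OF S(1)] rtsD(2)[OF X]])
    fix \<alpha> vs \<beta> assume "(\<alpha>, vs, \<beta>) \<in> transitions S"
    then obtain us where us: "(\<alpha>, us, \<beta>) \<in> transitions A" "list_all2 ?R us vs"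
      by (auto simp: S_def elim: subst_transE)
    have "map h vs = map h us" by (rule list_all2_map_eq[OF us(2)]) simp
    then show "(fs \<alpha>, map h vs, fs \<beta>) \<in> transitions X" using d(8)[OF us(1)] by (simp del: map_eq_conv)
  qed (use d in \<open>auto simp: S_def\<close>)
  have "action_cover p"
    unfolding action_cover_def
  proof (intro conjI allI impI)
    show "bij_betw (on_states p) (states (src p)) (states (tgt p))"
      using bij unfolding p_def mk_map_simps
      by (subst bij_betw_cong[of _ _ fs]) (auto simp: S_def A_def X_def fs_def)
    show "actions (tgt p) \<subseteq> on_actions p ` actions (src p)"
    proof
      fix b assume "b \<in> actions (tgt p)"
      then obtain \<alpha> \<beta> where b: "(\<alpha>, [b], \<beta>) \<in> transitions X"
        using regular_ts_usedD[OF rtsD(1)[OF X]] by (auto simp: p_def)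
      obtain \<alpha>' us' \<beta>' where u: "(\<alpha>', us', \<beta>') \<in> transitions A" "[b] = map h us'"
        using lift'[OF b] by (elim exE conjE) (rule that)
      then obtain a where "us' = [a]" "b = h a" by auto
      then show "b \<in> on_actions p ` actions (src p)"
        using weak_ts_transD(3)[OF w(2) u(1)] by (auto simp: p_def S_def)
    qed
    fix \<alpha> us \<beta>
    assume s: "\<alpha> \<in> states (src p)" "\<beta> \<in> states (src p)" "set us \<subseteq> actions (src p)"
      and t: "(on_states p \<alpha>, map (on_actions p) us, on_states p \<beta>) \<in> transitions (tgt p)"
    have "map (on_actions p) us = map h us" using s(3) by (auto simp: p_def)
    then have t': "(fs \<alpha>, map h us, fs \<beta>) \<in> transitions X"
      using s t by (simp add: p_def del: map_eq_conv)
    \<comment> \<open>The lift has the same end states by injectivity and a word with the same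
      image, so it differs from the given transition only by exchanges that \<open>S\<close>
      allows.\<close>
    obtain \<alpha>' us' \<beta>' where u: "(\<alpha>', us', \<beta>') \<in> transitions A" "fs \<alpha> = fs \<alpha>'"
      "map h us = map h us'" "fs \<beta> = fs \<beta>'"
      using lift'[OF t'] by blast
    have "\<alpha> = \<alpha>'" "\<beta> = \<beta>'"
      using inj u(2,4) s weak_ts_transD[OF w(2) u(1)] by (auto simp: p_def S_def dest: inj_onD)
    moreover have "list_all2 ?R us' us"
      using u(3) s(3) by (auto simp: p_def S_def list_all2_conv_all_nth list_eq_iff_nth_eq)
    ultimately show "(\<alpha>, us, \<beta>) \<in> transitions (src p)"
      using u(1) by (auto simp: p_def S_def intro: subst_transI)
  qed
  then have pW: "p \<in> W" by (rule W_cover[OF rts_mapsI[OF p S(1) X]])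
  have sub: "sub_ts A S"
    using ts_homD(8)[OF rts_mapsD(1)[OF W_rts_maps[OF S(2)], simplified]] weak_ts_transD[OF w(2)]
    by (force simp: sub_ts_def S_def map_idI subset_iff)
  have "p \<circ>\<^sub>t ts_incl A S = f"
    by (rule ts_hom_eqI[OF ts_comp_hom[OF ts_incl_hom[OF sub w(2) rtsD(2)[OF S(1)]] p] hom])
       (auto simp: p_def S_def fs_def h_def)
  then show ?thesis using W_comp[OF S(2) pW] by (simp add: p_def)
qed

end

section \<open>Cubification\<close>

lemma good_trans_image:
  assumes "good_trans T"
  shows "good_trans {(f \<alpha>, map g us, f \<beta>) | \<alpha> us \<beta>. (\<alpha>, us, \<beta>) \<in> T}" (is "good_trans ?I")
  unfolding good_trans_def
proof (intro conjI allI impI)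
  have I: "(f \<alpha>, map g us, f \<beta>) \<in> ?I" if "(\<alpha>, us, \<beta>) \<in> T" for \<alpha> us \<beta> using that by blast
  {
    fix \<alpha> us vs \<beta> assume "(\<alpha>, us, \<beta>) \<in> ?I" and m: "mset vs = mset us"
    then obtain \<alpha>' us' \<beta>' where t: "(\<alpha>', us', \<beta>') \<in> T" "\<alpha> = f \<alpha>'" "us = map g us'" "\<beta> = f \<beta>'" by blast
    have "list_all2 (\<lambda>b a. b = g a) us us'" using t(3) by (simp add: list_all2_conv_all_nth)
    then obtain vs' where v: "list_all2 (\<lambda>b a. b = g a) vs vs'" "mset vs' = mset us'"
      using list_all2_reorder_left_invariance[OF _ m] by blast
    have "vs = map g vs'" using v(1) by (auto simp: list_all2_conv_all_nth intro: nth_equalityI)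
    then show "(\<alpha>, vs, \<beta>) \<in> ?I" using I[OF good_transD(1)[OF assms t(1) v(2)]] t by simp
  next
    fix \<alpha> us vs \<beta> assume "(\<alpha>, us @ vs, \<beta>) \<in> ?I" and ne: "us \<noteq> []" "vs \<noteq> []"
    then obtain \<alpha>' us' vs' \<beta>' where t: "(\<alpha>', us' @ vs', \<beta>') \<in> T" "\<alpha> = f \<alpha>'" "us = map g us'"
      "vs = map g vs'" "\<beta> = f \<beta>'"
      by (auto simp: append_eq_map_conv)
    then obtain \<nu> where "(\<alpha>', us', \<nu>) \<in> T" "(\<nu>, vs', \<beta>') \<in> T"
      using good_transD(2)[OF assms t(1)] ne by auto
    then show "\<exists>\<nu>. (\<alpha>, us, \<nu>) \<in> ?I \<and> (\<nu>, vs, \<beta>) \<in> ?I"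
      using I t(2-) by blast
  next
    fix \<alpha> us vs ws \<beta> assume t0: "(\<alpha>, us @ vs @ ws, \<beta>) \<in> ?I" and ne: "us \<noteq> []" "vs \<noteq> []" "ws \<noteq> []"
    from t0 obtain \<alpha>' zs \<beta>' where z: "(\<alpha>', zs, \<beta>') \<in> T" "\<alpha> = f \<alpha>'" "us @ vs @ ws = map g zs" "\<beta> = f \<beta>'"
      by blast
    from z(3) obtain us' vs' ws' where "zs = us' @ vs' @ ws'" "us = map g us'" "vs = map g vs'" "ws = map g ws'"
      by (auto simp: append_eq_map_conv)
    with z have t: "(\<alpha>', us' @ vs' @ ws', \<beta>') \<in> T" "\<alpha> = f \<alpha>'"
      "us = map g us'" "vs = map g vs'" "ws = map g ws'" "\<beta> = f \<beta>'" by simp_all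
    then obtain \<nu>1 \<nu>2 where "(\<alpha>', us', \<nu>1) \<in> T" "(\<nu>1, vs' @ ws', \<beta>') \<in> T"
      "(\<alpha>', us' @ vs', \<nu>2) \<in> T" "(\<nu>2, ws', \<beta>') \<in> T" "(\<nu>1, vs', \<nu>2) \<in> T"
      using good_transD(3)[OF assms t(1)] ne by auto
    from this[THEN I] show "\<exists>\<nu>1 \<nu>2. (\<alpha>, us, \<nu>1) \<in> ?I \<and> (\<nu>1, vs @ ws, \<beta>) \<in> ?I \<and>
        (\<alpha>, us @ vs, \<nu>2) \<in> ?I \<and> (\<nu>2, ws, \<beta>) \<in> ?I \<and> (\<nu>1, vs, \<nu>2) \<in> ?I"
      unfolding t(2-) map_append by (intro exI conjI)
  }
qed

definition cube_arrows ::
    "('u, 'u, 'l) ts \<Rightarrow> ((nat list, 'l \<times> nat, 'u, 'u, 'l) ts_map \<times>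
       (nat list, 'l \<times> nat, nat list, 'l \<times> nat, 'l) ts_map \<times> (nat list, 'l \<times> nat, 'u, 'u, 'l) ts_map) set" where
  "cube_arrows X = {(k, h, k') | k h k'. k \<in> cubes_over X \<and> k' \<in> cubes_over X \<and>
     h \<in> ts_hom (src k) (src k') \<and> k' \<circ>\<^sub>t h = k}"

lemma is_Cub_eq: "is_Cub \<kappa> X Z c \<longleftrightarrow> ts_colimit (wts \<kappa>) (cubes_over X) src (cube_arrows X) Z c"
  by (simp add: is_Cub_def cube_arrows_def)

lemma is_CubD:
  fixes X Z Z' :: "('u, 'u, 'l) ts"
  assumes "is_Cub \<kappa> X Z c"
  shows "Z \<in> wts \<kappa>" "ts_cocone (cubes_over X) src (cube_arrows X) Z c"
    "Z' \<in> wts \<kappa> \<Longrightarrow> ts_cocone (cubes_over X) src (cube_arrows X) Z' c' \<Longrightarrow>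
       \<exists>!g. g \<in> ts_hom Z Z' \<and> (\<forall>k \<in> cubes_over X. g \<circ>\<^sub>t c k = c' k)"
proof -
  note * = assms[unfolded is_Cub_eq ts_colimit_def]
  show "Z \<in> wts \<kappa>" "ts_cocone (cubes_over X) src (cube_arrows X) Z c" using * by simp_all
  show "Z' \<in> wts \<kappa> \<Longrightarrow> ts_cocone (cubes_over X) src (cube_arrows X) Z' c' \<Longrightarrow>
       \<exists>!g. g \<in> ts_hom Z Z' \<and> (\<forall>k \<in> cubes_over X. g \<circ>\<^sub>t c k = c' k)"
    by (rule conjunct2[OF conjunct2[OF *], THEN bspec, THEN spec, THEN mp])
qed

lemma cubes_overE:
  assumes "k \<in> cubes_over X"
  obtains xs where "k \<in> ts_hom (cube xs) X" "src k = cube xs"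
  using assms ts_homD(1) unfolding cubes_over_def by blast

lemma cubes_overI: "k \<in> ts_hom (cube xs) X \<Longrightarrow> k \<in> cubes_over X"
  unfolding cubes_over_def by blast

lemma cubes_over_hom: "k \<in> cubes_over X \<Longrightarrow> k \<in> ts_hom (src k) X"
  by (auto elim: cubes_overE)

lemma cubes_over_comp: "k \<in> cubes_over X \<Longrightarrow> f \<in> ts_hom X Y \<Longrightarrow> f \<circ>\<^sub>t k \<in> cubes_over Y"
  unfolding cubes_over_def using ts_comp_hom by blast

lemma wtsD: "X \<in> wts \<kappa> \<Longrightarrow> weak_ts X"
  by (simp add: wts_def)

lemma rts_wts: "X \<in> rts \<kappa> \<Longrightarrow> X \<in> wts \<kappa>"
  by (simp add: rts_def)

lemma cocone_natural:
  assumes c: "ts_cocone (cubes_over X) src (cube_arrows X) Z c"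
    and k: "k \<in> ts_hom (cube xs) X" and h: "h \<in> ts_hom (cube ys) (cube xs)"
  shows "c (k \<circ>\<^sub>t h) = c k \<circ>\<^sub>t h"
proof -
  have "(k \<circ>\<^sub>t h, h, k) \<in> cube_arrows X"
    unfolding cube_arrows_def
    using cubes_overI[OF k] cubes_overI[OF ts_comp_hom[OF h k]] h ts_homD(1)[OF k] ts_homD(1)[OF h]
    by simp
  then show ?thesis using c by (auto simp: ts_cocone_def)
qed

lemma cocone_postcomp:
  assumes c: "ts_cocone (cubes_over X) src (cube_arrows X) Z c" and f: "f \<in> ts_hom Z Y"
  shows "ts_cocone (cubes_over X) src (cube_arrows X) Y (\<lambda>k. f \<circ>\<^sub>t c k)"
  unfolding ts_cocone_def
proof (intro conjI ballI allI impI)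
  fix k assume "k \<in> cubes_over X"
  then show "f \<circ>\<^sub>t c k \<in> ts_hom (src k) Y"
    using c f by (auto simp: ts_cocone_def intro: ts_comp_hom)
next
  fix k h k' assume a: "(k, h, k') \<in> cube_arrows X"
  then have k': "k' \<in> cubes_over X" "h \<in> ts_hom (src k) (src k')" by (auto simp: cube_arrows_def)
  have "c k' \<in> ts_hom (src k') Z" "c k' \<circ>\<^sub>t h = c k" using c a k'(1) by (auto simp: ts_cocone_def)
  then show "f \<circ>\<^sub>t c k' \<circ>\<^sub>t h = f \<circ>\<^sub>t c k" using ts_comp_assoc[OF k'(2) _ f] by simp
qed

lemma cube_cocone_id: "ts_cocone (cubes_over X) src (cube_arrows X) X (\<lambda>k. k)"
  unfolding ts_cocone_def cube_arrows_def by (auto dest: cubes_over_hom)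

text \<open>\<open>Z\<close> is an arbitrary colimit among weak systems, so its shape has to be
  deduced. The part \<open>Z0\<close> covered by the legs is regular because it lies over
  \<open>X\<close>, and it receives the colimit cocone; universality then forces it to be all of
  \<open>Z\<close>.\<close>

lemma Cub_counit:
  fixes X :: "('u, 'u, 'l) ts"
  assumes X: "X \<in> rts \<kappa>" and Cub: "is_Cub \<kappa> X Z c"
  obtains \<pi> where "\<pi> \<in> ts_hom Z X" "\<And>k. k \<in> cubes_over X \<Longrightarrow> \<pi> \<circ>\<^sub>t c k = k"
    "Z \<in> rts \<kappa>" "bij_betw (on_states \<pi>) (states Z) (states X)"
    "\<And>\<alpha> us \<beta>. (\<alpha>, us, \<beta>) \<in> transitions X \<Longrightarrow> trans_image (on_states \<pi>) (on_actions \<pi>) (transitions Z) \<alpha> us \<beta>"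
proof -
  note w = rtsD[OF X]
  let ?K = "cubes_over X"
  note Z = is_CubD(1)[OF Cub] and c = is_CubD(2)[OF Cub] and univ = is_CubD(3)[OF Cub]
  have wZ: "weak_ts Z" by (rule wtsD[OF Z])
  have ck: "c k \<in> ts_hom (src k) Z" if "k \<in> ?K" for k using c that by (auto simp: ts_cocone_def)
  \<comment> \<open>The cubes over \<open>X\<close>, taken as their own legs, form a cocone on
    \<open>X\<close>.\<close>
  obtain \<pi> where \<pi>: "\<pi> \<in> ts_hom Z X" and \<pi>c: "\<And>k. k \<in> ?K \<Longrightarrow> \<pi> \<circ>\<^sub>t c k = k"
    using univ[OF rts_wts[OF X] cube_cocone_id] by blast
  note d\<pi> = ts_homD[OF \<pi>]
  have \<pi>s: "on_states \<pi> (on_states (c k) e) = on_states k e" if "k \<in> ?K" "e \<in> states (src k)" for k e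
    using arg_cong[OF \<pi>c[OF that(1)], of "\<lambda>f. on_states f e"] that ts_homD(1)[OF ck[OF that(1)]] by simp
  have \<pi>a: "on_actions \<pi> (on_actions (c k) a) = on_actions k a" if "k \<in> ?K" "a \<in> actions (src k)" for k a
    using arg_cong[OF \<pi>c[OF that(1)], of "\<lambda>f. on_actions f a"] that ts_homD(1)[OF ck[OF that(1)]] by simp
  \<comment> \<open>Restricting a cube to a vertex is an arrow of the diagram. So a leg, evaluated
    at a vertex, depends only on the state of \<open>X\<close> below it, and \<pi> is injective on
    the states covered by the legs.\<close>
  have vertex: "on_states (c k) e = on_states (c (vertex_map X (on_states k e))) []"
    if k: "k \<in> ?K" and e: "e \<in> states (src k)" for k e
  proof -
    obtain xs where xs: "k \<in> ts_hom (cube xs) X" "src k = cube xs" using k by (rule cubes_overE)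
    have h: "vertex_map (cube xs) e \<in> ts_hom (cube []) (cube xs)"
      by (rule vertex_map_hom[OF cube_weak]) (use e xs in simp)
    have "k \<circ>\<^sub>t vertex_map (cube xs) e = vertex_map X (on_states (k \<circ>\<^sub>t vertex_map (cube xs) e) [])"
      by (rule cube_Nil_homI[OF ts_comp_hom[OF h xs(1)]])
    then have "k \<circ>\<^sub>t vertex_map (cube xs) e = vertex_map X (on_states k e)" by (simp add: cube_Nil)
    then show ?thesis using cocone_natural[OF c xs(1) h] by (simp add: cube_Nil)
  qed
  define S L T where "S = (\<Union>k \<in> ?K. on_states (c k) ` states (src k))"
    and "L = (\<Union>k \<in> ?K. on_actions (c k) ` actions (src k))"
    and "T = (\<Union>k \<in> ?K. {(on_states (c k) \<alpha>, map (on_actions (c k)) us, on_states (c k) \<beta>) |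
        \<alpha> us \<beta>. (\<alpha>, us, \<beta>) \<in> transitions (src k)})"
  define Z0 where "Z0 = \<lparr>states = S, actions = L, label = restrict (label Z) L, transitions = T\<rparr>"
  have SZ: "S \<subseteq> states Z" and LZ: "L \<subseteq> actions Z" and TZ: "T \<subseteq> transitions Z"
    unfolding S_def L_def T_def using ts_homD(5,6,8)[OF ck] by blast+
  have inj: "inj_on (on_states \<pi>) S"
  proof (rule inj_onI)
    fix s t assume "s \<in> S" "t \<in> S" and eq: "on_states \<pi> s = on_states \<pi> t"
    then obtain k e k' e' where k: "k \<in> ?K" "e \<in> states (src k)" "s = on_states (c k) e"
      "k' \<in> ?K" "e' \<in> states (src k')" "t = on_states (c k') e'"
      unfolding S_def by blast
    then have "on_states k e = on_states k' e'" using eq \<pi>s by simp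
    then show "s = t" using vertex[OF k(1,2)] vertex[OF k(4,5)] k by simp
  qed
  have "lies_over Z0 X (on_states \<pi>) (on_actions \<pi>)"
    unfolding lies_over_def Z0_def using w(1) inj d\<pi>(8) TZ by auto
  then have Z0_reg: "regular_ts Z0"
  proof (rule regular_ts_overI)
    fix \<alpha> us \<beta> assume "(\<alpha>, us, \<beta>) \<in> transitions Z0"
    then obtain k \<alpha>' us' \<beta>' where k: "k \<in> ?K" "(\<alpha>', us', \<beta>') \<in> transitions (src k)"
      "\<alpha> = on_states (c k) \<alpha>'" "us = map (on_actions (c k)) us'" "\<beta> = on_states (c k) \<beta>'"
      by (auto simp: Z0_def T_def)
    then show "\<alpha> \<in> states Z0 \<and> us \<noteq> [] \<and> set us \<subseteq> actions Z0 \<and> \<beta> \<in> states Z0"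
      using weak_ts_transD[OF ts_homD(3)[OF ck[OF k(1)]] k(2)] by (auto simp: Z0_def S_def L_def)
  next
    fix u assume "u \<in> actions Z0"
    then obtain k a where k: "k \<in> ?K" "a \<in> actions (src k)" "u = on_actions (c k) a"
      by (auto simp: Z0_def L_def)
    obtain xs where "src k = cube xs" using k(1) by (rule cubes_overE)
    then obtain e e' where "(e, [a], e') \<in> transitions (src k)"
      using regular_ts_usedD[OF cube_regular, of a xs] k(2) by auto
    then have "(on_states (c k) e, [u], on_states (c k) e') \<in> T"
      unfolding T_def
      by (intro UN_I[OF k(1)] CollectI exI[of _ e] exI[of _ "[a]"] exI[of _ e']) (simp add: k(3))
    then show "\<exists>\<alpha> \<beta>. (\<alpha>, [u], \<beta>) \<in> transitions Z0" by (auto simp: Z0_def)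
  next
    have "good_trans T"
      unfolding T_def
    proof (rule good_trans_Union, elim imageE)
      fix T' k assume k: "k \<in> ?K" "T' = {(on_states (c k) \<alpha>, map (on_actions (c k)) us, on_states (c k) \<beta>) |
        \<alpha> us \<beta>. (\<alpha>, us, \<beta>) \<in> transitions (src k)}"
      obtain xs where "src k = cube xs" using k(1) by (rule cubes_overE)
      then show "good_trans T'" unfolding k(2) using good_trans_image[OF regular_ts_good[OF cube_regular[of xs]]] by simp
    qed
    then show "good_trans (transitions Z0)" by (simp add: Z0_def)
  qed (simp add: Z0_def)
  have Z0_wts: "Z0 \<in> wts \<kappa>"
  proof -
    have "|states Z| <o \<kappa>" "|actions Z| <o \<kappa>" using Z by (simp_all add: wts_def)
    then have "|S| <o \<kappa>" "|L| <o \<kappa>"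
      using ordLeq_ordLess_trans card_of_mono1[OF SZ] card_of_mono1[OF LZ] by blast+
    then show ?thesis using regular_ts_weak[OF Z0_reg] by (simp add: wts_def Z0_def)
  qed
  define c0 where "c0 k = mk_map (src k) Z0 (on_states (c k)) (on_actions (c k))" for k
  have c0: "c0 k \<in> ts_hom (src k) Z0" if k: "k \<in> ?K" for k
    unfolding c0_def
  proof (rule mk_map_hom[OF ts_homD(3)[OF ck[OF k]] wtsD[OF Z0_wts]])
    fix a assume a: "a \<in> actions (src k)"
    then have "on_actions (c k) a \<in> L" using k by (auto simp: L_def)
    then show "label Z0 (on_actions (c k) a) = label (src k) a"
      using ts_homD(7)[OF ck[OF k] a] by (simp add: Z0_def)
  qed (use k in \<open>auto simp: Z0_def S_def L_def T_def\<close>)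
  have sub: "sub_ts Z0 Z" using SZ LZ TZ by (auto simp: sub_ts_def Z0_def)
  have inc: "ts_incl Z0 Z \<in> ts_hom Z0 Z" by (rule ts_incl_hom[OF sub wtsD[OF Z0_wts] wZ])
  have ic0: "ts_incl Z0 Z \<circ>\<^sub>t c0 k = c k" if k: "k \<in> ?K" for k
    by (rule ts_hom_eqI[OF ts_comp_hom[OF c0[OF k] inc] ck[OF k]])
       (use ts_homD(5,6)[OF c0[OF k]] in \<open>auto simp: c0_def\<close>)
  have "ts_cocone ?K src (cube_arrows X) Z0 c0"
    unfolding ts_cocone_def
  proof (intro conjI ballI allI impI)
    fix k h k' assume a: "(k, h, k') \<in> cube_arrows X"
    then have k: "k \<in> ?K" "k' \<in> ?K" "h \<in> ts_hom (src k) (src k')" by (auto simp: cube_arrows_def)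
    have eq: "c k' \<circ>\<^sub>t h = c k" using c a by (auto simp: ts_cocone_def)
    show "c0 k' \<circ>\<^sub>t h = c0 k"
      by (rule ts_hom_eqI[OF ts_comp_hom[OF k(3) c0[OF k(2)]] c0[OF k(1)]])
         (use ts_homD[OF k(3)] in \<open>auto simp: c0_def eq[symmetric]\<close>)
  qed (use c0 in blast)
  then obtain g0 where g0: "g0 \<in> ts_hom Z Z0" "\<And>k. k \<in> ?K \<Longrightarrow> g0 \<circ>\<^sub>t c k = c0 k"
    using univ[OF Z0_wts] by blast
  \<comment> \<open>Both sides carry the colimit cocone to itself, hence agree. Consequently
    \<open>g0\<close> is the identity on elements, and the legs cover \<open>Z\<close>.\<close>
  have "ts_incl Z0 Z \<circ>\<^sub>t g0 = ts_id Z"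
  proof -
    have "ts_incl Z0 Z \<circ>\<^sub>t g0 \<circ>\<^sub>t c k = c k" if "k \<in> ?K" for k
      using ts_comp_assoc[OF ck[OF that] g0(1) inc] g0(2)[OF that] ic0[OF that] by simp
    moreover have "ts_id Z \<circ>\<^sub>t c k = c k" if "k \<in> ?K" for k by (rule ts_comp_id(2)[OF ck[OF that]])
    ultimately show ?thesis
      using univ[OF Z c] ts_comp_hom[OF g0(1) inc] ts_id_hom[OF wZ] by blast
  qed
  then have gs: "on_states g0 s = s" if "s \<in> states Z" for s
    using arg_cong[of _ _ "\<lambda>f. on_states f s"] that ts_homD[OF g0(1)]
    by (metis id_apply mk_map_simps(3) ts_comp_simps(3) ts_id_mk)
  have ga: "on_actions g0 a = a" if "a \<in> actions Z" for a
    using arg_cong[OF \<open>ts_incl Z0 Z \<circ>\<^sub>t g0 = ts_id Z\<close>, of "\<lambda>f. on_actions f a"] that ts_homD[OF g0(1)]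
    by (simp add: ts_id_mk)
  have "states Z \<subseteq> S" "actions Z \<subseteq> L"
    using ts_homD(5,6)[OF g0(1)] gs ga by (auto simp: Z0_def subset_iff)
  moreover have "transitions Z \<subseteq> T"
  proof
    fix t assume t: "t \<in> transitions Z"
    obtain \<alpha> us \<beta> where [simp]: "t = (\<alpha>, us, \<beta>)" by (cases t)
    note tt = weak_ts_transD[OF wZ, of \<alpha> us \<beta>]
    have "map (on_actions g0) us = us" using ga tt t by (intro map_idI) auto
    then show "t \<in> T" using ts_homD(8)[OF g0(1), of \<alpha> us \<beta>] t gs tt by (simp add: Z0_def)
  qed
  ultimately have eq: "states Z = S" "actions Z = L" "transitions Z = T" using SZ LZ TZ by auto
  have "label Z \<in> extensional L" using wZ eq by (simp add: weak_ts_def)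
  then have "Z = Z0" using eq by (auto simp: Z0_def intro!: ts.equality extensional_restrict[symmetric])
  then have Z_rts: "Z \<in> rts \<kappa>" using Z Z0_reg by (simp add: rts_def)
  show ?thesis
  proof (rule that[OF \<pi> \<pi>c Z_rts])
    have "s \<in> on_states \<pi> ` states Z" if s: "s \<in> states X" for s
    proof -
      have k: "vertex_map X s \<in> ?K" by (rule cubes_overI[OF vertex_map_hom[OF w(2) s]])
      have e: "[] \<in> states (src (vertex_map X s))" by (simp add: cube_Nil)
      show ?thesis using \<pi>s[OF k e] ts_homD(5)[OF ck[OF k] e] by (metis image_eqI vertex_map_simps(1))
    qed
    then show "bij_betw (on_states \<pi>) (states Z) (states X)"
      using inj eq d\<pi>(5) by (auto simp: bij_betw_def)
  next
    fix \<alpha> us \<beta> assume t: "(\<alpha>, us, \<beta>) \<in> transitions X"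
    let ?xs = "map (label X) us" and ?n = "length us"
    \<comment> \<open>The transition is the long diagonal of a cube over \<open>X\<close>; the leg
      at this cube carries the diagonal to the lift in \<open>Z\<close>.\<close>
    obtain k where k: "k \<in> ts_hom (cube ?xs) X"
      "on_states k (replicate ?n 0) = \<alpha>" "on_states k (replicate ?n 1) = \<beta>"
      "\<And>i. i < ?n \<Longrightarrow> on_actions k (label X (us ! i), i) = us ! i"
      by (rule cube_fill[OF w(1) t]) blast
    have kK: "k \<in> ?K" by (rule cubes_overI[OF k(1)])
    have sk: "src k = cube ?xs" by (rule ts_homD(1)[OF k(1)])
    have "?xs \<noteq> []" using weak_ts_transD(2)[OF w(2) t] by simp
    from cube_top[OF this]
    have top: "(replicate ?n 0, map (cube_act ?xs) [0..<?n], replicate ?n 1) \<in> transitions (src k)"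
      by (simp add: sk)
    note tt = weak_ts_transD[OF cube_weak top[unfolded sk], folded sk]
    have "map (on_actions k) (map (cube_act ?xs) [0..<?n]) = us"
      by (rule nth_equalityI) (use k(4) in auto)
    moreover have "map (on_actions \<pi>) (map (on_actions (c k)) (map (cube_act ?xs) [0..<?n])) =
        map (on_actions k) (map (cube_act ?xs) [0..<?n])"
      using \<pi>a[OF kK] tt(3) by (auto simp del: set_upt)
    ultimately show "trans_image (on_states \<pi>) (on_actions \<pi>) (transitions Z) \<alpha> us \<beta>"
      using ts_homD(8)[OF ck[OF kK] top] \<pi>s[OF kK tt(1)] \<pi>s[OF kK tt(4)] k(2,3)
      by (intro exI conjI) (assumption, simp_all only:)
  qed
qed

lemma (in p_localizer) W_if_Cub:
  assumes f: "f \<in> rts_maps \<kappa>" and g: "is_Cub_map \<kappa> f g" "g \<in> W"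
  shows "f \<in> W"
proof -
  note df = rts_mapsD[OF f]
  obtain c d where c: "is_Cub \<kappa> (src f) (src g) c" and d: "is_Cub \<kappa> (tgt f) (tgt g) d"
    and gh: "g \<in> ts_hom (src g) (tgt g)"
    and gc: "\<And>k. k \<in> cubes_over (src f) \<Longrightarrow> g \<circ>\<^sub>t c k = d (f \<circ>\<^sub>t k)"
    using g(1) unfolding is_Cub_map_def by blast
  obtain \<pi> where p: "\<pi> \<in> ts_hom (src g) (src f)" "\<And>k. k \<in> cubes_over (src f) \<Longrightarrow> \<pi> \<circ>\<^sub>t c k = k"
    "src g \<in> rts \<kappa>" "bij_betw (on_states \<pi>) (states (src g)) (states (src f))"
    "\<And>\<alpha> us \<beta>. (\<alpha>, us, \<beta>) \<in> transitions (src f) \<Longrightarrow> trans_image (on_states \<pi>) (on_actions \<pi>) (transitions (src g)) \<alpha> us \<beta>"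
    by (rule Cub_counit[OF df(4) c]) blast
  obtain \<rho> where q: "\<rho> \<in> ts_hom (tgt g) (tgt f)" "\<And>k. k \<in> cubes_over (tgt f) \<Longrightarrow> \<rho> \<circ>\<^sub>t d k = k"
    "tgt g \<in> rts \<kappa>" "bij_betw (on_states \<rho>) (states (tgt g)) (states (tgt f))"
    "\<And>\<alpha> us \<beta>. (\<alpha>, us, \<beta>) \<in> transitions (tgt f) \<Longrightarrow> trans_image (on_states \<rho>) (on_actions \<rho>) (transitions (tgt g)) \<alpha> us \<beta>"
    by (rule Cub_counit[OF df(5) d]) blast
  note dp = ts_homD[OF p(1)] and dq = ts_homD[OF q(1)]
  have pW: "\<pi> \<in> W"
    by (rule W_if_transitions_lift[OF rts_mapsI[OF p(1,3) df(4)]]) (use p(4,5) dp(1,2) in simp_all)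
  have qW: "\<rho> \<in> W"
    by (rule W_if_transitions_lift[OF rts_mapsI[OF q(1,3) df(5)]]) (use q(4,5) dq(1,2) in simp_all)
  note cc = is_CubD(2)[OF c] and univ = is_CubD(3)[OF c]
  have ck: "c k \<in> ts_hom (src k) (src g)" if "k \<in> cubes_over (src f)" for k
    using cc that by (auto simp: ts_cocone_def)
  \<comment> \<open>Naturality of the counit follows from uniqueness of mediating maps: after the
    leg at \<open>k\<close> both composites become \<open>f \<circ>\<^sub>t k\<close>.\<close>
  have "\<rho> \<circ>\<^sub>t g = f \<circ>\<^sub>t \<pi>"
  proof -
    have "\<rho> \<circ>\<^sub>t g \<circ>\<^sub>t c k = f \<circ>\<^sub>t k" if "k \<in> cubes_over (src f)" for k
      using ts_comp_assoc[OF ck[OF that] gh q(1)] gc[OF that] q(2)[OF cubes_over_comp[OF that df(1)]]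
      by simp
    moreover have "f \<circ>\<^sub>t \<pi> \<circ>\<^sub>t c k = f \<circ>\<^sub>t k" if "k \<in> cubes_over (src f)" for k
      using ts_comp_assoc[OF ck[OF that] p(1) df(1)] p(2)[OF that] by simp
    ultimately show ?thesis
      using univ[OF rts_wts[OF df(5)] cocone_postcomp[OF cube_cocone_id df(1)]]
        ts_comp_hom[OF gh q(1)] ts_comp_hom[OF p(1) df(1)] by blast
  qed
  then have "f \<circ>\<^sub>t \<pi> \<in> W" using W_comp[OF g(2) qW] dq(1) by simp
  then show ?thesis using W_cancel_right[OF f _ pW] dp(2) by simp
qed

section \<open>Cubification of the maps \<open>p_map x\<close>\<close>

lemma ts_isoD:
  assumes "ts_iso f"
  shows "f \<in> ts_hom (src f) (tgt f)" "bij_betw (on_states f) (states (src f)) (states (tgt f))"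
    "inj_on (on_actions f) (actions (src f))"
    "\<And>\<alpha> us \<beta>. (\<alpha>, us, \<beta>) \<in> transitions (tgt f) \<Longrightarrow> trans_image (on_states f) (on_actions f) (transitions (src f)) \<alpha> us \<beta>"
proof -
  obtain g where f: "f \<in> ts_hom (src f) (tgt f)" and g: "g \<in> ts_hom (tgt f) (src f)"
    and gf: "g \<circ>\<^sub>t f = ts_id (src f)" and fg: "f \<circ>\<^sub>t g = ts_id (tgt f)"
    using assms unfolding ts_iso_def by blast
  note df = ts_homD[OF f] and dg = ts_homD[OF g]
  have gfs: "on_states g (on_states f s) = s" if "s \<in> states (src f)" for s
    using arg_cong[OF gf, of "\<lambda>f. on_states f s"] that by (simp add: ts_id_mk)
  have gfa: "on_actions g (on_actions f s) = s" if "s \<in> actions (src f)" for s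
    using arg_cong[OF gf, of "\<lambda>f. on_actions f s"] that by (simp add: ts_id_mk)
  have fgs: "on_states f (on_states g s) = s" if "s \<in> states (tgt f)" for s
    using arg_cong[OF fg, of "\<lambda>f. on_states f s"] that dg(1) by (simp add: ts_id_mk)
  have fga: "on_actions f (on_actions g s) = s" if "s \<in> actions (tgt f)" for s
    using arg_cong[OF fg, of "\<lambda>f. on_actions f s"] that dg(1) by (simp add: ts_id_mk)
  show "f \<in> ts_hom (src f) (tgt f)" by (rule f)
  show "bij_betw (on_states f) (states (src f)) (states (tgt f))"
    by (rule bij_betwI[of _ _ _ "on_states g"]) (use df(5) dg(5) gfs fgs in auto)
  show "inj_on (on_actions f) (actions (src f))" using gfa by (metis inj_onI)
  fix \<alpha> us \<beta> assume t: "(\<alpha>, us, \<beta>) \<in> transitions (tgt f)"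
  note tt = weak_ts_transD[OF df(4) t]
  have "us = map (on_actions f) (map (on_actions g) us)"
    using fga tt(3) by (auto intro!: map_idI[symmetric])
  then show "trans_image (on_states f) (on_actions f) (transitions (src f)) \<alpha> us \<beta>"
    using dg(8)[OF t] fgs[OF tt(1)] fgs[OF tt(4)] by metis
qed

text \<open>Conditions under which the cubes over \<open>Y\<close> are the vertices and edges of \<open>X\<close>, where \<open>X\<close> is a
  disjoint union of isolated vertices and edges with pairwise different actions.\<close>

locale edge_cover =
  fixes f :: "('s, 'a, 't, 'b, 'l) ts_map"
  assumes bij: "bij_betw (on_states f) (states (src f)) (states (tgt f))"
    and used: "\<And>u. u \<in> actions (src f) \<Longrightarrow> \<exists>\<alpha> \<beta>. (\<alpha>, [u], \<beta>) \<in> transitions (src f)"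
    and length: "\<And>\<alpha> us \<beta>. (\<alpha>, us, \<beta>) \<in> transitions (src f) \<Longrightarrow> length us = 1"
    and unique_edge: "\<And>\<alpha> \<beta> \<alpha>' \<beta>' u. (\<alpha>, [u], \<beta>) \<in> transitions (src f) \<Longrightarrow>
      (\<alpha>', [u], \<beta>') \<in> transitions (src f) \<Longrightarrow> \<alpha> = \<alpha>' \<and> \<beta> = \<beta>'"
    and unique_action: "\<And>\<alpha> \<beta> u u'. (\<alpha>, [u], \<beta>) \<in> transitions (src f) \<Longrightarrow>
      (\<alpha>, [u'], \<beta>) \<in> transitions (src f) \<Longrightarrow> u = u'"
    and lift: "\<And>\<gamma> us \<delta>. (\<gamma>, us, \<delta>) \<in> transitions (tgt f) \<Longrightarrow>
      \<exists>\<alpha> u \<beta>. (\<alpha>, [u], \<beta>) \<in> transitions (src f) \<and>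
        \<gamma> = on_states f \<alpha> \<and> us = [on_actions f u] \<and> \<delta> = on_states f \<beta>"

lemmas edge_coverD =
  edge_cover.bij edge_cover.used edge_cover.length edge_cover.unique_edge edge_cover.unique_action
  edge_cover.lift

text \<open>A 0-cube lifts by bijectivity on states, a 1-cube because transitions of
  \<open>Y\<close> lift to edges, and there are no larger cubes over \<open>Y\<close>. Uniqueness
  holds because the end points of an edge of \<open>X\<close> determine its action.\<close>

lemma edge_cover_lift:
  assumes f: "f \<in> ts_hom X Y" and e: "edge_cover f" and k: "k \<in> ts_hom (cube xs) Y"
  shows "\<exists>!k'. k' \<in> ts_hom (cube xs) X \<and> f \<circ>\<^sub>t k' = k"
proof (rule ex_ex1I)
  note d = ts_homD[OF f] and dk = ts_homD[OF k]
  note e' = edge_coverD[OF e, unfolded d(1,2)]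
  show "\<exists>k'. k' \<in> ts_hom (cube xs) X \<and> f \<circ>\<^sub>t k' = k"
  proof (cases "length xs")
    case 0
    then have xs: "xs = []" by simp
    obtain s where s: "s \<in> states X" "on_states f s = on_states k []"
      using bij_betw_imp_surj_on[OF e'(1)] dk(5)[of "[]"] by (force simp: xs cube_Nil)
    have h: "vertex_map X s \<in> ts_hom (cube xs) X" unfolding xs by (rule vertex_map_hom[OF d(3) s(1)])
    have "f \<circ>\<^sub>t vertex_map X s = k"
      by (rule ts_hom_eqI[OF ts_comp_hom[OF h f] k]) (use s in \<open>auto simp: xs cube_Nil\<close>)
    then show ?thesis using h by blast
  next
    case (Suc n)
    then have "xs \<noteq> []" by auto
    from e'(6)[OF dk(8)[OF cube_top[OF this]]]
    obtain \<alpha> u \<beta> where t: "(\<alpha>, [u], \<beta>) \<in> transitions X"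
      "on_states k (replicate (length xs) 0) = on_states f \<alpha>"
      "map (on_actions k) (map (cube_act xs) [0..<length xs]) = [on_actions f u]"
      "on_states k (replicate (length xs) 1) = on_states f \<beta>"
      by (elim exE conjE) (rule that)
    \<comment> \<open>The long diagonal has as many actions as the cube has dimensions, and it lifts
      to a single edge.\<close>
    have "length xs = 1" using arg_cong[OF t(3), of length] by simp
    then obtain x where xs: "xs = [x]" by (auto simp: length_Suc_conv)
    have u: "on_actions k (x, 0) = on_actions f u" using t(3) by (simp add: xs)
    have "u \<in> actions X" using weak_ts_transD(3)[OF d(3) t(1)] by simp
    then have "label X u = x"
      using d(7)[of u] dk(7)[of "(x, 0)"] u by (simp add: xs cube_single cube_label)
    then have h: "edge_map X \<alpha> u \<beta> \<in> ts_hom (cube xs) X" and l: "label X u = x"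
      using edge_map_hom[OF d(3) t(1)] by (simp_all add: xs)
    have "f \<circ>\<^sub>t edge_map X \<alpha> u \<beta> = k"
    proof (rule ts_hom_eqI[OF ts_comp_hom[OF h f] k])
      show "on_states (f \<circ>\<^sub>t edge_map X \<alpha> u \<beta>) s = on_states k s" if "s \<in> states (cube xs)" for s
        using that t(2,4) l by (auto simp: xs cube_single)
      show "on_actions (f \<circ>\<^sub>t edge_map X \<alpha> u \<beta>) s = on_actions k s" if "s \<in> actions (cube xs)" for s
        using that u l by (auto simp: xs cube_single)
    qed
    then show ?thesis using h by blast
  qed
next
  note d = ts_homD[OF f]
  note e' = edge_coverD[OF e, unfolded d(1,2)]
  fix k1 k2
  assume "k1 \<in> ts_hom (cube xs) X \<and> f \<circ>\<^sub>t k1 = k" "k2 \<in> ts_hom (cube xs) X \<and> f \<circ>\<^sub>t k2 = k"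
  then have k1: "k1 \<in> ts_hom (cube xs) X" and k2: "k2 \<in> ts_hom (cube xs) X" and eq: "f \<circ>\<^sub>t k1 = f \<circ>\<^sub>t k2"
    by auto
  note d1 = ts_homD[OF k1] and d2 = ts_homD[OF k2]
  have s: "on_states k1 v = on_states k2 v" if v: "v \<in> states (cube xs)" for v
  proof -
    have "on_states f (on_states k1 v) = on_states f (on_states k2 v)"
      using arg_cong[OF eq, of "\<lambda>f. on_states f v"] v d1(1) d2(1) by simp
    then show ?thesis using bij_betw_imp_inj_on[OF e'(1)] d1(5)[OF v] d2(5)[OF v] by (auto dest: inj_onD)
  qed
  show "k1 = k2"
  proof (rule ts_hom_eqI[OF k1 k2 s])
    fix a assume "a \<in> actions (cube xs)"
    then obtain v v' where t: "(v, [a], v') \<in> transitions (cube xs)"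
      using regular_ts_usedD[OF cube_regular] by blast
    note tt = weak_ts_transD[OF cube_weak t]
    show "on_actions k1 a = on_actions k2 a"
      using e'(5) d1(8)[OF t] d2(8)[OF t] s[OF tt(1)] s[OF tt(4)] by simp
  qed
qed

text \<open>By unique lifting, cubes over \<open>Y\<close> and cubes over \<open>X\<close> form the
  same diagram. Its colimit is \<open>X\<close>, since states correspond to 0-cubes and each action
  belongs to exactly one edge. The second conjunct records the legs, as needed to evaluate the
  functor on maps.\<close>

lemma is_Cub_edge_cover:
  fixes X Y :: "('u, 'u, 'l) ts"
  assumes X: "X \<in> wts \<kappa>" and f: "f \<in> ts_hom X Y" and e: "edge_cover f"
  shows "\<exists>c. is_Cub \<kappa> Y X c \<and> (\<forall>k \<in> cubes_over X. c (f \<circ>\<^sub>t k) = k)"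
proof -
  note d = ts_homD[OF f]
  note e' = edge_coverD[OF e, unfolded d(1,2)]
  define c :: "(nat list, 'l \<times> nat, 'u, 'u, 'l) ts_map \<Rightarrow> (nat list, 'l \<times> nat, 'u, 'u, 'l) ts_map"
    where "c = (\<lambda>k. THE k'. k' \<in> ts_hom (src k) X \<and> f \<circ>\<^sub>t k' = k)"
  have c: "c k \<in> ts_hom (cube xs) X" "f \<circ>\<^sub>t c k = k" if k: "k \<in> ts_hom (cube xs) Y" for k xs
    using theI'[OF edge_cover_lift[OF f e k]] ts_homD(1)[OF k] unfolding c_def by auto
  have cf: "c (f \<circ>\<^sub>t k) = k" if k: "k \<in> ts_hom (cube xs) X" for k xs
    using edge_cover_lift[OF f e ts_comp_hom[OF k f]] c[OF ts_comp_hom[OF k f]] k by blast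
  have cK: "c k \<in> cubes_over X" "f \<circ>\<^sub>t c k = k" "c k \<in> ts_hom (src k) X" if "k \<in> cubes_over Y" for k
    using that c ts_homD(1) by (fastforce elim!: cubes_overE intro: cubes_overI)+
  have "ts_cocone (cubes_over Y) src (cube_arrows Y) X c"
    unfolding ts_cocone_def
  proof (intro conjI ballI allI impI)
    fix k h k' assume "(k, h, k') \<in> cube_arrows Y"
    then have k: "k \<in> cubes_over Y" "k' \<in> cubes_over Y" "h \<in> ts_hom (src k) (src k')" "k' \<circ>\<^sub>t h = k"
      by (auto simp: cube_arrows_def)
    obtain xs where xs: "src k = cube xs" using k(1) by (rule cubes_overE)
    have h: "c k' \<circ>\<^sub>t h \<in> ts_hom (cube xs) X"
      using ts_comp_hom[OF k(3) cK(3)[OF k(2)]] xs by simp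
    have "f \<circ>\<^sub>t (c k' \<circ>\<^sub>t h) = k"
      using ts_comp_assoc[OF k(3) cK(3)[OF k(2)] f] cK(2)[OF k(2)] k(4) by simp
    then show "c k' \<circ>\<^sub>t h = c k" using cf[OF h] by simp
  qed (use cK in blast)
  moreover have "\<exists>!g. g \<in> ts_hom X Z \<and> (\<forall>k \<in> cubes_over Y. g \<circ>\<^sub>t c k = c' k)"
    if Z: "Z \<in> wts \<kappa>" and c': "ts_cocone (cubes_over Y) src (cube_arrows Y) Z c'" for Z c'
  proof -
    have c'h: "c' (f \<circ>\<^sub>t k) \<in> ts_hom (cube xs) Z" if k: "k \<in> ts_hom (cube xs) X" for k xs
      using c' cubes_overI[OF ts_comp_hom[OF k f]] ts_homD(1)[OF k] by (force simp: ts_cocone_def)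
    have nat: "c' (f \<circ>\<^sub>t (k \<circ>\<^sub>t h)) = c' (f \<circ>\<^sub>t k) \<circ>\<^sub>t h"
      if k: "k \<in> ts_hom (cube xs) X" and h: "h \<in> ts_hom (cube ys) (cube xs)" for k h xs ys
      using cocone_natural[OF c' ts_comp_hom[OF k f] h] ts_comp_assoc[OF h k f] by simp
    define gs where "gs s = on_states (c' (f \<circ>\<^sub>t vertex_map X s)) []" for s
    \<comment> \<open>By \<open>unique_edge\<close> there is a single candidate, so
      \<open>ga\<close> reads off the image of \<open>u\<close> from the only edge that carries
      it.\<close>
    define edge where "edge u = (SOME k. \<exists>\<alpha> \<beta>. (\<alpha>, [u], \<beta>) \<in> transitions X \<and> k = edge_map X \<alpha> u \<beta>)" for u
    define ga where "ga u = on_actions (c' (f \<circ>\<^sub>t edge u)) (label X u, 0)" for u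
    have edge: "edge u = edge_map X \<alpha> u \<beta>" if t: "(\<alpha>, [u], \<beta>) \<in> transitions X" for \<alpha> u \<beta>
      unfolding edge_def by (rule some_equality) (use t e'(4) in blast)+
    \<comment> \<open>A leg at any cube is determined by the legs at 0-cubes and, for actions, at
      1-cubes: restrict the cube to a vertex, respectively to an edge carrying the action, and use
      naturality.\<close>
    have st: "on_states (c' (f \<circ>\<^sub>t k)) v = gs (on_states k v)"
      if k: "k \<in> ts_hom (cube xs) X" and v: "v \<in> states (cube xs)" for k xs v
    proof -
      have h: "vertex_map (cube xs) v \<in> ts_hom (cube []) (cube xs)" by (rule vertex_map_hom[OF cube_weak v])
      have "k \<circ>\<^sub>t vertex_map (cube xs) v = vertex_map X (on_states k v)"
        using cube_Nil_homI[OF ts_comp_hom[OF h k]] by (simp add: cube_Nil)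
      then have "c' (f \<circ>\<^sub>t vertex_map X (on_states k v)) = c' (f \<circ>\<^sub>t k) \<circ>\<^sub>t vertex_map (cube xs) v"
        using nat[OF k h] by simp
      then show ?thesis by (simp add: gs_def cube_Nil)
    qed
    have ac: "on_actions (c' (f \<circ>\<^sub>t k)) a = ga (on_actions k a)"
      if k: "k \<in> ts_hom (cube xs) X" and a: "a \<in> actions (cube xs)" for k xs a
    proof -
      note dk = ts_homD[OF k]
      obtain v v' where t: "(v, [a], v') \<in> transitions (cube xs)"
        using regular_ts_usedD[OF cube_regular a] by blast
      note tt = weak_ts_transD[OF cube_weak t]
      let ?u = "on_actions k a" and ?h = "edge_map (cube xs) v a v'"
      have t': "(on_states k v, [?u], on_states k v') \<in> transitions X" using dk(8)[OF t] by simp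
      have l: "label X ?u = label (cube xs) a" by (rule dk(7)[OF a])
      have h: "?h \<in> ts_hom (cube [label X ?u]) (cube xs)"
        unfolding l by (rule edge_map_hom[OF cube_weak t])
      have "k \<circ>\<^sub>t ?h = edge_map X (on_states k v) ?u (on_states k v')"
      proof (rule ts_hom_eqI[OF ts_comp_hom[OF h k] edge_map_hom[OF dk(4) t']])
        show "on_states (k \<circ>\<^sub>t ?h) s = on_states (edge_map X (on_states k v) ?u (on_states k v')) s"
          if "s \<in> states (cube [label X ?u])" for s
          using that l by (auto simp: cube_single)
        show "on_actions (k \<circ>\<^sub>t ?h) s = on_actions (edge_map X (on_states k v) ?u (on_states k v')) s"
          if "s \<in> actions (cube [label X ?u])" for s
        proof -
          have s: "s = (label X ?u, 0)" using that by (simp add: cube_single)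
          have "s \<in> actions (src ?h)" unfolding ts_homD(1)[OF h] by (rule that)
          then have "on_actions (k \<circ>\<^sub>t ?h) s = on_actions k (on_actions ?h s)" by (rule ts_comp_simps(4))
          also have "on_actions ?h s = a" by (simp add: s l)
          finally show ?thesis by (simp add: s)
        qed
      qed
      then have "c' (f \<circ>\<^sub>t edge ?u) = c' (f \<circ>\<^sub>t k) \<circ>\<^sub>t ?h" using nat[OF k h] edge[OF t'] by simp
      then have "ga ?u = on_actions (c' (f \<circ>\<^sub>t k)) (on_actions ?h (label X ?u, 0))"
        using ts_homD(1)[OF h] by (simp add: ga_def cube_single)
      then show ?thesis by (simp add: l)
    qed
    define g where "g = mk_map X Z gs ga"
    have g: "g \<in> ts_hom X Z"
      unfolding g_def
    proof (rule mk_map_hom[OF d(3) wtsD[OF Z]])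
      fix s assume "s \<in> states X"
      then show "gs s \<in> states Z"
        unfolding gs_def using ts_homD(5)[OF c'h[OF vertex_map_hom[OF d(3)]]] by (simp add: cube_Nil)
    next
      fix u assume "u \<in> actions X"
      then obtain \<alpha> \<beta> where t: "(\<alpha>, [u], \<beta>) \<in> transitions X" using e'(2) by blast
      note h = ts_homD[OF c'h[OF edge_map_hom[OF d(3) t]]]
      have a: "(label X u, 0) \<in> actions (cube [label X u])" by (simp add: cube_single)
      show "ga u \<in> actions Z" "label Z (ga u) = label X u"
        using h(6)[OF a] h(7)[OF a] edge[OF t] by (simp_all add: ga_def cube_label cube_single)
    next
      fix \<alpha> us \<beta> assume t: "(\<alpha>, us, \<beta>) \<in> transitions X"
      then obtain u where us: "us = [u]" using e'(3) by (force simp: length_Suc_conv)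
      have k: "edge_map X \<alpha> u \<beta> \<in> ts_hom (cube [label X u]) X"
        by (rule edge_map_hom[OF d(3)]) (use t us in simp)
      show "(gs \<alpha>, map ga us, gs \<beta>) \<in> transitions Z"
        using ts_homD(8)[OF c'h[OF k], of "[0]" "[(label X u, 0)]" "[1]"] st[OF k, of "[0]"]
          st[OF k, of "[1]"] ac[OF k, of "(label X u, 0)"]
        by (simp add: us cube_single)
    qed
    have gc: "g \<circ>\<^sub>t k = c' (f \<circ>\<^sub>t k)" if k: "k \<in> ts_hom (cube xs) X" for k xs
      by (rule ts_hom_eqI[OF ts_comp_hom[OF k g] c'h[OF k]])
         (use st[OF k] ac[OF k] ts_homD[OF k] in \<open>auto simp: g_def\<close>)
    show ?thesis
    proof (rule ex1I[of _ g])
      have "g \<circ>\<^sub>t c k = c' k" if "k \<in> cubes_over Y" for k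
        using that gc c by (metis cubes_overE)
      then show "g \<in> ts_hom X Z \<and> (\<forall>k \<in> cubes_over Y. g \<circ>\<^sub>t c k = c' k)" using g by blast
    next
      fix h assume h: "h \<in> ts_hom X Z \<and> (\<forall>k \<in> cubes_over Y. h \<circ>\<^sub>t c k = c' k)"
      have hc: "h \<circ>\<^sub>t k = g \<circ>\<^sub>t k" if k: "k \<in> ts_hom (cube xs) X" for k xs
      proof -
        have "h \<circ>\<^sub>t c (f \<circ>\<^sub>t k) = c' (f \<circ>\<^sub>t k)" using h cubes_overI[OF ts_comp_hom[OF k f]] by blast
        then show ?thesis using cf[OF k] gc[OF k] by simp
      qed
      show "h = g"
      proof (rule ts_hom_eqI[OF conjunct1[OF h] g])
        fix s assume s: "s \<in> states X"
        show "on_states h s = on_states g s"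
          using arg_cong[OF hc[OF vertex_map_hom[OF d(3) s]], of "\<lambda>f. on_states f []"]
          by (simp add: cube_Nil)
      next
        fix u assume "u \<in> actions X"
        then obtain \<alpha> \<beta> where t: "(\<alpha>, [u], \<beta>) \<in> transitions X" using e'(2) by blast
        show "on_actions h u = on_actions g u"
          using arg_cong[OF hc[OF edge_map_hom[OF d(3) t]], of "\<lambda>f. on_actions f (label X u, 0)"]
          by (simp add: cube_single)
      qed
    qed
  qed
  ultimately have "is_Cub \<kappa> Y X c" unfolding is_Cub_eq ts_colimit_def using X by blast
  moreover have "c (f \<circ>\<^sub>t k) = k" if "k \<in> cubes_over X" for k
    using that cf by (auto elim: cubes_overE)
  ultimately show ?thesis by blast
qed

text \<open>The conditions on the source are inherited by its identity, so the source is its own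
  cubification.\<close>

lemma edge_cover_id:
  assumes f: "f \<in> ts_hom X Y" and e: "edge_cover f"
  shows "edge_cover (ts_id X)"
proof -
  note d = ts_homD[OF f]
  note e' = edge_coverD[OF e, unfolded d(1,2)]
  have 6: "\<exists>\<alpha>' u \<beta>'. (\<alpha>', [u], \<beta>') \<in> transitions X \<and>
      \<alpha> = on_states (ts_id X) \<alpha>' \<and> us = [on_actions (ts_id X) u] \<and> \<beta> = on_states (ts_id X) \<beta>'"
    if t: "(\<alpha>, us, \<beta>) \<in> transitions X" for \<alpha> us \<beta>
  proof -
    obtain u where us: "us = [u]" using e'(3)[OF t] by (auto simp: length_Suc_conv)
    show ?thesis
      using t weak_ts_transD[OF d(3) t] unfolding us
      by (intro exI[of _ \<alpha>] exI[of _ u] exI[of _ \<beta>]) (simp add: ts_id_mk)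
  qed
  have "bij_betw (on_states (ts_id X)) (states X) (states X)"
    by (auto simp: bij_betw_def inj_on_def ts_id_mk image_iff)
  then show ?thesis
    unfolding edge_cover_def using e'(2-5) 6 by (simp add: ts_id_mk)
qed

text \<open>The conditions are visible on \<open>p_map x\<close> itself: two disjoint edges with
  different actions, and a target with no other transitions than their images. They are transported
  along the square of isomorphisms.\<close>

lemma edge_cover_p_map:
  assumes f: "f \<in> ts_hom X Y" and X: "regular_ts X" and iso: "arrow_iso f (p_map x)"
  shows "edge_cover f"
proof -
  let ?C = "ts_coprod (cube [x]) (cube [x])" and ?E = "double_transition x"
  note d = ts_homD[OF f]
  obtain a b where a: "ts_iso a" "src a = X" "tgt a = ?C" and b: "ts_iso b" "src b = Y" "tgt b = ?E"
    and sq: "b \<circ>\<^sub>t f = p_map x \<circ>\<^sub>t a"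
    using iso d(1,2) ts_homD(1,2)[OF p_map_hom[of x]] unfolding arrow_iso_def by metis
  note ia = ts_isoD[OF a(1), unfolded a(2,3)] and ib = ts_isoD[OF b(1), unfolded b(2,3)]
  note da = ts_homD[OF ia(1)] and db = ts_homD[OF ib(1)]
  have sqs: "on_states b (on_states f s) = on_states (p_map x) (on_states a s)" if "s \<in> states X" for s
    using arg_cong[OF sq, of "\<lambda>f. on_states f s"] that d(1) a(2) by simp
  have sqa: "on_actions b (on_actions f s) = on_actions (p_map x) (on_actions a s)" if "s \<in> actions X" for s
    using arg_cong[OF sq, of "\<lambda>f. on_actions f s"] that d(1) a(2) by simp
  have injb: "s = t" if "s \<in> states Y" "t \<in> states Y" "on_states b s = on_states b t" for s t
    using that bij_betw_imp_inj_on[OF ib(2)] by (auto dest: inj_onD)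
  have inja: "s = t" if "s \<in> states X" "t \<in> states X" "on_states a s = on_states a t" for s t
    using that bij_betw_imp_inj_on[OF ia(2)] by (auto dest: inj_onD)
  have p: "bij_betw (on_states (p_map x)) (states ?C) (states ?E)"
    by (auto simp: bij_betw_def inj_on_def p_map_mk coprod_edge_sel double_transition_sel)
  have ta: "(on_states a \<alpha>, us, on_states a \<beta>) = (Inl [0], [Inl (x, 0)], Inl [1]) \<or>
      (on_states a \<alpha>, us, on_states a \<beta>) = (Inr [0], [Inr (x, 0)], Inr [1])"
    if "(\<alpha>, us', \<beta>) \<in> transitions X" "us = map (on_actions a) us'" for \<alpha> us us' \<beta>
    using da(8)[OF that(1)] that(2) by (simp add: coprod_edge_sel)
  show ?thesis
    unfolding edge_cover_def d(1,2)
  proof (intro conjI allI impI ballI)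
    show "bij_betw (on_states f) (states X) (states Y)"
      unfolding bij_betw_def
    proof (intro conjI inj_onI subset_antisym subsetI)
      fix s t assume st: "s \<in> states X" "t \<in> states X" "on_states f s = on_states f t"
      then have "on_states (p_map x) (on_states a s) = on_states (p_map x) (on_states a t)"
        using sqs[OF st(1)] sqs[OF st(2)] by simp
      then have "on_states a s = on_states a t"
        using bij_betw_imp_inj_on[OF p] da(5) st by (auto dest: inj_onD)
      then show "s = t" using inja st by blast
    next
      fix y assume y: "y \<in> states Y"
      obtain z where z: "z \<in> states ?C" "on_states (p_map x) z = on_states b y"
        using bij_betw_imp_surj_on[OF p] db(5)[OF y] by force
      obtain s where s: "s \<in> states X" "on_states a s = z"
        using bij_betw_imp_surj_on[OF ia(2)] z(1) by force
      have "on_states b (on_states f s) = on_states b y" using sqs[OF s(1)] s z by simp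
      then have "on_states f s = y" by (intro injb d(5)[OF s(1)] y)
      then show "y \<in> on_states f ` states X" using s(1) by blast
    qed (use d in auto)
  next
    fix u assume "u \<in> actions X"
    then show "\<exists>\<alpha> \<beta>. (\<alpha>, [u], \<beta>) \<in> transitions X" using X by (simp add: regular_ts_def)
  next
    fix \<alpha> us \<beta> assume "(\<alpha>, us, \<beta>) \<in> transitions X"
    from ta[OF this refl] show "length us = 1" by auto
  next
    fix \<alpha> \<beta> \<alpha>' \<beta>' u assume t: "(\<alpha>, [u], \<beta>) \<in> transitions X" and t': "(\<alpha>', [u], \<beta>') \<in> transitions X"
    have "on_states a \<alpha> = on_states a \<alpha>'" "on_states a \<beta> = on_states a \<beta>'"
      using ta[OF t refl] ta[OF t' refl] by auto
    then show "\<alpha> = \<alpha>'" "\<beta> = \<beta>'"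
      using inja weak_ts_transD(1,4)[OF d(3) t] weak_ts_transD(1,4)[OF d(3) t'] by blast+
  next
    fix \<alpha> \<beta> u u' assume t: "(\<alpha>, [u], \<beta>) \<in> transitions X" and t': "(\<alpha>, [u'], \<beta>) \<in> transitions X"
    have "on_actions a u = on_actions a u'"
      using ta[OF t refl] ta[OF t' refl] by auto
    then show "u = u'"
      using ia(3) weak_ts_transD(3)[OF d(3) t] weak_ts_transD(3)[OF d(3) t'] by (auto dest: inj_onD)
  next
    fix \<gamma> vs \<delta> assume t: "(\<gamma>, vs, \<delta>) \<in> transitions Y"
    note tt = weak_ts_transD[OF d(4) t]
    have "\<exists>z v z'. (z, [v], z') \<in> transitions ?C \<and> on_states (p_map x) z = on_states b \<gamma> \<and>
        map (on_actions b) vs = [on_actions (p_map x) v] \<and> on_states (p_map x) z' = on_states b \<delta>"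
    proof -
      have v: "on_states (p_map x) (Inl [0]) = [1]" "on_states (p_map x) (Inl [1]) = [2]"
        "on_states (p_map x) (Inr [0]) = [3]" "on_states (p_map x) (Inr [1]) = [4]"
        "on_actions (p_map x) (Inl (x, 0)) = (x, 0)" "on_actions (p_map x) (Inr (x, 0)) = (x, 0)"
        by (simp_all add: p_map_mk coprod_edge_sel)
      consider "(on_states b \<gamma>, map (on_actions b) vs, on_states b \<delta>) = ([1], [(x, 0)], [2])"
        | "(on_states b \<gamma>, map (on_actions b) vs, on_states b \<delta>) = ([3], [(x, 0)], [4])"
        using db(8)[OF t] by (auto simp: double_transition_sel)
      then show ?thesis
      proof cases
        case 1
        then show ?thesis
          by (intro exI[of _ "Inl [0]"] exI[of _ "Inl (x, 0)"] exI[of _ "Inl [1]"])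
            (use v in \<open>simp add: coprod_edge_sel\<close>)
      next
        case 2
        then show ?thesis
          by (intro exI[of _ "Inr [0]"] exI[of _ "Inr (x, 0)"] exI[of _ "Inr [1]"])
            (use v in \<open>simp add: coprod_edge_sel\<close>)
      qed
    qed
    then obtain z v z' where z: "(z, [v], z') \<in> transitions ?C" "on_states (p_map x) z = on_states b \<gamma>"
        "map (on_actions b) vs = [on_actions (p_map x) v]" "on_states (p_map x) z' = on_states b \<delta>"
      by (elim exE conjE) (rule that)
    obtain \<alpha> us \<beta> where u: "(\<alpha>, us, \<beta>) \<in> transitions X" "z = on_states a \<alpha>" "[v] = map (on_actions a) us"
      "z' = on_states a \<beta>"
      using ia(4)[OF z(1)] by (elim exE conjE) (rule that)
    from u(3) obtain w where w: "us = [w]" "v = on_actions a w" by auto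
    from z(3) obtain y where y: "vs = [y]" "on_actions b y = on_actions (p_map x) v" by auto
    note uu = weak_ts_transD[OF d(3) u(1)]
    have wX: "w \<in> actions X" using uu(3) w by simp
    have "on_states f \<alpha> = \<gamma>" by (rule injb[OF d(5)[OF uu(1)] tt(1)]) (use sqs[OF uu(1)] u z in simp)
    moreover have "on_states f \<beta> = \<delta>" by (rule injb[OF d(5)[OF uu(4)] tt(4)]) (use sqs[OF uu(4)] u z in simp)
    moreover have "on_actions f w = y"
      by (rule inj_onD[OF ib(3)]) (use sqa[OF wX] w y d(6)[OF wX] tt(3) in auto)
    ultimately show "\<exists>\<alpha>' u \<beta>'. (\<alpha>', [u], \<beta>') \<in> transitions X \<and>
        \<gamma> = on_states f \<alpha>' \<and> vs = [on_actions f u] \<and> \<delta> = on_states f \<beta>'"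
      using u(1) w y by blast
  qed
qed

text \<open>The double transition has cubes of dimension at most 1 only, so cubification separates
  its two edges and returns the sum of two 1-cubes. One object thus serves as the value at both
  ends, and the induced map is the identity.\<close>

lemma p_maps_Cub:
  fixes f :: "('u, 'u, 'u, 'u, 'l) ts_map"
  assumes f: "f \<in> p_maps \<kappa>"
  shows "is_Cub_map \<kappa> f (ts_id (src f))"
proof -
  obtain x where f': "f \<in> rts_maps \<kappa>" and iso: "arrow_iso f (p_map x)"
    using f by (auto simp: p_maps_def)
  note df = rts_mapsD[OF f']
  let ?X = "src f"
  have wX: "weak_ts ?X" by (rule regular_ts_weak[OF df(2)])
  note id = ts_id_hom[OF wX]
  have e: "edge_cover f" by (rule edge_cover_p_map[OF df(1,2) iso])
  obtain d where d: "is_Cub \<kappa> (tgt f) ?X d" "\<And>k. k \<in> cubes_over ?X \<Longrightarrow> d (f \<circ>\<^sub>t k) = k"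
    using is_Cub_edge_cover[OF rts_wts[OF df(4)] df(1) e] by blast
  obtain c where c: "is_Cub \<kappa> ?X ?X c" "\<And>k. k \<in> cubes_over ?X \<Longrightarrow> c (ts_id ?X \<circ>\<^sub>t k) = k"
    using is_Cub_edge_cover[OF rts_wts[OF df(4)] id edge_cover_id[OF df(1) e]] by blast
  have "ts_id ?X \<circ>\<^sub>t c k = d (f \<circ>\<^sub>t k)" if k: "k \<in> cubes_over ?X" for k
    using c(2)[OF k] d(2)[OF k] ts_comp_id(2)[OF cubes_over_hom[OF k]] by simp
  then show ?thesis
    unfolding is_Cub_map_def using id c(1) d(1) by (auto simp: ts_id_mk)
qed

theorem theorem6p5:
  fixes \<kappa> :: "'k rel"
  assumes "Card_order \<kappa>" and "regularCard \<kappa>" and "natLeq <o \<kappa>"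
    and "\<kappa> \<le>o |UNIV :: 'u set|"
    and "|UNIV :: 'l set| <o \<kappa>"
  shows "W_Cub \<kappa> = generated_localizer \<kappa> (p_maps \<kappa> :: ('u, 'u, 'u, 'u, 'l) ts_map set)"
proof -
  have large: "large_type TYPE('u) \<kappa>" by unfold_locales (use assms in blast)+
  let ?C = "{f \<in> rts_maps \<kappa>. \<exists>g. is_Cub_map \<kappa> f g \<and> g \<in> left_determined_weqs \<kappa>}
    :: ('u, 'u, 'u, 'u, 'l) ts_map set"
  \<comment> \<open>Both sides of the theorem are intersections of localizers, so it suffices that
    the same localizers contain the two generating classes.\<close>
  have "?C \<subseteq> W \<longleftrightarrow> p_maps \<kappa> \<subseteq> W" if W: "grothendieck_localizer \<kappa> W"
    for W :: "('u, 'u, 'u, 'u, 'l) ts_map set"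
  proof
    assume C: "?C \<subseteq> W"
    show "p_maps \<kappa> \<subseteq> W"
    proof
      fix f :: "('u, 'u, 'u, 'u, 'l) ts_map" assume f: "f \<in> p_maps \<kappa>"
      then have f': "f \<in> rts_maps \<kappa>" by (simp add: p_maps_def)
      have "ts_id (src f) \<in> W'" if "grothendieck_localizer \<kappa> W'" for W'
      proof -
        interpret localizer \<kappa> "TYPE('u)" W' by (intro localizer.intro localizer_axioms.intro large that)
        show ?thesis by (rule W_id[OF rts_mapsD(4)[OF f']])
      qed
      then have "ts_id (src f) \<in> left_determined_weqs \<kappa>"
        by (auto simp: left_determined_weqs_def generated_localizer_def)
      then show "f \<in> W" using C f' p_maps_Cub[OF f] by blast
    qed
  next
    assume "p_maps \<kappa> \<subseteq> W"
    then interpret p_localizer \<kappa> "TYPE('u)" W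
      by (intro p_localizer.intro p_localizer_axioms.intro localizer.intro localizer_axioms.intro large W)
    have "left_determined_weqs \<kappa> \<subseteq> W"
      using W by (auto simp: left_determined_weqs_def generated_localizer_def)
    then show "?C \<subseteq> W" using W_if_Cub by blast
  qed
  then show ?thesis unfolding W_Cub_def generated_localizer_def by blast
qed

end
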